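(* Let $f^0$ be a compactly supported probability density on $\mathbf U(d)\times\mathfrak{su}(d)$ (with respect to $\mu\otimes\gamma$), and set $$D^0:=\sup\{\|U-V\|_2\text{ s.t. }U\text{ and }V\in\mathrm{supp}(\rho_{f^0})\},\qquad \alpha:=\sup\{\|A-B\|_2\text{ s.t. }(U,A)\text{ and }(V,B)\in\mathrm{supp}(f^0)\}.$$ Consider coupling strengths $\kappa$ satisfying $$\kappa>(3/2)^{3/2}\alpha>0\quad\text{and}\quad 0<D^0<\zeta_2(\alpha/\kappa)$$ (it is assumed that such $\kappa$ exist), and for each such $\kappa$ let $f_\kappa$ be the weak solution with initial data $f^0$ of $$\partial_tf+\mathrm{div}_{U}(fAU)+\frac{\kappa}{2}\mathrm{div}_U\Big(f\int_{\mathbf U(d)\times\mathfrak{su}(d)}K(V,U)U\,f(t,V,B)\mu(dV)\gamma(dB)\Big)=0.$$ Then the family $f_\kappa$ exhibits practical synchronization, i.e. $$\lim_{\kappa\to+\infty}\ \limsup_{t\to+\infty}\ \Lambda[f_\kappa](t)=0.$$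
   Context: $\mathbf U(d)$: group of unitary $d\times d$ complex matrices; $\mathfrak{su}(d):=\{A\in M_d(\mathbb C):A+A^*=0\}$; $\|A\|_2=\mathrm{trace}(A^*A)^{1/2}$; $K(V,U):=VU^*-UV^*$. $\mu$ is the normalized Haar measure on $\mathbf U(d)$ and $\gamma$ is a Borel probability measure on the linear space $\mathfrak{su}(d)$ with positive density with respect to Lebesgue measure. $\rho_f(t,U):=\int_{\mathfrak{su}(d)}f(t,U,A)\gamma(dA)$, and likewise $\rho_{f^0}$. For $\eta\in[0,(2/3)^{3/2})$, $\zeta_2(\eta)$ denotes the largest root of $\tfrac12X^3-X+\eta$. $$\Lambda[f](t):=\int_{(\mathbf U(d)\times\mathfrak{su}(d))^2}\|U-V\|_2^2\,f(t,U,A)f(t,V,B)\,\mu(dU)\gamma(dA)\mu(dV)\gamma(dB).$$ The unknown $f(t,U,A)$ is a time-dependent probability density with respect to $\mu\otimes\gamma$, with $t\mapsto f(t,\cdot,\cdot)\,\mu\otimes\gamma$ weakly continuous on $[0,+\infty)$; the equation is understood weakly: for all $\phi\in C^1_c(\mathbf U(d)\times\mathfrak{su}(d))$, $\frac{d}{dt}\int\phi f\,d\mu d\gamma=\int\big(d_U\phi,(A+\frac\kappa2\int K(V,U)\rho_f(t,V)\mu(dV))U\big)f\,d\mu d\gamma$ in the sense of distributions on $(0,+\infty)$. *)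

theory Defs
  imports "HOL-Probability.Probability"
begin

section \<open>Matrices\<close>

definition ctranspose :: "complex^'n^'n \<Rightarrow> complex^'n^'n" where
  "ctranspose A = (\<chi> i j. cnj (A $ j $ i))"

text \<open>The library norm on \<^typ>\<open>complex^'n^'n\<close> is the norm written $\|A\|_2$ in the mathematics.\<close>

lemma trace_ctranspose_mult: "trace (ctranspose A ** A) = of_real ((norm A)\<^sup>2)"
proof -
  have "trace (ctranspose A ** A) = (\<Sum>i\<in>UNIV. \<Sum>k\<in>UNIV. of_real ((norm (A $ k $ i))\<^sup>2))"
    by (simp add: trace_def matrix_matrix_mult_def ctranspose_def complex_norm_square mult.commute
        del: of_real_power)
  also have "\<dots> = of_real (\<Sum>k\<in>UNIV. \<Sum>i\<in>UNIV. (norm (A $ k $ i))\<^sup>2)"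
    by (subst sum.swap) (simp only: of_real_sum)
  also have "(\<Sum>k\<in>UNIV. \<Sum>i\<in>UNIV. (norm (A $ k $ i))\<^sup>2) = (norm A)\<^sup>2"
    by (simp add: norm_vec_def L2_set_def sum_nonneg)
  finally show ?thesis .
qed

lemma norm_eq_sqrt_trace: "norm A = sqrt (Re (trace (ctranspose A ** A)))"
  by (simp add: trace_ctranspose_mult flip: of_real_power)

definition unitary_group :: "(complex^'n^'n) set" where
  "unitary_group = {U. U ** ctranspose U = mat 1 \<and> ctranspose U ** U = mat 1}"

definition skew_hermitian :: "(complex^'n^'n) set" where
  "skew_hermitian = {A. A + ctranspose A = 0}"

definition interaction :: "complex^'n^'n \<Rightarrow> complex^'n^'n \<Rightarrow> complex^'n^'n" where
  "interaction V U = V ** ctranspose U - U ** ctranspose V"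

text \<open>\<open>M \<mapsto> ((M - M\<^sup>T) + \<i>(M + M\<^sup>T)) / 2\<close> is a linear isometry from the real square
  matrices onto the skew-Hermitian matrices, so it transports Lebesgue measure.\<close>

definition skew_hermitian_coord :: "real^'n^'n \<Rightarrow> complex^'n^'n" where
  "skew_hermitian_coord M =
     (\<chi> i j. Complex ((M $ i $ j - M $ j $ i) / 2) ((M $ i $ j + M $ j $ i) / 2))"

lemma range_skew_hermitian_coord: "range skew_hermitian_coord = skew_hermitian"
proof
  show "range skew_hermitian_coord \<subseteq> skew_hermitian"
    by (auto simp: skew_hermitian_def skew_hermitian_coord_def ctranspose_def vec_eq_iff
        complex_eq_iff diff_divide_distrib add_divide_distrib)
  show "skew_hermitian \<subseteq> range skew_hermitian_coord"
  proof
    fix A :: "complex^'n^'n" assume "A \<in> skew_hermitian"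
    then have "(A + ctranspose A) $ i $ j = 0" for i j
      by (simp only: skew_hermitian_def mem_Collect_eq zero_index)
    then have sum0: "A $ i $ j + cnj (A $ j $ i) = 0" for i j
      by (simp only: ctranspose_def vector_add_component vec_lambda_beta)
    have *: "Re (A $ j $ i) = - Re (A $ i $ j)" "Im (A $ j $ i) = Im (A $ i $ j)" for i j
      using arg_cong[OF sum0[of i j], of Re] arg_cong[OF sum0[of i j], of Im] by simp_all
    have "A $ i $ j
        = skew_hermitian_coord (\<chi> i j. Re (A $ i $ j) + Im (A $ i $ j)) $ i $ j" for i j
      using *[of i j] by (simp add: skew_hermitian_coord_def complex_eq_iff)
    then have "A = skew_hermitian_coord (\<chi> i j. Re (A $ i $ j) + Im (A $ i $ j))"
      unfolding vec_eq_iff by blast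
    then show "A \<in> range skew_hermitian_coord" by blast
  qed
qed

lemma linear_skew_hermitian_coord: "linear skew_hermitian_coord"
  by (auto intro!: linearI simp: skew_hermitian_coord_def vec_eq_iff complex_eq_iff
      diff_divide_distrib add_divide_distrib right_diff_distrib distrib_left)

lemma norm_skew_hermitian_coord: "norm (skew_hermitian_coord M) = norm M"
proof -
  have "(\<Sum>i\<in>UNIV. \<Sum>j\<in>UNIV. (norm (skew_hermitian_coord M $ i $ j))\<^sup>2)
      = (\<Sum>i\<in>UNIV. \<Sum>j\<in>UNIV. (M $ i $ j)\<^sup>2 / 2 + (M $ j $ i)\<^sup>2 / 2)"
    by (intro sum.cong refl)
      (simp add: skew_hermitian_coord_def cmod_power2 power_divide power2_sum power2_diff
        add_divide_distrib diff_divide_distrib)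
  also have "\<dots> = (\<Sum>i\<in>UNIV. \<Sum>j\<in>UNIV. (M $ i $ j)\<^sup>2 / 2)
      + (\<Sum>i\<in>UNIV. \<Sum>j\<in>UNIV. (M $ j $ i)\<^sup>2 / 2)"
    by (simp add: sum.distrib)
  also have "(\<Sum>i\<in>UNIV. \<Sum>j\<in>UNIV. (M $ j $ i)\<^sup>2 / 2)
      = (\<Sum>i\<in>UNIV. \<Sum>j\<in>UNIV. (M $ i $ j)\<^sup>2 / 2)"
    by (rule sum.swap)
  finally have "(\<Sum>i\<in>UNIV. \<Sum>j\<in>UNIV. (norm (skew_hermitian_coord M $ i $ j))\<^sup>2)
      = (\<Sum>i\<in>UNIV. \<Sum>j\<in>UNIV. (M $ i $ j)\<^sup>2)"
    by (simp flip: sum.distrib)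
  then show ?thesis
    by (simp add: norm_vec_def L2_set_def sum_nonneg)
qed

section \<open>Reference measures\<close>

definition haar_unitary :: "(complex^'n^'n) measure \<Rightarrow> bool" where
  "haar_unitary \<mu> \<longleftrightarrow>
     sets \<mu> = sets (restrict_space borel unitary_group) \<and> prob_space \<mu> \<and>
     (\<forall>V\<in>unitary_group. distr \<mu> \<mu> (\<lambda>U. V ** U) = \<mu>)"

definition skew_hermitian_lebesgue :: "(complex^'n^'n) measure" where
  "skew_hermitian_lebesgue =
     distr lborel (restrict_space borel skew_hermitian) skew_hermitian_coord"

definition positive_density_prob :: "(complex^'n^'n) measure \<Rightarrow> bool" where
  "positive_density_prob \<gamma> \<longleftrightarrow> prob_space \<gamma> \<and>
     (\<exists>g\<in>borel_measurable (restrict_space borel skew_hermitian).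
        (\<forall>A\<in>skew_hermitian. 0 < g A) \<and>
        \<gamma> = density skew_hermitian_lebesgue (\<lambda>A. ennreal (g A)))"

section \<open>Densities and supports\<close>

definition prob_density :: "'a measure \<Rightarrow> ('a \<Rightarrow> real) \<Rightarrow> bool" where
  "prob_density M h \<longleftrightarrow> h \<in> borel_measurable M \<and> (AE x in M. 0 \<le> h x) \<and>
     prob_space (density M (\<lambda>x. ennreal (h x)))"

text \<open>A density is only determined almost everywhere: its support is that of the measure
  it defines, as a subset of the underlying space of \<open>M\<close>.\<close>

definition density_support :: "'a::topological_space measure \<Rightarrow> ('a \<Rightarrow> real) \<Rightarrow> 'a set" where
  "density_support M h = {x \<in> space M. \<forall>N. open N \<longrightarrow> x \<in> N \<longrightarrow>
     0 < emeasure (density M (\<lambda>y. ennreal (h y))) (N \<inter> space M)}"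

definition marginal ::
  "(complex^'n^'n) measure \<Rightarrow> ((complex^'n^'n) \<times> (complex^'n^'n) \<Rightarrow> real) \<Rightarrow> complex^'n^'n \<Rightarrow> real"
where
  "marginal \<gamma> h U = (\<integral>A. h (U, A) \<partial>\<gamma>)"

section \<open>Weak solutions\<close>

text \<open>Continuously differentiable functions on the submanifold $U(d) \times su(d)$ are expressed by a
  derivative within that set which can be chosen continuous. Such a \<open>\<phi>'\<close> is unique along tangent
  vectors, and only tangent vectors are fed to it below.\<close>

definition C1c_test ::
  "((complex^'n^'n) \<times> (complex^'n^'n) \<Rightarrow> real)
    \<Rightarrow> ((complex^'n^'n) \<times> (complex^'n^'n) \<Rightarrow> ((complex^'n^'n) \<times> (complex^'n^'n)) \<Rightarrow>\<^sub>L real) \<Rightarrow> bool"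
where
  "C1c_test \<phi> \<phi>' \<longleftrightarrow>
     (\<forall>p\<in>unitary_group \<times> skew_hermitian.
        (\<phi> has_derivative blinfun_apply (\<phi>' p)) (at p within unitary_group \<times> skew_hermitian)) \<and>
     continuous_on (unitary_group \<times> skew_hermitian) \<phi>' \<and>
     (\<exists>C. compact C \<and> (\<forall>p\<in>unitary_group \<times> skew_hermitian - C. \<phi> p = 0))"

definition smooth_time_test :: "(real \<Rightarrow> real) \<Rightarrow> bool" where
  "smooth_time_test \<psi> \<longleftrightarrow> (\<forall>n t. (deriv ^^ n) \<psi> field_differentiable (at t)) \<and>
     (\<exists>a b. 0 < a \<and> (\<forall>t. t \<notin> {a..b} \<longrightarrow> \<psi> t = 0))"

definition velocity ::
  "(complex^'n^'n) measure \<Rightarrow> (complex^'n^'n) measure \<Rightarrow> real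
    \<Rightarrow> ((complex^'n^'n) \<times> (complex^'n^'n) \<Rightarrow> real) \<Rightarrow> complex^'n^'n \<Rightarrow> complex^'n^'n \<Rightarrow> complex^'n^'n"
where
  "velocity \<mu> \<gamma> \<kappa> h U A =
     (A + (\<kappa> / 2) *\<^sub>R (\<integral>V. marginal \<gamma> h V *\<^sub>R interaction V U \<partial>\<mu>)) ** U"

definition weak_solution ::
  "(complex^'n^'n) measure \<Rightarrow> (complex^'n^'n) measure \<Rightarrow> real
    \<Rightarrow> ((complex^'n^'n) \<times> (complex^'n^'n) \<Rightarrow> real)
    \<Rightarrow> (real \<Rightarrow> (complex^'n^'n) \<times> (complex^'n^'n) \<Rightarrow> real) \<Rightarrow> bool"
where
  "weak_solution \<mu> \<gamma> \<kappa> f0 f \<longleftrightarrow>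
     (\<forall>t\<ge>0. prob_density (\<mu> \<Otimes>\<^sub>M \<gamma>) (f t)) \<and>
     (\<forall>\<phi> :: (complex^'n^'n) \<times> (complex^'n^'n) \<Rightarrow> real.
        continuous_on (unitary_group \<times> skew_hermitian) \<phi> \<longrightarrow>
        bounded (\<phi> ` (unitary_group \<times> skew_hermitian)) \<longrightarrow>
        continuous_on {0..} (\<lambda>t. \<integral>p. \<phi> p * f t p \<partial>(\<mu> \<Otimes>\<^sub>M \<gamma>))) \<and>
     (AE p in \<mu> \<Otimes>\<^sub>M \<gamma>. f 0 p = f0 p) \<and>
     (\<forall>\<phi> \<phi>' \<psi>. C1c_test \<phi> \<phi>' \<longrightarrow> smooth_time_test \<psi> \<longrightarrow>
        - (LINT t:{0<..}|lborel. deriv \<psi> t * (\<integral>p. \<phi> p * f t p \<partial>(\<mu> \<Otimes>\<^sub>M \<gamma>))) =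
        (LINT t:{0<..}|lborel. \<psi> t *
           (\<integral>(U, A). blinfun_apply (\<phi>' (U, A)) (velocity \<mu> \<gamma> \<kappa> (f t) U A, 0) * f t (U, A)
              \<partial>(\<mu> \<Otimes>\<^sub>M \<gamma>))))"

section \<open>Synchronization\<close>

definition dispersion ::
  "(complex^'n^'n) measure \<Rightarrow> (complex^'n^'n) measure
    \<Rightarrow> (real \<Rightarrow> (complex^'n^'n) \<times> (complex^'n^'n) \<Rightarrow> real) \<Rightarrow> real \<Rightarrow> real"
where
  "dispersion \<mu> \<gamma> f t =
     (\<integral>((U, A), (V, B)). (norm (U - V))\<^sup>2 * f t (U, A) * f t (V, B)
        \<partial>((\<mu> \<Otimes>\<^sub>M \<gamma>) \<Otimes>\<^sub>M (\<mu> \<Otimes>\<^sub>M \<gamma>)))"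

definition initial_diameter ::
  "(complex^'n^'n) measure \<Rightarrow> (complex^'n^'n) measure
    \<Rightarrow> ((complex^'n^'n) \<times> (complex^'n^'n) \<Rightarrow> real) \<Rightarrow> real"
where
  "initial_diameter \<mu> \<gamma> f0 =
     Sup {norm (U - V) | U V. U \<in> density_support \<mu> (marginal \<gamma> f0) \<and>
                              V \<in> density_support \<mu> (marginal \<gamma> f0)}"

definition frequency_diameter ::
  "(complex^'n^'n) measure \<Rightarrow> (complex^'n^'n) measure
    \<Rightarrow> ((complex^'n^'n) \<times> (complex^'n^'n) \<Rightarrow> real) \<Rightarrow> real"
where
  "frequency_diameter \<mu> \<gamma> f0 =
     Sup {norm (A - B) | A B U V. (U, A) \<in> density_support (\<mu> \<Otimes>\<^sub>M \<gamma>) f0 \<and>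
                                  (V, B) \<in> density_support (\<mu> \<Otimes>\<^sub>M \<gamma>) f0}"

definition zeta2 :: "real \<Rightarrow> real" where
  "zeta2 \<eta> = Max {x. 1 / 2 * x ^ 3 - x + \<eta> = 0}"

definition admissible_coupling ::
  "(complex^'n^'n) measure \<Rightarrow> (complex^'n^'n) measure
    \<Rightarrow> ((complex^'n^'n) \<times> (complex^'n^'n) \<Rightarrow> real) \<Rightarrow> real \<Rightarrow> bool"
where
  "admissible_coupling \<mu> \<gamma> f0 \<kappa> \<longleftrightarrow>
     (3 / 2) powr (3 / 2) * frequency_diameter \<mu> \<gamma> f0 < \<kappa> \<and>
     0 < (3 / 2) powr (3 / 2) * frequency_diameter \<mu> \<gamma> f0 \<and>
     0 < initial_diameter \<mu> \<gamma> f0 \<and>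
     initial_diameter \<mu> \<gamma> f0 < zeta2 (frequency_diameter \<mu> \<gamma> f0 / \<kappa>)"

end

theory Submission
  imports Defs
begin

text \<open>
  The interaction is linear in the distribution, so it only depends on the mean
  $m(t) = \int V f(t, V, B)$, and the velocity is $AU + \frac\kappa2 (m - U m^* U)$. For unitary $U, V, W$
  and $X = U - V$ one has
  $\mathrm{Re}\,\mathrm{tr}\, X^*(UW^*U - VW^*V) = \mathrm{Re}\,\mathrm{tr}\, X^*X(U^*W + V^*W)
    \ge \|X\|_2^2 (2 - \frac12\|U-W\|_2^2 - \frac12\|V-W\|_2^2)$.
  Hence $r^2 = \|U-V\|_2^2$ decays along a pair of particles, up to a term $2 \alpha r$, as long as all
  distances stay below $\sqrt 2$.

  Characteristics are avoided. Instead one differentiates $\int\!\int g(\|U-V\|_2^2) f f$, first for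
  polynomials $g$, where the weak formulation gives the derivative exactly, and then for
  $g(x) = ((x - (D^0)^2)_+)^2$ by Weierstrass approximation of $g'$. If $\alpha \le \kappa D^0(1 - (D^0)^2/2)$,
  a Gronwall inequality shows that this functional stays $0$: the diameter of the support in $U$ never
  exceeds $D^0$. With $c = \kappa(1 - (D^0)^2/2)$ the choice $g(x) = x$ then gives
  $\Lambda' \le \alpha^2/c - c\Lambda$, so that $\limsup \Lambda \le (\alpha/c)^2 = O(\kappa^{-2})$.
\<close>

section \<open>Unitary and skew-Hermitian matrices\<close>

text \<open>The solution is known only through integrals of one-particle test functions, with time
  derivatives in the sense of distributions, so supports and trajectories cannot be followed
  directly. The diameter argument also looks circular: the contraction rate of a pair depends on its
  mean squared distances to all particles, and these are at most D^2 only if the bound to be proved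
  already holds. What breaks the circle is that the excess over D^2 enters to second order. The rate
  is off by at most a mean excess, this is multiplied by \<open>g'\<close>, again an excess, and the
  product is dominated by squared excesses, that is by the functional itself. Squaring the positive
  part also makes \<open>g'\<close> continuous, as Weierstrass requires.

  The condition on \<alpha> says that the cubic of \<open>zeta2\<close> with \<eta> =
  \<alpha>/\<kappa> is nonpositive at D^0. It can fail for an admissible \<kappa> when D^0 lies
  below the smaller positive root. But one admissible \<kappa> forces (D^0)^2 < 2, and for this
  fixed D^0 the condition holds for all large \<kappa>, which is all the limit sees.\<close>

lemma ctranspose_matrix_mult: "ctranspose (A ** B) = ctranspose B ** ctranspose A"
  by (simp add: ctranspose_def matrix_matrix_mult_def vec_eq_iff mult.commute)

lemma ctranspose_ctranspose [simp]: "ctranspose (ctranspose A) = A"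
  by (simp add: ctranspose_def vec_eq_iff)

lemma ctranspose_add: "ctranspose (A + B) = ctranspose A + ctranspose B"
  by (simp add: ctranspose_def vec_eq_iff)

lemma ctranspose_scaleR: "ctranspose (r *\<^sub>R A) = r *\<^sub>R ctranspose A"
  by (simp add: ctranspose_def vec_eq_iff)

lemma ctranspose_diff: "ctranspose (A - B) = ctranspose A - ctranspose B"
  by (simp add: ctranspose_def vec_eq_iff)

lemma inner_ctranspose: "ctranspose A \<bullet> ctranspose B = A \<bullet> B" for A B :: "complex^'n^'n"
  unfolding inner_vec_def ctranspose_def
  by (subst sum.swap) (simp add: inner_complex_def)

text \<open>On complex matrices \<bullet> is the real inner product Re tr (A^H B), where A^H stands
  for \<open>ctranspose A\<close>. Left multiplication by A therefore has left multiplication by A^H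
  as its adjoint.\<close>

lemma inner_matrix_mult_left: "(A ** B) \<bullet> C = B \<bullet> (ctranspose A ** C)"
  for A B C :: "complex^'n^'n"
proof -
  have c: "(a * b) \<bullet> c = b \<bullet> (cnj a * c)" for a b c :: complex
    by (simp add: inner_complex_def algebra_simps)
  have "(A ** B) \<bullet> C = (\<Sum>i\<in>UNIV. \<Sum>j\<in>UNIV. \<Sum>k\<in>UNIV. (A$i$k * B$k$j) \<bullet> (C$i$j))"
    by (simp add: inner_vec_def matrix_matrix_mult_def inner_sum_left)
  also have "\<dots> = (\<Sum>k\<in>UNIV. \<Sum>j\<in>UNIV. \<Sum>i\<in>UNIV. (A$i$k * B$k$j) \<bullet> (C$i$j))"
    by (subst sum.swap, subst (2) sum.swap, subst sum.swap) (rule refl)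
  also have "\<dots> = B \<bullet> (ctranspose A ** C)"
    by (simp add: inner_vec_def matrix_matrix_mult_def inner_sum_right ctranspose_def c)
  finally show ?thesis .
qed

lemma inner_matrix_mult_right: "(A ** B) \<bullet> C = A \<bullet> (C ** ctranspose B)"
  for A B C :: "complex^'n^'n"
  using inner_matrix_mult_left[of "ctranspose B" "ctranspose A" "ctranspose C"]
  by (metis ctranspose_ctranspose ctranspose_matrix_mult inner_ctranspose)

lemma norm_matrix_mult_le: "norm (A ** B) \<le> norm A * norm B" for A B :: "complex^'n^'n"
proof -
  have n: "(norm M)\<^sup>2 = (\<Sum>i\<in>UNIV. \<Sum>j\<in>UNIV. (norm (M$i$j))\<^sup>2)" for M :: "complex^'n^'n"
    by (simp add: norm_vec_def L2_set_def sum_nonneg)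
  have "(norm ((A ** B)$i$j))\<^sup>2 \<le> (\<Sum>k\<in>UNIV. (norm (A$i$k))\<^sup>2) * (\<Sum>k\<in>UNIV. (norm (B$k$j))\<^sup>2)" for i j
  proof -
    have "norm ((A ** B)$i$j) \<le> (\<Sum>k\<in>UNIV. norm (A$i$k) * norm (B$k$j))"
      unfolding matrix_matrix_mult_def by (simp add: sum_norm_le norm_mult)
    then have "(norm ((A ** B)$i$j))\<^sup>2 \<le> (\<Sum>k\<in>UNIV. norm (A$i$k) * norm (B$k$j))\<^sup>2"
      by (intro power_mono) auto
    also have "\<dots> \<le> (\<Sum>k\<in>UNIV. (norm (A$i$k))\<^sup>2) * (\<Sum>k\<in>UNIV. (norm (B$k$j))\<^sup>2)"
      by (rule Cauchy_Schwarz_ineq_sum)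
    finally show ?thesis .
  qed
  then have "(norm (A ** B))\<^sup>2
      \<le> (\<Sum>i\<in>UNIV. \<Sum>j\<in>UNIV. (\<Sum>k\<in>UNIV. (norm (A$i$k))\<^sup>2) * (\<Sum>k\<in>UNIV. (norm (B$k$j))\<^sup>2))"
    unfolding n by (intro sum_mono)
  also have "\<dots> = (norm A * norm B)\<^sup>2"
    unfolding n[of A] power_mult_distrib n[of B] sum.swap[of "\<lambda>i j. (norm (B$i$j))\<^sup>2"]
    by (rule sum_product[symmetric])
  finally show ?thesis
    using power2_le_imp_le by force
qed

lemma bounded_bilinear_matrix_mult:
  "bounded_bilinear ((**) :: complex^'n^'n \<Rightarrow> complex^'n^'n \<Rightarrow> complex^'n^'n)"
proof
  show "\<exists>K. \<forall>(a :: complex^'n^'n) (b :: complex^'n^'n). norm (a ** b) \<le> norm a * norm b * K"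
    by (rule exI[of _ 1]) (simp add: norm_matrix_mult_le)
qed (simp_all add: matrix_matrix_mult_def vec_eq_iff algebra_simps sum.distrib scaleR_sum_right)

interpretation matrix_mult: bounded_bilinear
  "(**) :: complex^'n^'n \<Rightarrow> complex^'n^'n \<Rightarrow> complex^'n^'n"
  by (rule bounded_bilinear_matrix_mult)

lemma bounded_linear_ctranspose: "bounded_linear (ctranspose :: complex^'n^'n \<Rightarrow> _)"
proof (rule bounded_linear_intro[where K = 1])
  show "norm (ctranspose x :: complex^'n^'n) \<le> norm x * 1" for x :: "complex^'n^'n"
    by (simp add: norm_eq_sqrt_inner inner_ctranspose)
qed (simp_all add: ctranspose_add ctranspose_scaleR)

lemmas continuous_on_matrix_mult [continuous_intros] = matrix_mult.continuous_on
lemmas continuous_on_ctranspose [continuous_intros] =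
  bounded_linear.continuous_on[OF bounded_linear_ctranspose]

lemma unitary_groupD:
  assumes "U \<in> unitary_group"
  shows "U ** ctranspose U = mat 1" "ctranspose U ** U = mat 1"
    "U ** (ctranspose U ** Z) = Z" "ctranspose U ** (U ** Z) = Z"
  using assms by (simp_all add: unitary_group_def matrix_mul_assoc)

lemma norm_unitary:
  assumes "U \<in> unitary_group"
  shows "norm (U :: complex^'n^'n) = norm (mat 1 :: complex^'n^'n)"
  using inner_matrix_mult_left[of U "mat 1" U]
  by (simp add: norm_eq_sqrt_inner unitary_groupD[OF assms])

lemma norm_mult_unitary:
  assumes "P \<in> unitary_group"
  shows "norm (X ** P) = norm (X :: complex^'n^'n)" "norm (P ** X) = norm X"
proof -
  show "norm (X ** P) = norm X"
    using inner_matrix_mult_right[of X P "X ** P"]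
    by (simp add: norm_eq_sqrt_inner unitary_groupD[OF assms] flip: matrix_mul_assoc)
  show "norm (P ** X) = norm X"
    using inner_matrix_mult_left[of P X "P ** X"]
    by (simp add: norm_eq_sqrt_inner unitary_groupD[OF assms])
qed

lemma ctranspose_unitary: "U \<in> unitary_group \<Longrightarrow> ctranspose U \<in> unitary_group"
  by (simp add: unitary_group_def)

lemma unitary_mult:
  assumes U: "U \<in> unitary_group" and V: "V \<in> unitary_group"
  shows "U ** V \<in> unitary_group"
proof -
  have "(U ** V) ** ctranspose (U ** V) = U ** (V ** (ctranspose V ** ctranspose U))"
    "ctranspose (U ** V) ** (U ** V) = ctranspose V ** (ctranspose U ** (U ** V))"
    by (simp_all add: ctranspose_matrix_mult flip: matrix_mul_assoc)
  then show ?thesis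
    by (simp add: unitary_group_def unitary_groupD[OF U] unitary_groupD[OF V])
qed

lemma compact_unitary_group: "compact (unitary_group :: (complex^'n^'n) set)"
proof -
  have "closed {U :: complex^'n^'n. U ** ctranspose U = mat 1 \<and> ctranspose U ** U = mat 1}"
    by (intro closed_Collect_conj closed_Collect_eq continuous_intros)
  moreover have "bounded (unitary_group :: (complex^'n^'n) set)"
    by (rule boundedI[where B = "norm (mat 1 :: complex^'n^'n)"]) (simp add: norm_unitary)
  ultimately show ?thesis
    by (simp add: compact_eq_bounded_closed unitary_group_def)
qed

section \<open>Drift and interaction paired with the difference of two states\<close>

lemma inner_skew_hermitian_mult:
  fixes X :: "complex^'n^'n"
  assumes "A \<in> skew_hermitian"
  shows "X \<bullet> (A ** X) = 0"
proof -
  have "ctranspose A = - A"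
    using assms by (simp add: skew_hermitian_def eq_neg_iff_add_eq_0 add.commute)
  then have "(A ** X) \<bullet> X = - (X \<bullet> (A ** X))"
    using inner_matrix_mult_left[of A X X] by (simp add: matrix_mult.minus_left)
  then show ?thesis by (simp add: inner_commute)
qed

text \<open>Polarization: X \<bullet> XP is half of |X|^2 + |XP|^2 - |X(1 - P)|^2. Here |XP| = |X|
  because P is unitary, and submultiplicativity bounds the last term.\<close>

lemma inner_mult_unitary_ge:
  fixes X :: "complex^'n^'n"
  assumes "P \<in> unitary_group"
  shows "X \<bullet> (X ** P) \<ge> (norm X)\<^sup>2 * (1 - (norm (mat 1 - P))\<^sup>2 / 2)"
proof -
  have "(norm (X ** (mat 1 - P)))\<^sup>2 \<le> (norm X * norm (mat 1 - P))\<^sup>2"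
    by (intro power_mono norm_matrix_mult_le norm_ge_zero)
  moreover have "(norm (X ** (mat 1 - P)))\<^sup>2 = (norm X)\<^sup>2 + (norm (X ** P))\<^sup>2 - 2 * (X \<bullet> (X ** P))"
    by (simp add: matrix_mult.diff_right power2_norm_eq_inner inner_diff inner_commute)
  ultimately show ?thesis
    by (simp add: norm_mult_unitary[OF assms] power_mult_distrib algebra_simps)
qed

text \<open>Adjoints bring both sides into the form Z \<bullet> W. With X = U - V, comparing the two
  matrices Z leaves U X^H U - V X^H V = (U + V) X^H X, which follows from unitarity by
  expanding.\<close>

lemma interaction_inner_eq:
  fixes U V W :: "complex^'n^'n"
  assumes U: "U \<in> unitary_group" and V: "V \<in> unitary_group"
  shows "(U - V) \<bullet> (U ** ctranspose W ** U - V ** ctranspose W ** V) =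
    (U - V) \<bullet> ((U - V) ** (ctranspose U ** W)) + (U - V) \<bullet> ((U - V) ** (ctranspose V ** W))"
proof -
  have 1: "X \<bullet> (Y ** ctranspose W ** Y) = (Y ** ctranspose X ** Y) \<bullet> W" for X Y :: "complex^'n^'n"
  proof -
    have "(Y ** ctranspose X ** Y) \<bullet> W = ctranspose X \<bullet> (ctranspose Y ** (W ** ctranspose Y))"
      by (simp only: inner_matrix_mult_right[of "Y ** ctranspose X"] inner_matrix_mult_left[of Y])
    also have "\<dots> = ctranspose X \<bullet> ctranspose (Y ** ctranspose W ** Y)"
      by (simp add: ctranspose_matrix_mult matrix_mul_assoc)
    finally show ?thesis by (simp add: inner_ctranspose)
  qed
  have 2: "X \<bullet> (X ** (ctranspose Y ** W)) = (Y ** ctranspose X ** X) \<bullet> W" for X Y :: "complex^'n^'n"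
  proof -
    have "(Y ** ctranspose X ** X) \<bullet> W = (ctranspose X ** X) \<bullet> (ctranspose Y ** W)"
      by (simp add: inner_matrix_mult_left flip: matrix_mul_assoc)
    also have "\<dots> = X \<bullet> (X ** (ctranspose Y ** W))"
      by (simp add: inner_matrix_mult_left)
    finally show ?thesis by simp
  qed
  show ?thesis
    unfolding inner_diff_right 1 2
    unfolding inner_diff_left[symmetric] inner_add_left[symmetric]
    by (rule arg_cong[where f = "\<lambda>Z. Z \<bullet> W"])
      (simp add: ctranspose_diff matrix_mult.diff_left matrix_mult.diff_right
        unitary_groupD[OF U] unitary_groupD[OF V] flip: matrix_mul_assoc)
qed

text \<open>The lower bound for X \<bullet> XP with P = U^H W and with P = V^H W. Unitary invariance
  of the norm (\<open>n\<close>) turns the distance of P from the identity into the distance of the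
  two states.\<close>

lemma interaction_inner_ge:
  fixes U V W :: "complex^'n^'n"
  assumes U: "U \<in> unitary_group" and V: "V \<in> unitary_group" and W: "W \<in> unitary_group"
  shows "(U - V) \<bullet> (U ** ctranspose W ** U - V ** ctranspose W ** V) \<ge>
    (norm (U - V))\<^sup>2 * (2 - (norm (U - W))\<^sup>2 / 2 - (norm (V - W))\<^sup>2 / 2)"
proof -
  have n: "norm (mat 1 - ctranspose Y ** W) = norm (Y - W)" if "Y \<in> unitary_group"
    for Y :: "complex^'n^'n"
    using norm_mult_unitary(2)[OF ctranspose_unitary[OF that], of "Y - W"]
    by (simp add: matrix_mult.diff_right unitary_groupD[OF that])
  show ?thesis
    using inner_mult_unitary_ge[OF unitary_mult[OF ctranspose_unitary[OF U] W], of "U - V"]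
      inner_mult_unitary_ge[OF unitary_mult[OF ctranspose_unitary[OF V] W], of "U - V"]
    unfolding interaction_inner_eq[OF U V] n[OF U] n[OF V]
    by (simp add: algebra_simps)
qed

text \<open>Splitting AU - BV = A(U - V) + (A - B)V, the first part is an infinitesimal rotation of
  U - V and is orthogonal to it, so only the difference of the frequencies counts.\<close>

lemma drift_inner_le:
  fixes U V A B :: "complex^'n^'n"
  assumes "V \<in> unitary_group" and A: "A \<in> skew_hermitian"
  shows "(U - V) \<bullet> (A ** U - B ** V) \<le> norm (U - V) * norm (A - B)"
proof -
  have "A ** U - B ** V = A ** (U - V) + (A - B) ** V"
    by (simp add: matrix_mult.diff_left matrix_mult.diff_right)
  then have "(U - V) \<bullet> (A ** U - B ** V) = (U - V) \<bullet> ((A - B) ** V)"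
    by (simp add: inner_add_right inner_skew_hermitian_mult[OF A])
  also have "\<dots> \<le> norm (U - V) * norm ((A - B) ** V)"
    by (rule norm_cauchy_schwarz)
  finally show ?thesis
    by (simp add: norm_mult_unitary[OF assms(1)])
qed

section \<open>Differential inequalities and derivatives in the sense of distributions\<close>

text \<open>The integrating factor exp (-Lt) makes u + c/L nonincreasing. Differentiability is asked
  only at interior times because the weak formulation says nothing at t = 0. The sign of L is left
  open: growth is needed for the diameter, decay for the dispersion.\<close>

lemma gronwall_affine:
  fixes u :: "real \<Rightarrow> real"
  assumes T: "0 \<le> T" and cont: "continuous_on {0..T} u" and L: "L \<noteq> 0"
    and deriv: "\<And>t. 0 < t \<Longrightarrow> t < T \<Longrightarrow> \<exists>y. (u has_real_derivative y) (at t) \<and> y \<le> L * u t + c"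
  shows "u T \<le> (u 0 + c / L) * exp (L * T) - c / L"
proof -
  define w where "w t = (u t + c / L) * exp (- (L * t))" for t
  have "w T \<le> w 0"
  proof (rule DERIV_nonpos_imp_decreasing_open[OF T])
    show "continuous_on {0..T} w"
      unfolding w_def by (intro continuous_intros cont)
    fix t assume "0 < t" "t < T"
    then obtain y where y: "(u has_real_derivative y) (at t)" "y \<le> L * u t + c"
      using deriv by blast
    have "(w has_real_derivative (y - (L * u t + c)) * exp (- (L * t))) (at t)"
      unfolding w_def using L by (auto intro!: derivative_eq_intros y simp: field_simps)
    then show "\<exists>y. (w has_real_derivative y) (at t) \<and> y \<le> 0"
      using y(2) by (intro exI conjI) (auto intro: mult_nonpos_nonneg)
  qed
  then have "(u T + c / L) * exp (- (L * T)) \<le> u 0 + c / L"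
    by (simp add: w_def)
  then have "(u T + c / L) * exp (- (L * T)) * exp (L * T) \<le> (u 0 + c / L) * exp (L * T)"
    by (intro mult_right_mono) auto
  then show ?thesis
    by (simp add: mult.assoc flip: exp_add)
qed

text \<open>Test functions in time must be smooth, so a bump function is needed. It is built from
  $x \mapsto p(1/x) e^{-1/x}$, a class that differentiation maps to itself.\<close>

definition flat_exp :: "real poly \<Rightarrow> real \<Rightarrow> real" where
  "flat_exp p x = (if x \<le> 0 then 0 else poly p (1 / x) * exp (- (1 / x)))"

lemma tendsto_poly_times_exp_minus: "((\<lambda>y. poly p y * exp (- y)) \<longlongrightarrow> (0::real)) at_top"
proof -
  have "((\<lambda>y. \<Sum>i\<le>degree p. coeff p i * (y ^ i / exp y)) \<longlongrightarrow> (\<Sum>i\<le>degree p. coeff p i * 0)) at_top"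
    by (intro tendsto_intros tendsto_power_div_exp_0)
  then show ?thesis
    by (simp add: poly_altdef sum_distrib_right exp_minus divide_inverse mult.assoc)
qed

text \<open>With y = 1/x one has dy/dx = -y^2, so p(y) exp (-y) has derivative y^2 (p(y) - p'(y))
  exp (-y), and \<open>[:0, 0, 1:]\<close> is the factor y^2. At 0 the right difference quotient is
  y p(y) exp (-y), which tends to 0 as y grows.\<close>

lemma flat_exp_has_derivative:
  "(flat_exp p has_real_derivative flat_exp ([:0, 0, 1:] * (p - pderiv p)) x) (at x)"
proof -
  consider "x < 0" | "x > 0" | "x = 0" by linarith
  then show ?thesis
  proof cases
    case 1
    have "((\<lambda>x. 0) has_real_derivative 0) (at x)" by simp
    then have "(flat_exp p has_real_derivative 0) (at x)"
      using 1 by (elim has_field_derivative_transform_within_open[of _ _ x "{..<0}"])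
        (auto simp: flat_exp_def)
    then show ?thesis using 1 by (simp add: flat_exp_def)
  next
    case 2
    have "((\<lambda>x. poly p (1 / x) * exp (- (1 / x))) has_real_derivative
      poly ([:0, 0, 1:] * (p - pderiv p)) (1 / x) * exp (- (1 / x))) (at x)"
      using 2 by (auto intro!: derivative_eq_intros poly_DERIV simp: field_simps power2_eq_square)
    then have "(flat_exp p has_real_derivative
      poly ([:0, 0, 1:] * (p - pderiv p)) (1 / x) * exp (- (1 / x))) (at x)"
      using 2 by (elim has_field_derivative_transform_within_open[of _ _ x "{0<..}"])
        (auto simp: flat_exp_def)
    then show ?thesis using 2 by (simp add: flat_exp_def)
  next
    case 3
    have "((\<lambda>h. poly ([:0, 1:] * p) (1 / h) * exp (- (1 / h))) \<longlongrightarrow> 0) (at_right (0::real))"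
      using filterlim_compose[OF tendsto_poly_times_exp_minus[of "[:0, 1:] * p"] filterlim_inverse_at_top_right]
      by (simp add: inverse_eq_divide)
    then have "((\<lambda>h. flat_exp p h / h) \<longlongrightarrow> 0) (at_right 0)"
      by (rule Lim_transform_eventually)
        (auto simp: eventually_at_filter flat_exp_def)
    moreover have "((\<lambda>h. flat_exp p h / h) \<longlongrightarrow> 0) (at_left 0)"
      by (rule Lim_transform_eventually[OF tendsto_const])
        (auto simp: eventually_at_filter flat_exp_def)
    ultimately show ?thesis
      unfolding DERIV_def 3 by (simp add: filterlim_at_split flat_exp_def)
  qed
qed

text \<open>One factor vanishes left of -\<epsilon>, the other right of \<epsilon>. Differentiating
  a product gives a sum of two products of the same shape, so closing under sums makes the class
  stable under differentiation.\<close>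

inductive_set bump_space :: "real \<Rightarrow> (real \<Rightarrow> real) set" for \<epsilon> where
  prod: "(\<lambda>x. flat_exp p (x + \<epsilon>) * flat_exp q (\<epsilon> - x)) \<in> bump_space \<epsilon>"
| add: "f \<in> bump_space \<epsilon> \<Longrightarrow> g \<in> bump_space \<epsilon> \<Longrightarrow> (\<lambda>x. f x + g x) \<in> bump_space \<epsilon>"

lemma bump_space_deriv:
  assumes "f \<in> bump_space \<epsilon>"
  shows "\<exists>f'\<in>bump_space \<epsilon>. \<forall>x. (f has_real_derivative f' x) (at x)"
  using assms
proof induction
  case (prod p q)
  define D where "D p = [:0, 0, 1:] * (p - pderiv p)" for p :: "real poly"
  have neg: "flat_exp (- r) x = - flat_exp r x" for r x
    by (simp add: flat_exp_def)
  have 1: "((\<lambda>x. flat_exp p (x + \<epsilon>)) has_real_derivative flat_exp (D p) (x + \<epsilon>)) (at x)" for x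
    unfolding D_def by (rule DERIV_shift[THEN iffD1, OF flat_exp_has_derivative])
  have 2: "((\<lambda>x. flat_exp q (\<epsilon> - x)) has_real_derivative flat_exp (- D q) (\<epsilon> - x)) (at x)" for x
  proof -
    have "((\<lambda>x. \<epsilon> - x) has_real_derivative - 1) (at x)"
      by (auto intro!: derivative_eq_intros)
    from DERIV_chain2[OF flat_exp_has_derivative[of q "\<epsilon> - x"] this]
    show ?thesis by (simp only: neg D_def mult_minus1_right)
  qed
  show ?case
  proof (intro bexI allI)
    fix x
    show "((\<lambda>x. flat_exp p (x + \<epsilon>) * flat_exp q (\<epsilon> - x)) has_real_derivative
      flat_exp (D p) (x + \<epsilon>) * flat_exp q (\<epsilon> - x) + flat_exp p (x + \<epsilon>) * flat_exp (- D q) (\<epsilon> - x)) (at x)"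
      using DERIV_mult[OF 1[of x] 2[of x]] by (simp add: algebra_simps)
  qed (intro bump_space.intros)
next
  case (add f g)
  then obtain f' g' where "f' \<in> bump_space \<epsilon>" "\<forall>x. (f has_real_derivative f' x) (at x)"
    "g' \<in> bump_space \<epsilon>" "\<forall>x. (g has_real_derivative g' x) (at x)" by blast
  then show ?case
    by (intro bexI[of _ "\<lambda>x. f' x + g' x"]) (auto intro: DERIV_add bump_space.intros)
qed

text \<open>Smoothness of time tests is stated through iterates of \<open>deriv\<close>; a class
  stable under differentiation settles all orders at once, without formulas for higher
  derivatives.\<close>

lemma smooth_if_closed_under_deriv:
  fixes S :: "(real \<Rightarrow> real) set"
  assumes S: "\<And>f. f \<in> S \<Longrightarrow> \<exists>f'\<in>S. \<forall>x. (f has_real_derivative f' x) (at x)" and f: "f \<in> S"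
  shows "(deriv ^^ n) f field_differentiable (at t)"
proof -
  have "deriv g \<in> S" if g: "g \<in> S" for g
  proof -
    obtain g' where "g' \<in> S" "\<forall>x. (g has_real_derivative g' x) (at x)"
      using S[OF g] by blast
    moreover from this have "deriv g = g'" by (intro ext DERIV_imp_deriv) auto
    ultimately show ?thesis by simp
  qed
  then have "(deriv ^^ n) f \<in> S" by (induction n) (auto simp: f)
  then show ?thesis using S field_differentiable_def by blast
qed

text \<open>The primitive \<open>G\<close> is supplied as well: a difference of two translates of
  \<open>G\<close> is a compactly supported test function whose derivative is a difference of two
  bumps.\<close>

lemma bump_exists:
  assumes "0 < \<epsilon>"
  obtains \<beta> G :: "real \<Rightarrow> real" where "\<beta> \<in> bump_space \<epsilon>" "\<And>x. (G has_real_derivative \<beta> x) (at x)"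
    "\<And>x. \<beta> x \<ge> 0" "\<beta> 0 > 0" "\<And>x. \<epsilon> \<le> \<bar>x\<bar> \<Longrightarrow> \<beta> x = 0" "continuous_on UNIV \<beta>"
proof -
  define \<beta> where "\<beta> x = flat_exp 1 (x + \<epsilon>) * flat_exp 1 (\<epsilon> - x)" for x
  have mem: "\<beta> \<in> bump_space \<epsilon>"
    unfolding \<beta>_def by (rule bump_space.prod)
  have cont: "isCont \<beta> x" for x
    using bump_space_deriv[OF mem] DERIV_isCont by blast
  obtain G where "\<forall>x. - \<infinity> < ereal x \<longrightarrow> ereal x < \<infinity> \<longrightarrow> (G has_vector_derivative \<beta> x) (at x)"
    using einterval_antiderivative[of "-\<infinity>" "\<infinity>" \<beta>] cont by auto
  then have "(G has_real_derivative \<beta> x) (at x)" for x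
    by (simp add: has_real_derivative_iff_has_vector_derivative)
  moreover have "\<beta> x \<ge> 0" for x by (simp add: \<beta>_def flat_exp_def)
  moreover have "\<beta> 0 > 0" using assms by (simp add: \<beta>_def flat_exp_def)
  moreover have "\<beta> x = 0" if "\<epsilon> \<le> \<bar>x\<bar>" for x
    using that by (auto simp: \<beta>_def flat_exp_def)
  ultimately show ?thesis
    using that[of \<beta> G, OF mem] cont by (simp add: continuous_at_imp_continuous_on)
qed

lemma smooth_time_testD:
  assumes "smooth_time_test \<psi>"
  obtains a b where "0 < a" "a < b" "\<And>t. t \<notin> {a<..<b} \<Longrightarrow> \<psi> t = 0"
    "\<And>t. t \<notin> {a<..<b} \<Longrightarrow> deriv \<psi> t = 0" "\<And>t. (\<psi> has_real_derivative deriv \<psi> t) (at t)"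
    "continuous_on UNIV \<psi>" "continuous_on UNIV (deriv \<psi>)"
proof -
  have d: "(deriv ^^ n) \<psi> field_differentiable (at t)" for n t
    using assms by (auto simp: smooth_time_test_def)
  obtain a b where ab: "0 < a" "\<And>t. t \<notin> {a..b} \<Longrightarrow> \<psi> t = 0"
    using assms by (auto simp: smooth_time_test_def)
  have der: "(\<psi> has_real_derivative deriv \<psi> t) (at t)" for t
    using d[of 0 t] by (simp add: field_differentiable_derivI)
  have z: "deriv \<psi> t = 0" if "t \<notin> {a..b}" for t
  proof (rule DERIV_imp_deriv, rule has_field_derivative_transform_within_open)
    show "((\<lambda>x. 0) has_real_derivative 0) (at t)" by simp
    show "open (- {a..b})" by auto
  qed (use that ab in auto)
  have cd: "continuous_on UNIV (deriv \<psi>)"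
    using d[of 1] by (auto intro!: continuous_at_imp_continuous_on field_differentiable_imp_continuous_at)
  have c: "continuous_on UNIV \<psi>"
    using der by (auto intro!: continuous_at_imp_continuous_on DERIV_isCont)
  show ?thesis
  \<comment> \<open>The interval is enlarged so that \<psi> and its derivative vanish at the
    endpoints too, and so that it is nonempty even if \<open>{a..b}\<close> was empty.\<close>
  proof (rule that[of "a / 2" "max a b + 1"])
    fix t assume "t \<notin> {a / 2<..<max a b + 1}"
    then have "t \<notin> {a..b}" using ab(1) by auto
    then show "\<psi> t = 0" "deriv \<psi> t = 0" using ab z by blast+
  qed (use ab(1) in \<open>auto intro: der c cd\<close>)
qed

section \<open>From distributional to classical derivatives in time\<close>

lemma set_integral_eq_integral_if_supported:
  fixes F :: "real \<Rightarrow> real"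
  assumes "0 < a" and z: "\<And>t. t \<notin> {a<..<b} \<Longrightarrow> F t = 0" and c: "continuous_on {a..b} F"
  shows "(LINT t:{0<..}|lborel. F t) = integral {a..b} F"
proof -
  have "(LINT t:{0<..}|lborel. F t) = (LINT t:{a..b}|lborel. F t)"
    unfolding set_lebesgue_integral_def
    by (intro Bochner_Integration.integral_cong refl) (use z assms(1) in \<open>force simp: indicator_def\<close>)
  also have "\<dots> = integral {a..b} F"
    by (rule set_borel_integral_eq_integral[OF borel_integrable_atLeastAtMost'[OF c]])
  finally show ?thesis .
qed

text \<open>Test with \<psi> whose derivative is a bump at s minus a bump at t. Since \<psi>' has
  integral 0, the integral of \<psi>' (c - H) vanishes for the midpoint c of H s and H t. Near s one
  has H < c and near t one has c < H, so the integrand is nonnegative and hence identically 0, which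
  is false at s.\<close>

lemma weakly_constant_not_less:
  fixes H :: "real \<Rightarrow> real"
  assumes cont: "continuous_on {0<..} H"
    and weak: "\<And>\<psi>. smooth_time_test \<psi> \<Longrightarrow> (LINT t:{0<..}|lborel. deriv \<psi> t * H t) = 0"
    and st: "0 < s" "0 < t" "s \<noteq> t"
  shows "\<not> H s < H t"
proof
  assume less: "H s < H t"
  define c where "c = (H s + H t) / 2"
  have c: "H s < c" "c < H t" using less by (auto simp: c_def)
  have isC: "isCont H x" if "0 < x" for x
    using cont that by (simp add: continuous_on_eq_continuous_at)
  have "\<exists>e>0. \<forall>x. \<bar>x - s\<bar> < e \<longrightarrow> H x < c"
    using order_tendstoD(2)[OF isC[OF st(1), unfolded isCont_def tendsto_at_iff_tendsto_nhds] c(1)]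
    by (simp add: eventually_nhds_metric dist_real_def)
  then obtain e1 where e1: "e1 > 0" "\<And>x. \<bar>x - s\<bar> < e1 \<Longrightarrow> H x < c" by blast
  have "\<exists>e>0. \<forall>x. \<bar>x - t\<bar> < e \<longrightarrow> c < H x"
    using order_tendstoD(1)[OF isC[OF st(2), unfolded isCont_def tendsto_at_iff_tendsto_nhds] c(2)]
    by (simp add: eventually_nhds_metric dist_real_def)
  then obtain e2 where e2: "e2 > 0" "\<And>x. \<bar>x - t\<bar> < e2 \<Longrightarrow> c < H x" by blast
  \<comment> \<open>Small enough that H stays on its side of c on both bumps, and that both bumps
    lie in the positive times.\<close>
  define \<epsilon> where "\<epsilon> = Min {e1, e2, s / 2, t / 2}"
  have \<epsilon>: "0 < \<epsilon>" "\<epsilon> \<le> e1" "\<epsilon> \<le> e2" "\<epsilon> < s" "\<epsilon> < t"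
    using e1(1) e2(1) st by (auto simp: \<epsilon>_def min_def)
  obtain \<beta> G where \<beta>: "\<beta> \<in> bump_space \<epsilon>" "\<And>x. (G has_real_derivative \<beta> x) (at x)"
    "\<And>x. \<beta> x \<ge> 0" "\<beta> 0 > 0" "\<And>x. \<epsilon> \<le> \<bar>x\<bar> \<Longrightarrow> \<beta> x = 0" "continuous_on UNIV \<beta>"
    using bump_exists[OF \<epsilon>(1)] by metis
  define \<psi> where "\<psi> x = G (x - s) - G (x - t)" for x
  define \<psi>' where "\<psi>' x = \<beta> (x - s) - \<beta> (x - t)" for x
  have sh: "((\<lambda>x. f (x - r)) has_real_derivative f' (x - r)) (at x)"
    if "\<And>x. (f has_real_derivative f' x) (at x)" for f f' :: "real \<Rightarrow> real" and r x
    using DERIV_shift[of f "f' (x - r)" x "- r"] that[of "x - r"] by simp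
  have \<psi>': "(\<psi> has_real_derivative \<psi>' x) (at x)" for x
    unfolding \<psi>_def \<psi>'_def by (intro DERIV_diff sh \<beta>)
  have Gc: "continuous_on A G" for A
    using \<beta>(2) by (intro DERIV_continuous_on) (auto intro: has_field_derivative_at_within)
  have G0: "(G has_real_derivative 0) (at x)" if "\<epsilon> \<le> \<bar>x\<bar>" for x
    using \<beta>(2)[of x] \<beta>(5)[OF that] by simp
  have G1: "G x = G (- \<epsilon>)" if "x \<le> - \<epsilon>" for x
  proof (cases "x = - \<epsilon>")
    case False
    then have "G (- \<epsilon>) = G x"
      using that \<epsilon>(1) by (intro DERIV_isconst_end Gc G0) auto
    then show ?thesis by simp
  qed simp
  have G2: "G x = G \<epsilon>" if "\<epsilon> \<le> x" for x
  proof (cases "x = \<epsilon>")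
    case False
    then show ?thesis
      using that \<epsilon>(1) by (intro DERIV_isconst_end Gc G0) auto
  qed simp
  define a b where "a = min s t - \<epsilon>" and "b = max s t + \<epsilon>"
  have ab: "0 < a" "a < b" using \<epsilon> st by (auto simp: a_def b_def)
  have z: "\<psi> x = 0" if "x \<notin> {a<..<b}" for x
    using that G1[of "x - s"] G1[of "x - t"] G2[of "x - s"] G2[of "x - t"]
    by (auto simp: \<psi>_def a_def b_def min_def max_def split: if_splits)
  have z': "\<psi>' x = 0" if "x \<notin> {a<..<b}" for x
    using that \<beta>(5)[of "x - s"] \<beta>(5)[of "x - t"]
    by (auto simp: \<psi>'_def a_def b_def min_def max_def split: if_splits)
  have "smooth_time_test \<psi>"
    unfolding smooth_time_test_def
  proof (intro conjI allI exI)
    fix n r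
    \<comment> \<open>\<psi> is a difference of primitives and need not come from
      \<open>bump_space\<close>; all its derivatives do, so it is adjoined by hand.\<close>
    define S where "S = insert \<psi> {\<lambda>x. f (x - s) - f (x - t) | f. f \<in> bump_space \<epsilon>}"
    show "(deriv ^^ n) \<psi> field_differentiable at r"
    proof (rule smooth_if_closed_under_deriv)
      show "\<psi> \<in> S" by (simp add: S_def)
      fix f assume "f \<in> S"
      then consider "f = \<psi>" | g where "g \<in> bump_space \<epsilon>" "f = (\<lambda>x. g (x - s) - g (x - t))"
        by (auto simp: S_def)
      then show "\<exists>f'\<in>S. \<forall>x. (f has_real_derivative f' x) (at x)"
      proof cases
        case 1
        then show ?thesis
          using \<psi>' \<beta>(1) by (intro bexI[of _ \<psi>']) (auto simp: S_def \<psi>'_def[abs_def])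
      next
        case 2
        then obtain g' where "g' \<in> bump_space \<epsilon>" "\<And>x. (g has_real_derivative g' x) (at x)"
          using bump_space_deriv by blast
        then show ?thesis
          unfolding 2 by (intro bexI[of _ "\<lambda>x. g' (x - s) - g' (x - t)"])
            (auto simp: S_def intro!: DERIV_diff sh)
      qed
    qed
    show "0 < a" by fact
    show "x \<notin> {a..b} \<longrightarrow> \<psi> x = 0" for x using z by auto
  qed
  from weak[OF this] have w: "(LINT t:{0<..}|lborel. \<psi>' t * H t) = 0"
    by (simp only: DERIV_imp_deriv[OF \<psi>'])
  have sub: "{a..b} \<subseteq> {0<..}" using ab by auto
  have c\<psi>: "continuous_on {a..b} \<psi>'"
    unfolding \<psi>'_def by (intro continuous_intros continuous_on_compose2[OF \<beta>(6)]) auto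
  have cH: "continuous_on {a..b} (\<lambda>t. \<psi>' t * H t)" "continuous_on {a..b} (\<lambda>t. \<psi>' t * (c - H t))"
    by (intro continuous_intros c\<psi> continuous_on_subset[OF cont sub])+
  have "integral {a..b} (\<lambda>t. \<psi>' t * H t) = 0"
    using set_integral_eq_integral_if_supported[OF ab(1) _ cH(1)] z' w by simp
  moreover have "integral {a..b} \<psi>' = \<psi> b - \<psi> a"
    using \<psi>' ab by (intro integral_unique fundamental_theorem_of_calculus)
      (auto simp: has_real_derivative_iff_has_vector_derivative[symmetric] intro: has_field_derivative_at_within)
  then have "integral {a..b} \<psi>' = 0" using z[of a] z[of b] by simp
  moreover have "integral {a..b} (\<lambda>t. \<psi>' t * (c - H t)) = integral {a..b} (\<lambda>t. \<psi>' t * c) - integral {a..b} (\<lambda>t. \<psi>' t * H t)"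
    unfolding right_diff_distrib
    by (intro Henstock_Kurzweil_Integration.integral_diff integrable_continuous_real cH continuous_intros c\<psi>)
  ultimately have "integral {a..b} (\<lambda>t. \<psi>' t * (c - H t)) = 0" by simp
  moreover have "\<psi>' x * (c - H x) \<ge> 0" for x
  proof -
    have "\<beta> (x - s) * (c - H x) \<ge> 0"
      using \<beta>(3,5)[of "x - s"] e1(2)[of x] \<epsilon> by (cases "\<epsilon> \<le> \<bar>x - s\<bar>") auto
    moreover have "\<beta> (x - t) * (c - H x) \<le> 0"
      using \<beta>(3,5)[of "x - t"] e2(2)[of x] \<epsilon>
      by (cases "\<epsilon> \<le> \<bar>x - t\<bar>") (auto intro: mult_nonneg_nonpos)
    ultimately show ?thesis by (simp add: \<psi>'_def left_diff_distrib)
  qed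
  ultimately have "\<forall>x\<in>{a..b}. \<psi>' x * (c - H x) = 0"
    using integral_eq_0_iff[OF cH(2)] ab by blast
  moreover have "s \<in> {a..b}" using \<epsilon> by (auto simp: a_def b_def)
  ultimately have "\<psi>' s * (c - H s) = 0" by blast
  then have "\<psi>' s = 0" using c by simp
  \<comment> \<open>If s were in the bump around t, then H s would be both below and above c. Hence
    only the bump at s contributes to \<psi>' s, and it contributes \<beta> 0 > 0.\<close>
  moreover have "\<epsilon> \<le> \<bar>s - t\<bar>"
  proof (rule ccontr)
    assume "\<not> \<epsilon> \<le> \<bar>s - t\<bar>"
    then show False using e1(2)[of s] e2(2)[of s] e1(1) \<epsilon> by auto
  qed
  ultimately show False using \<beta>(4) \<beta>(5)[of "s - t"] by (simp add: \<psi>'_def)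
qed

text \<open>Subtracting a primitive of \<open>k\<close> leaves, after integration by parts, a
  continuous function with vanishing distributional derivative, hence a constant. This converts the
  weak formulation into derivatives to which Gronwall applies.\<close>

lemma weak_derivative_imp_derivative:
  fixes h k :: "real \<Rightarrow> real"
  assumes h: "continuous_on {0..} h" and k: "continuous_on {0..} k"
    and weak: "\<And>\<psi>. smooth_time_test \<psi> \<Longrightarrow>
      - (LINT t:{0<..}|lborel. deriv \<psi> t * h t) = (LINT t:{0<..}|lborel. \<psi> t * k t)"
    and t: "0 < t"
  shows "(h has_real_derivative k t) (at t)"
proof -
  define K where "K x = integral {0..x} k" for x
  have K: "(K has_real_derivative k x) (at x)" if "0 < x" for x
  proof -
    have "(K has_real_derivative k x) (at x within {0..x + 1})"
      unfolding K_def using that by (intro integral_has_real_derivative continuous_on_subset[OF k]) auto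
    then show ?thesis
      using that by (simp add: at_within_Icc_at)
  qed
  have Kc: "continuous_on {0<..} K"
    using K by (auto intro!: continuous_at_imp_continuous_on DERIV_isCont)
  have hc: "continuous_on {0<..} h" and kc: "continuous_on {0<..} k"
    using h k by (auto intro: continuous_on_subset)
  define H where "H x = h x - K x" for x
  have Hc: "continuous_on {0<..} H"
    unfolding H_def by (intro continuous_intros hc Kc)
  have weakH: "(LINT t:{0<..}|lborel. deriv \<psi> t * H t) = 0" if test: "smooth_time_test \<psi>" for \<psi>
  proof -
    obtain a b where ab: "0 < a" "a < b" and z: "\<And>t. t \<notin> {a<..<b} \<Longrightarrow> \<psi> t = 0"
      "\<And>t. t \<notin> {a<..<b} \<Longrightarrow> deriv \<psi> t = 0" and d: "\<And>t. (\<psi> has_real_derivative deriv \<psi> t) (at t)"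
      and c: "continuous_on UNIV \<psi>" "continuous_on UNIV (deriv \<psi>)"
      using smooth_time_testD[OF test] by metis
    have sub: "{a..b} \<subseteq> {0<..}" using ab by auto
    have cc: "continuous_on {a..b} (\<lambda>t. deriv \<psi> t * h t)" "continuous_on {a..b} (\<lambda>t. deriv \<psi> t * K t)"
      "continuous_on {a..b} (\<lambda>t. \<psi> t * k t)" "continuous_on {a..b} (\<lambda>t. deriv \<psi> t * H t)"
      by (intro continuous_intros continuous_on_subset[OF c(1)] continuous_on_subset[OF c(2)]
        continuous_on_subset[OF Kc sub] continuous_on_subset[OF hc sub] continuous_on_subset[OF kc sub]
        continuous_on_subset[OF Hc sub] subset_UNIV)+
    have "- integral {a..b} (\<lambda>t. deriv \<psi> t * h t) = integral {a..b} (\<lambda>t. \<psi> t * k t)"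
      using weak[OF test] set_integral_eq_integral_if_supported[OF ab(1) _ cc(1)]
        set_integral_eq_integral_if_supported[OF ab(1) _ cc(3)] z by simp
    moreover have "integral {a..b} (\<lambda>t. deriv \<psi> t * K t + \<psi> t * k t) = \<psi> b * K b - \<psi> a * K a"
    proof (intro integral_unique fundamental_theorem_of_calculus)
      fix x assume "x \<in> {a..b}"
      then have "((\<lambda>t. \<psi> t * K t) has_real_derivative deriv \<psi> x * K x + \<psi> x * k x) (at x)"
        using DERIV_mult[OF d[of x] K[of x]] ab by (simp add: algebra_simps)
      then show "((\<lambda>t. \<psi> t * K t) has_vector_derivative deriv \<psi> x * K x + \<psi> x * k x) (at x within {a..b})"
        by (simp add: has_real_derivative_iff_has_vector_derivative[symmetric] has_field_derivative_at_within)
    qed (use ab in simp)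
    then have "integral {a..b} (\<lambda>t. deriv \<psi> t * K t) + integral {a..b} (\<lambda>t. \<psi> t * k t) = 0"
      using z(1)[of a] z(1)[of b]
      by (simp add: Henstock_Kurzweil_Integration.integral_add integrable_continuous_real cc)
    moreover have "integral {a..b} (\<lambda>t. deriv \<psi> t * H t)
        = integral {a..b} (\<lambda>t. deriv \<psi> t * h t) - integral {a..b} (\<lambda>t. deriv \<psi> t * K t)"
      unfolding H_def right_diff_distrib
      by (intro Henstock_Kurzweil_Integration.integral_diff integrable_continuous_real cc)
    ultimately show ?thesis
      using set_integral_eq_integral_if_supported[OF ab(1) _ cc(4)] z by simp
  qed
  have "H x = H t" if "0 < x" for x
    using weakly_constant_not_less[OF Hc weakH, of x t] weakly_constant_not_less[OF Hc weakH, of t x] that t by (metis linorder_neqE_linordered_idom)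
  then have hx: "H t + K x = h x" if "x \<in> {0<..}" for x
    using that by (simp add: H_def algebra_simps)
  have "((\<lambda>x. H t + K x) has_real_derivative k t) (at t)"
    using DERIV_add[OF DERIV_const K[OF t]] by simp
  then show ?thesis
    by (rule has_field_derivative_transform_within_open[where S = "{0<..}"]) (use t hx in auto)
qed

section \<open>Pair functionals of the mean-field flow\<close>

lemma (in prob_space) distr_pair_snd': "distr (M \<Otimes>\<^sub>M M) M snd = M"
proof (intro measure_eqI)
  fix A assume A: "A \<in> sets (distr (M \<Otimes>\<^sub>M M) M snd)"
  have "emeasure (distr (M \<Otimes>\<^sub>M M) M snd) A = emeasure (M \<Otimes>\<^sub>M M) (space M \<times> A)"
    using A sets.sets_into_space[of A M]
    by (auto simp: emeasure_distr space_pair_measure intro!: arg_cong2[where f = emeasure])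
  also have "\<dots> = emeasure M (space M) * emeasure M A"
    using A by (intro emeasure_pair_measure_Times) auto
  finally show "emeasure (distr (M \<Otimes>\<^sub>M M) M snd) A = emeasure M A"
    by (simp add: emeasure_space_1)
qed simp

lemma (in prob_space) AE_pair_fst: "AE x in M. P x \<Longrightarrow> AE z in M \<Otimes>\<^sub>M M. P (fst z)"
  by (rule AE_distrD[where M' = M], simp) (unfold distr_pair_fst)

lemma (in prob_space) AE_pair_snd: "AE x in M. P x \<Longrightarrow> AE z in M \<Otimes>\<^sub>M M. P (snd z)"
  by (rule AE_distrD[where M' = M], simp) (unfold distr_pair_snd')

lemma (in prob_space) pair_integral_fst:
  fixes f :: "'a \<Rightarrow> real"
  assumes "integrable M f"
  shows "integrable (M \<Otimes>\<^sub>M M) (\<lambda>z. f (fst z))" "(\<integral>z. f (fst z) \<partial>(M \<Otimes>\<^sub>M M)) = (\<integral>x. f x \<partial>M)"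
  using assms integrable_distr_eq[of fst "M \<Otimes>\<^sub>M M" M f] integral_distr[of fst "M \<Otimes>\<^sub>M M" M f]
  by (auto simp: distr_pair_fst borel_measurable_integrable)

lemma (in prob_space) pair_integral_snd:
  fixes f :: "'a \<Rightarrow> real"
  assumes "integrable M f"
  shows "integrable (M \<Otimes>\<^sub>M M) (\<lambda>z. f (snd z))" "(\<integral>z. f (snd z) \<partial>(M \<Otimes>\<^sub>M M)) = (\<integral>x. f x \<partial>M)"
  using assms integrable_distr_eq[of snd "M \<Otimes>\<^sub>M M" M f] integral_distr[of snd "M \<Otimes>\<^sub>M M" M f]
  by (auto simp: distr_pair_snd' borel_measurable_integrable)

lemma (in prob_space) power2_expectation_le:
  fixes f :: "'a \<Rightarrow> real"
  assumes "integrable M f" "integrable M (\<lambda>x. (f x)\<^sup>2)"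
  shows "(expectation f)\<^sup>2 \<le> expectation (\<lambda>x. (f x)\<^sup>2)"
  using variance_positive[of f] variance_eq[OF assms] by simp

section \<open>Polynomial test functions\<close>

lemma real_polynomial_function_C1:
  fixes \<phi> :: "'a::real_normed_vector \<Rightarrow> real"
  assumes "real_polynomial_function \<phi>"
  obtains \<phi>' where "\<And>x. (\<phi> has_derivative blinfun_apply (\<phi>' x)) (at x)" "continuous_on UNIV \<phi>'"
    "continuous_on UNIV \<phi>"
proof -
  have "\<exists>\<phi>'. (\<forall>x. (\<phi> has_derivative blinfun_apply (\<phi>' x)) (at x)) \<and> continuous_on UNIV \<phi>'"
    using assms
  proof induction
    case (linear f)
    then show ?case
      by (intro exI[of _ "\<lambda>x. Blinfun f"])
        (auto simp: bounded_linear_Blinfun_apply intro: bounded_linear_imp_has_derivative)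
  next
    case (const c)
    show ?case by (intro exI[of _ "\<lambda>x. 0"]) auto
  next
    case (add f g)
    then obtain f' g' where "\<forall>x. (f has_derivative blinfun_apply (f' x)) (at x)" "continuous_on UNIV f'"
      "\<forall>x. (g has_derivative blinfun_apply (g' x)) (at x)" "continuous_on UNIV g'" by blast
    then show ?case
      by (intro exI[of _ "\<lambda>x. f' x + g' x"])
        (auto simp: blinfun.add_left intro!: has_derivative_add continuous_intros)
  next
    case (mult f g)
    then obtain f' g' where f: "\<And>x. (f has_derivative blinfun_apply (f' x)) (at x)" "continuous_on UNIV f'"
      and g: "\<And>x. (g has_derivative blinfun_apply (g' x)) (at x)" "continuous_on UNIV g'" by blast
    have c: "continuous_on UNIV f" "continuous_on UNIV g"
      using f(1) g(1) by (auto intro!: has_derivative_continuous_on)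
    show ?case
    proof (intro exI[of _ "\<lambda>x. f x *\<^sub>R g' x + g x *\<^sub>R f' x"] conjI allI)
      show "((\<lambda>x. f x * g x) has_derivative blinfun_apply (f x *\<^sub>R g' x + g x *\<^sub>R f' x)) (at x)" for x
        using has_derivative_mult[OF f(1)[of x] g(1)[of x]]
        by (simp add: blinfun.add_left[abs_def] blinfun.scaleR_left fun_eq_iff mult.commute has_derivative_def)
    qed (intro continuous_intros c f g)
  qed
  moreover have "continuous_on UNIV \<phi>"
    using assms by (simp add: continuous_on_polymonial_function real_polynomial_function_eq)
  ultimately show ?thesis using that by blast
qed

text \<open>Weierstrass will be applied to a derivative; the normalisation at 0 allows the
  primitives to be compared by integrating from 0.\<close>

lemma real_polynomial_function_antiderivative:
  fixes q :: "real \<Rightarrow> real"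
  assumes "real_polynomial_function q"
  obtains Q where "real_polynomial_function Q" "\<And>x. (Q has_real_derivative q x) (at x)" "Q 0 = 0"
proof -
  obtain a n where q: "q = (\<lambda>x. \<Sum>i\<le>n. a i * x ^ i)"
    using assms real_polynomial_function_iff_sum by blast
  define Q where "Q x = (\<Sum>i\<le>n. a i / (real i + 1) * x ^ Suc i)" for x
  have "real_polynomial_function Q"
    unfolding Q_def
    by (intro real_polynomial_function_sum real_polynomial_function.intros(4) real_polynomial_function.intros(2)
        real_polynomial_function_power real_polynomial_function.intros(1) bounded_linear_ident) auto
  moreover have "(Q has_real_derivative q x) (at x)" for x
  proof -
    have "(Q has_real_derivative (\<Sum>i\<le>n. a i / (real i + 1) * (real (Suc i) * x ^ i))) (at x)"
      unfolding Q_def by (auto intro!: derivative_eq_intros sum.cong simp del: power_Suc)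
    also have "(\<Sum>i\<le>n. a i / (real i + 1) * (real (Suc i) * x ^ i)) = q x"
      unfolding q by (intro sum.cong) (auto simp: field_simps)
    finally show ?thesis .
  qed
  ultimately show ?thesis using that[of Q] by (simp add: Q_def)
qed

text \<open>The weak formulation only tests against one-particle functions; products of such functions
  reach every polynomial of the squared distance of a pair.\<close>

inductive_set tensor :: "('a::euclidean_space \<times> 'a \<Rightarrow> real) set" where
  prod: "real_polynomial_function \<phi> \<Longrightarrow> real_polynomial_function \<psi> \<Longrightarrow> (\<lambda>z. \<phi> (fst z) * \<psi> (snd z)) \<in> tensor"
| add: "\<Phi> \<in> tensor \<Longrightarrow> \<Psi> \<in> tensor \<Longrightarrow> (\<lambda>z. \<Phi> z + \<Psi> z) \<in> tensor"

lemma tensor_fst: "real_polynomial_function \<phi> \<Longrightarrow> (\<lambda>z. \<phi> (fst z)) \<in> tensor"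
  using tensor.prod[of \<phi> "\<lambda>x. 1"] by auto

lemma tensor_snd: "real_polynomial_function \<phi> \<Longrightarrow> (\<lambda>z. \<phi> (snd z)) \<in> tensor"
  using tensor.prod[of "\<lambda>x. 1" \<phi>] by auto

lemma tensor_const: "(\<lambda>z. c) \<in> tensor"
  using tensor_fst[of "\<lambda>x. c"] by auto

lemma tensor_mult:
  assumes "\<Phi> \<in> tensor" "\<Psi> \<in> tensor"
  shows "(\<lambda>z. \<Phi> z * \<Psi> z) \<in> tensor"
  using assms
proof (induction arbitrary: \<Psi>)
  case (prod \<phi>1 \<psi>1)
  show ?case using prod(3)
  proof induction
    case (prod \<phi>2 \<psi>2)
    then show ?case
      using tensor.prod[of "\<lambda>x. \<phi>1 x * \<phi>2 x" "\<lambda>x. \<psi>1 x * \<psi>2 x"] \<open>real_polynomial_function \<phi>1\<close>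
        \<open>real_polynomial_function \<psi>1\<close>
      by (simp add: real_polynomial_function.intros(4) mult.assoc mult.left_commute)
  next
    case (add \<Phi> \<Psi>)
    then show ?case
      using tensor.add[of "\<lambda>z. \<phi>1 (fst z) * \<psi>1 (snd z) * \<Phi> z" "\<lambda>z. \<phi>1 (fst z) * \<psi>1 (snd z) * \<Psi> z"]
      by (simp add: distrib_left)
  qed
next
  case (add \<Phi>1 \<Phi>2)
  then show ?case
    using tensor.add[of "\<lambda>z. \<Phi>1 z * \<Psi> z" "\<lambda>z. \<Phi>2 z * \<Psi> z"] by (simp add: distrib_right)
qed

lemma tensor_sum:
  assumes "finite I" "\<And>i. i \<in> I \<Longrightarrow> \<Phi> i \<in> tensor"
  shows "(\<lambda>z. \<Sum>i\<in>I. \<Phi> i z) \<in> tensor"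
  using assms by (induction I) (auto intro: tensor_const tensor.add)

lemma tensor_compose_polynomial:
  assumes "real_polynomial_function q" "\<Phi> \<in> tensor"
  shows "(\<lambda>z. q (\<Phi> z)) \<in> tensor"
  using assms(1)
proof induction
  case (linear f)
  then obtain c where "f = (\<lambda>x. x * c)" using real_bounded_linear by blast
  then show ?case using tensor_mult[OF assms(2) tensor_const] by simp
qed (auto intro: tensor_const tensor.add tensor_mult)

text \<open>In |x|^2 + |y|^2 - 2 (x \<bullet> y) only the last term couples the particles, and in
  coordinates it is a finite sum of products.\<close>

lemma tensor_dist: "(\<lambda>z::'a::euclidean_space \<times> 'a. (norm (fst z - snd z))\<^sup>2) \<in> tensor"
proof -
  have inner: "real_polynomial_function (\<lambda>x::'a. x \<bullet> b)" for b
    by (intro real_polynomial_function.intros(1) bounded_linear_inner_left)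
  have "(norm (fst z - snd z))\<^sup>2 = (\<Sum>b\<in>Basis. fst z \<bullet> b * (fst z \<bullet> b)) + (\<Sum>b\<in>Basis. snd z \<bullet> b * (snd z \<bullet> b))
     + - 2 * (\<Sum>b\<in>Basis. fst z \<bullet> b * (snd z \<bullet> b))" for z :: "'a \<times> 'a"
    unfolding euclidean_inner[symmetric] power2_norm_eq_inner
    by (simp add: inner_diff inner_commute)
  moreover have "(\<lambda>z::'a \<times> 'a. (\<Sum>b\<in>Basis. fst z \<bullet> b * (fst z \<bullet> b)) + (\<Sum>b\<in>Basis. snd z \<bullet> b * (snd z \<bullet> b))
     + - 2 * (\<Sum>b\<in>Basis. fst z \<bullet> b * (snd z \<bullet> b))) \<in> tensor"
    by (intro tensor.add tensor_sum tensor_mult tensor_const finite_Basis tensor_fst tensor_snd inner)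
  ultimately show ?thesis by simp
qed

text \<open>For unitary U this is K(V, U) U = V - U V^H U averaged over V. The formula is polynomial
  in \<open>p\<close> and makes sense off the unitary group, so continuity holds on the whole matrix
  space.\<close>

definition flow_velocity :: "real \<Rightarrow> complex^'n^'n \<Rightarrow> (complex^'n^'n) \<times> (complex^'n^'n) \<Rightarrow> complex^'n^'n" where
  "flow_velocity \<kappa> m p = snd p ** fst p + (\<kappa> / 2) *\<^sub>R (m - fst p ** ctranspose m ** fst p)"

lemma continuous_on_flow_velocity [continuous_intros]:
  assumes "continuous_on A g"
  shows "continuous_on A (\<lambda>x. flow_velocity \<kappa> m (g x))"
  unfolding flow_velocity_def by (intro continuous_intros assms)

text \<open>Abstracts from densities: \<open>N t\<close> is the law of a particle \<open>(U, A)\<close> at time \<open>t\<close>, and the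
  interaction has already been reduced to the mean of \<open>U\<close>.\<close>

locale mean_field_flow =
  fixes N :: "real \<Rightarrow> ((complex^'n^'n) \<times> (complex^'n^'n)) measure"
    and S :: "(complex^'n^'n) set" and \<kappa> \<alpha> :: real
  assumes prob_N: "0 \<le> t \<Longrightarrow> prob_space (N t)"
    and sets_N: "0 \<le> t \<Longrightarrow> sets (N t) = sets borel"
    and supp_N: "0 \<le> t \<Longrightarrow> AE p in N t. p \<in> unitary_group \<times> S"
    and compact_S: "compact S" and skew_S: "S \<subseteq> skew_hermitian"
    and diam_S: "\<And>A B. A \<in> S \<Longrightarrow> B \<in> S \<Longrightarrow> norm (A - B) \<le> \<alpha>"
    and \<kappa>_pos: "0 < \<kappa>" and \<alpha>_nonneg: "0 \<le> \<alpha>"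
    and cont_N: "\<And>\<phi> :: complex^'n^'n \<Rightarrow> real. continuous_on UNIV \<phi> \<Longrightarrow>
      continuous_on {0..} (\<lambda>t. \<integral>p. \<phi> (fst p) \<partial>N t)"
    and deriv_N: "\<And>\<phi> \<phi>' t. (\<And>U. (\<phi> has_derivative blinfun_apply (\<phi>' U)) (at U)) \<Longrightarrow>
      continuous_on UNIV \<phi>' \<Longrightarrow> 0 < t \<Longrightarrow>
      ((\<lambda>t. \<integral>p. \<phi> (fst p) \<partial>N t) has_real_derivative
        (\<integral>p. blinfun_apply (\<phi>' (fst p)) (flow_velocity \<kappa> (\<integral>p. fst p \<partial>N t) p) \<partial>N t)) (at t)"
begin

definition vel :: "real \<Rightarrow> (complex^'n^'n) \<times> (complex^'n^'n) \<Rightarrow> complex^'n^'n" where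
  "vel t = flow_velocity \<kappa> (\<integral>p. fst p \<partial>N t)"

abbreviation pairs :: "real \<Rightarrow> (((complex^'n^'n) \<times> (complex^'n^'n)) \<times> ((complex^'n^'n) \<times> (complex^'n^'n))) measure" where
  "pairs t \<equiv> N t \<Otimes>\<^sub>M N t"

abbreviation states :: "((complex^'n^'n) \<times> (complex^'n^'n)) \<times> ((complex^'n^'n) \<times> (complex^'n^'n)) \<Rightarrow> (complex^'n^'n) \<times> (complex^'n^'n)" where
  "states z \<equiv> (fst (fst z), fst (snd z))"

definition sqd :: "((complex^'n^'n) \<times> (complex^'n^'n)) \<times> ((complex^'n^'n) \<times> (complex^'n^'n)) \<Rightarrow> real" where
  "sqd z = (norm (fst (fst z) - fst (snd z)))\<^sup>2"

definition sqd_rate :: "real \<Rightarrow> ((complex^'n^'n) \<times> (complex^'n^'n)) \<times> ((complex^'n^'n) \<times> (complex^'n^'n)) \<Rightarrow> real" where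
  "sqd_rate t z = 2 * ((fst (fst z) - fst (snd z)) \<bullet> (vel t (fst z) - vel t (snd z)))"

text \<open>The number 4d: by the triangle inequality it bounds the squared distance of two unitary
  matrices, and \<open>{0..R2}\<close> is where the Weierstrass approximation takes place.\<close>

definition R2 :: real where "R2 = (2 * norm (mat 1 :: complex^'n^'n))\<^sup>2"

lemma R2_pos: "0 < R2"
proof -
  have "(mat 1 :: complex^'n^'n) $ i $ i \<noteq> 0 $ i $ i" for i by (simp add: mat_def)
  then have "(mat 1 :: complex^'n^'n) \<noteq> 0" by metis
  then show ?thesis by (simp add: R2_def)
qed

lemma continuous_sqd [continuous_intros]: "continuous_on A sqd"
  unfolding sqd_def by (intro continuous_intros)

lemma continuous_vel [continuous_intros]:
  "continuous_on A g \<Longrightarrow> continuous_on A (\<lambda>x. vel t (g x))"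
  unfolding vel_def by (intro continuous_intros)

lemma continuous_sqd_rate [continuous_intros]: "continuous_on A (sqd_rate t)"
  unfolding sqd_rate_def by (intro continuous_intros)

lemma measurable_N: "0 \<le> t \<Longrightarrow> continuous_on UNIV f \<Longrightarrow> f \<in> borel_measurable (N t)"
  using borel_measurable_continuous_onI measurable_cong_sets[OF sets_N refl] by blast

lemma sets_pairs: "0 \<le> t \<Longrightarrow> sets (pairs t) = sets borel"
  unfolding borel_prod[symmetric, where 'a = "(complex^'n^'n) \<times> (complex^'n^'n)" and 'b = "(complex^'n^'n) \<times> (complex^'n^'n)"]
  by (intro sets_pair_measure_cong sets_N)

lemma measurable_pairs: "0 \<le> t \<Longrightarrow> continuous_on UNIV f \<Longrightarrow> f \<in> borel_measurable (pairs t)"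
  using borel_measurable_continuous_onI measurable_cong_sets[OF sets_pairs refl] by blast

lemma integrable_N:
  fixes f :: "_ \<Rightarrow> 'b::{banach, second_countable_topology}"
  assumes t: "0 \<le> t" and f: "continuous_on UNIV f"
  shows "integrable (N t) f"
proof -
  interpret prob_space "N t" by (rule prob_N[OF t])
  have "compact (f ` (unitary_group \<times> S))"
    using f by (intro compact_continuous_image compact_Times compact_unitary_group compact_S)
      (auto intro: continuous_on_subset)
  then obtain B where B: "\<forall>x\<in>unitary_group \<times> S. norm (f x) \<le> B"
    using compact_imp_bounded bounded_iff by (metis image_eqI)
  show ?thesis
  proof (rule integrable_const_bound)
    show "AE x in N t. norm (f x) \<le> B"
      using supp_N[OF t] B by (auto elim!: eventually_mono)
  qed (rule measurable_N[OF t f])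
qed

lemma supp_pairs:
  assumes t: "0 \<le> t"
  shows "AE z in pairs t. z \<in> (unitary_group \<times> S) \<times> (unitary_group \<times> S)"
proof -
  interpret prob_space "N t" by (rule prob_N[OF t])
  show ?thesis
    using AE_pair_fst[OF supp_N[OF t]] AE_pair_snd[OF supp_N[OF t]]
    by eventually_elim (auto simp: mem_Times_iff)
qed

lemma integrable_pairs:
  fixes f :: "_ \<Rightarrow> 'b::{banach, second_countable_topology}"
  assumes t: "0 \<le> t" and f: "continuous_on UNIV f"
  shows "integrable (pairs t) f"
proof -
  interpret prob_space "N t" by (rule prob_N[OF t])
  interpret pair_prob_space "N t" "N t" ..
  have "compact (f ` ((unitary_group \<times> S) \<times> (unitary_group \<times> S)))"
    using f by (intro compact_continuous_image compact_Times compact_unitary_group compact_S)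
      (auto intro: continuous_on_subset)
  then obtain B where B: "\<forall>x\<in>(unitary_group \<times> S) \<times> (unitary_group \<times> S). norm (f x) \<le> B"
    using compact_imp_bounded bounded_iff by (metis image_eqI)
  show ?thesis
  proof (rule P.integrable_const_bound)
    show "AE x in pairs t. norm (f x) \<le> B"
      using supp_pairs[OF t] B by (auto elim!: eventually_mono)
  qed (rule measurable_pairs[OF t f])
qed

lemma integral_pairs_prod:
  fixes f g :: "_ \<Rightarrow> real"
  assumes t: "0 \<le> t" and f: "continuous_on UNIV f" and g: "continuous_on UNIV g"
  shows "(\<integral>z. f (fst z) * g (snd z) \<partial>pairs t) = (\<integral>p. f p \<partial>N t) * (\<integral>p. g p \<partial>N t)"
proof -
  interpret prob_space "N t" by (rule prob_N[OF t])
  interpret pair_prob_space "N t" "N t" ..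
  have "integrable (pairs t) (\<lambda>z. f (fst z) * g (snd z))"
    by (intro integrable_pairs t continuous_intros continuous_on_compose2[OF f] continuous_on_compose2[OF g]) auto
  from integral_fst'[OF this] show ?thesis by simp
qed

text \<open>The two particles of a pair are independent, so the integral of \<phi>(U) \<psi>(V) is a
  product of one-particle integrals. The product rule and \<open>deriv_N\<close> differentiate it,
  and independence reassembles the result into the derivative of \<Phi> along the pair of
  velocities. \<open>F\<close> is left existential so that the claim passes through sums.\<close>

lemma tensor_deriv_aux:
  assumes "\<Phi> \<in> tensor"
  shows "\<exists>F. (\<forall>z. (\<Phi> has_derivative blinfun_apply (F z)) (at z)) \<and> continuous_on UNIV F \<and>
    continuous_on UNIV \<Phi> \<and>
    continuous_on {0..} (\<lambda>t. \<integral>z. \<Phi> (states z) \<partial>pairs t) \<and>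
    (\<forall>t>0. ((\<lambda>t. \<integral>z. \<Phi> (states z) \<partial>pairs t) has_real_derivative
      (\<integral>z. blinfun_apply (F (states z)) (vel t (fst z), vel t (snd z)) \<partial>pairs t)) (at t))"
  using assms
proof induction
  case (prod \<phi> \<psi>)
  obtain \<phi>' where \<phi>: "\<And>x. (\<phi> has_derivative blinfun_apply (\<phi>' x)) (at x)" "continuous_on UNIV \<phi>'"
    "continuous_on UNIV \<phi>" using real_polynomial_function_C1[OF prod(1)] by metis
  obtain \<psi>' where \<psi>: "\<And>x. (\<psi> has_derivative blinfun_apply (\<psi>' x)) (at x)" "continuous_on UNIV \<psi>'"
    "continuous_on UNIV \<psi>" using real_polynomial_function_C1[OF prod(2)] by metis
  define F where "F z = \<phi> (fst z) *\<^sub>R (\<psi>' (snd z) o\<^sub>L snd_blinfun) + \<psi> (snd z) *\<^sub>R (\<phi>' (fst z) o\<^sub>L fst_blinfun)"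
    for z :: "(complex^'n^'n) \<times> (complex^'n^'n)"
  note cc = continuous_on_compose2[OF \<phi>(2) _ subset_UNIV] continuous_on_compose2[OF \<phi>(3) _ subset_UNIV]
     continuous_on_compose2[OF \<psi>(2) _ subset_UNIV] continuous_on_compose2[OF \<psi>(3) _ subset_UNIV]
  have prod_eq: "(\<integral>z. \<phi> (fst (states z)) * \<psi> (snd (states z)) \<partial>pairs t) = (\<integral>p. \<phi> (fst p) \<partial>N t) * (\<integral>p. \<psi> (fst p) \<partial>N t)"
    if "0 \<le> t" for t
    using integral_pairs_prod[OF that, of "\<lambda>p. \<phi> (fst p)" "\<lambda>p. \<psi> (fst p)"]
    by (simp add: continuous_on_fst continuous_on_id cc)
  show ?case
  proof (intro exI[of _ F] conjI allI impI)
    show "((\<lambda>z. \<phi> (fst z) * \<psi> (snd z)) has_derivative blinfun_apply (F z)) (at z)" for z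
      unfolding F_def
      by (auto intro!: derivative_eq_intros has_derivative_compose[OF _ \<phi>(1)] has_derivative_compose[OF _ \<psi>(1)]
          simp: blinfun.add_left blinfun.scaleR_left)
    show "continuous_on UNIV F"
      unfolding F_def by (intro continuous_intros cc)
    show "continuous_on UNIV (\<lambda>z. \<phi> (fst z) * \<psi> (snd z))"
      by (intro continuous_intros cc)
    show "continuous_on {0..} (\<lambda>t. \<integral>z. \<phi> (fst (states z)) * \<psi> (snd (states z)) \<partial>pairs t)"
      by (rule continuous_on_eq[where f = "\<lambda>t. (\<integral>p. \<phi> (fst p) \<partial>N t) * (\<integral>p. \<psi> (fst p) \<partial>N t)"])
        (auto simp: prod_eq[simplified] intro!: continuous_intros cont_N \<phi> \<psi>)
    fix t :: real assume t: "0 < t"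
    then have t0: "0 \<le> t" by simp
    have "((\<lambda>t. (\<integral>p. \<phi> (fst p) \<partial>N t) * (\<integral>p. \<psi> (fst p) \<partial>N t)) has_real_derivative
       (\<integral>p. blinfun_apply (\<phi>' (fst p)) (vel t p) \<partial>N t) * (\<integral>p. \<psi> (fst p) \<partial>N t) +
       (\<integral>p. blinfun_apply (\<psi>' (fst p)) (vel t p) \<partial>N t) * (\<integral>p. \<phi> (fst p) \<partial>N t)) (at t)"
      unfolding vel_def by (intro DERIV_mult deriv_N \<phi> \<psi> t)
    also have "(\<integral>p. blinfun_apply (\<phi>' (fst p)) (vel t p) \<partial>N t) * (\<integral>p. \<psi> (fst p) \<partial>N t) =
       (\<integral>z. blinfun_apply (\<phi>' (fst (fst z))) (vel t (fst z)) * \<psi> (fst (snd z)) \<partial>pairs t)"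
      by (rule integral_pairs_prod[OF t0, symmetric]) (intro continuous_intros cc)+
    also have "(\<integral>p. blinfun_apply (\<psi>' (fst p)) (vel t p) \<partial>N t) * (\<integral>p. \<phi> (fst p) \<partial>N t) =
       (\<integral>z. \<phi> (fst (fst z)) * blinfun_apply (\<psi>' (fst (snd z))) (vel t (snd z)) \<partial>pairs t)"
      unfolding mult.commute[of _ "\<integral>p. \<phi> (fst p) \<partial>N t"]
      by (rule integral_pairs_prod[OF t0, symmetric]) (intro continuous_intros cc)+
    also have "(\<integral>z. blinfun_apply (\<phi>' (fst (fst z))) (vel t (fst z)) * \<psi> (fst (snd z)) \<partial>pairs t) +
      (\<integral>z. \<phi> (fst (fst z)) * blinfun_apply (\<psi>' (fst (snd z))) (vel t (snd z)) \<partial>pairs t) =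
      (\<integral>z. blinfun_apply (\<phi>' (fst (fst z))) (vel t (fst z)) * \<psi> (fst (snd z)) +
        \<phi> (fst (fst z)) * blinfun_apply (\<psi>' (fst (snd z))) (vel t (snd z)) \<partial>pairs t)"
      by (intro Bochner_Integration.integral_add[symmetric] integrable_pairs t0 continuous_intros cc)
    also have "\<dots> = (\<integral>z. blinfun_apply (F (states z)) (vel t (fst z), vel t (snd z)) \<partial>pairs t)"
      by (intro Bochner_Integration.integral_cong refl)
        (simp add: F_def blinfun.add_left blinfun.scaleR_left mult.commute)
    finally show "((\<lambda>t. \<integral>z. \<phi> (fst (states z)) * \<psi> (snd (states z)) \<partial>pairs t) has_real_derivative
       (\<integral>z. blinfun_apply (F (states z)) (vel t (fst z), vel t (snd z)) \<partial>pairs t)) (at t)"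
      \<comment> \<open>The factorisation is available only for nonnegative times, where
        \<open>N t\<close> is a probability measure.\<close>
      by (rule has_field_derivative_transform_within_open[where S = "{0<..}"])
        (use t prod_eq in auto)
  qed
next
  case (add \<Phi> \<Psi>)
  obtain F where F: "\<forall>z. (\<Phi> has_derivative blinfun_apply (F z)) (at z)" "continuous_on UNIV F"
    "continuous_on UNIV \<Phi>" "continuous_on {0..} (\<lambda>t. \<integral>z. \<Phi> (states z) \<partial>pairs t)"
    "\<And>t. 0 < t \<Longrightarrow> ((\<lambda>t. \<integral>z. \<Phi> (states z) \<partial>pairs t) has_real_derivative
      (\<integral>z. blinfun_apply (F (states z)) (vel t (fst z), vel t (snd z)) \<partial>pairs t)) (at t)"
    using add.IH(1) by blast
  obtain G where G: "\<forall>z. (\<Psi> has_derivative blinfun_apply (G z)) (at z)" "continuous_on UNIV G"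
    "continuous_on UNIV \<Psi>" "continuous_on {0..} (\<lambda>t. \<integral>z. \<Psi> (states z) \<partial>pairs t)"
    "\<And>t. 0 < t \<Longrightarrow> ((\<lambda>t. \<integral>z. \<Psi> (states z) \<partial>pairs t) has_real_derivative
      (\<integral>z. blinfun_apply (G (states z)) (vel t (fst z), vel t (snd z)) \<partial>pairs t)) (at t)"
    using add.IH(2) by blast
  note cc = continuous_on_compose2[OF F(2) _ subset_UNIV] continuous_on_compose2[OF F(3) _ subset_UNIV]
     continuous_on_compose2[OF G(2) _ subset_UNIV] continuous_on_compose2[OF G(3) _ subset_UNIV]
  have eq: "(\<integral>z. \<Phi> (states z) + \<Psi> (states z) \<partial>pairs t) =
    (\<integral>z. \<Phi> (states z) \<partial>pairs t) + (\<integral>z. \<Psi> (states z) \<partial>pairs t)" if "0 \<le> t" for t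
    by (intro Bochner_Integration.integral_add integrable_pairs that continuous_intros cc)
  show ?case
  proof (intro exI[of _ "\<lambda>z. F z + G z"] conjI allI impI)
    show "((\<lambda>z. \<Phi> z + \<Psi> z) has_derivative blinfun_apply (F z + G z)) (at z)" for z
    proof -
      have "blinfun_apply (F z + G z) = (\<lambda>h. blinfun_apply (F z) h + blinfun_apply (G z) h)"
        by (simp add: fun_eq_iff blinfun.add_left)
      moreover have "(\<Phi> has_derivative blinfun_apply (F z)) (at z)"
        "(\<Psi> has_derivative blinfun_apply (G z)) (at z)" using F(1) G(1) by blast+
      ultimately show ?thesis by (simp only: has_derivative_add)
    qed
    show "continuous_on {0..} (\<lambda>t. \<integral>z. \<Phi> (states z) + \<Psi> (states z) \<partial>pairs t)"
      by (rule continuous_on_eq[OF continuous_on_add[OF F(4) G(4)]]) (simp add: eq)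
    fix t :: real assume t: "0 < t"
    then have t0: "0 \<le> t" by simp
    have "((\<lambda>t. (\<integral>z. \<Phi> (states z) \<partial>pairs t) + (\<integral>z. \<Psi> (states z) \<partial>pairs t)) has_real_derivative
      (\<integral>z. blinfun_apply (F (states z)) (vel t (fst z), vel t (snd z)) \<partial>pairs t) +
      (\<integral>z. blinfun_apply (G (states z)) (vel t (fst z), vel t (snd z)) \<partial>pairs t)) (at t)"
      by (intro DERIV_add F G t)
    also have "(\<integral>z. blinfun_apply (F (states z)) (vel t (fst z), vel t (snd z)) \<partial>pairs t) +
      (\<integral>z. blinfun_apply (G (states z)) (vel t (fst z), vel t (snd z)) \<partial>pairs t) =
      (\<integral>z. blinfun_apply (F (states z) + G (states z)) (vel t (fst z), vel t (snd z)) \<partial>pairs t)"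
      unfolding blinfun.add_left
      by (intro Bochner_Integration.integral_add[symmetric] integrable_pairs t0 continuous_intros cc)
    finally show "((\<lambda>t. \<integral>z. \<Phi> (states z) + \<Psi> (states z) \<partial>pairs t) has_real_derivative
      (\<integral>z. blinfun_apply (F (states z) + G (states z)) (vel t (fst z), vel t (snd z)) \<partial>pairs t)) (at t)"
      by (rule has_field_derivative_transform_within_open[where S = "{0<..}"])
        (use t eq in auto)
  qed (intro continuous_intros cc F G)+
qed

lemma polynomial_sqd_deriv:
  assumes Q: "real_polynomial_function Q" and q: "\<And>x. (Q has_real_derivative q x) (at x)"
  shows "continuous_on {0..} (\<lambda>t. \<integral>z. Q (sqd z) \<partial>pairs t)"
    and "0 < t \<Longrightarrow> ((\<lambda>t. \<integral>z. Q (sqd z) \<partial>pairs t) has_real_derivative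
      (\<integral>z. q (sqd z) * sqd_rate t z \<partial>pairs t)) (at t)"
proof -
  define \<Phi> where "\<Phi> z = Q ((norm (fst z - snd z))\<^sup>2)" for z :: "(complex^'n^'n) \<times> (complex^'n^'n)"
  have "\<Phi> \<in> tensor"
    unfolding \<Phi>_def by (rule tensor_compose_polynomial[OF Q tensor_dist])
  then obtain F where F: "\<And>z. (\<Phi> has_derivative blinfun_apply (F z)) (at z)"
    "continuous_on {0..} (\<lambda>t. \<integral>z. \<Phi> (states z) \<partial>pairs t)"
    "\<And>t. 0 < t \<Longrightarrow> ((\<lambda>t. \<integral>z. \<Phi> (states z) \<partial>pairs t) has_real_derivative
      (\<integral>z. blinfun_apply (F (states z)) (vel t (fst z), vel t (snd z)) \<partial>pairs t)) (at t)"
    using tensor_deriv_aux by blast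
  have "(\<Phi> has_derivative (\<lambda>h. q ((norm (fst z - snd z))\<^sup>2) * (2 * ((fst z - snd z) \<bullet> (fst h - snd h))))) (at z)" for z
  proof -
    have "((\<lambda>z. (norm (fst z - snd z))\<^sup>2) has_derivative (\<lambda>h. 2 * ((fst z - snd z) \<bullet> (fst h - snd h)))) (at z)"
      unfolding power2_norm_eq_inner
      by (auto intro!: derivative_eq_intros simp: inner_commute)
    from has_derivative_compose[OF this q[unfolded has_field_derivative_def, of "(norm (fst z - snd z))\<^sup>2"]]
    show ?thesis by (simp add: \<Phi>_def[abs_def])
  qed
  \<comment> \<open>The induction yields some derivative \<open>F\<close>; uniqueness identifies it
    with the one from the chain rule.\<close>
  from has_derivative_unique[OF this F(1)]
  have F': "blinfun_apply (F z) h = q ((norm (fst z - snd z))\<^sup>2) * (2 * ((fst z - snd z) \<bullet> (fst h - snd h)))" for z h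
    by (simp only: fun_eq_iff)
  show "continuous_on {0..} (\<lambda>t. \<integral>z. Q (sqd z) \<partial>pairs t)"
    using F(2) by (simp add: \<Phi>_def sqd_def)
  show "0 < t \<Longrightarrow> ((\<lambda>t. \<integral>z. Q (sqd z) \<partial>pairs t) has_real_derivative
      (\<integral>z. q (sqd z) * sqd_rate t z \<partial>pairs t)) (at t)"
    using F(3)[of t] by (simp add: F' \<Phi>_def sqd_def sqd_rate_def)
qed

end

section \<open>The support diameter and the decay of the dispersion\<close>

lemma has_real_derivative_pos_part_power2:
  "((\<lambda>x. (max 0 (x - c))\<^sup>2) has_real_derivative 2 * max 0 (x - c)) (at (x::real))"
proof -
  consider "x < c" | "x > c" | "x = c" by linarith
  then show ?thesis
  proof cases
    case 1
    have "((\<lambda>x. 0) has_real_derivative 0) (at x)" by simp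
    then have "((\<lambda>x. (max 0 (x - c))\<^sup>2) has_real_derivative 0) (at x)"
      by (rule has_field_derivative_transform_within_open[where S = "{..<c}"]) (use 1 in auto)
    with 1 show ?thesis by simp
  next
    case 2
    have "((\<lambda>x. (x - c)\<^sup>2) has_real_derivative 2 * (x - c)) (at x)"
      by (auto intro!: derivative_eq_intros)
    then have "((\<lambda>x. (max 0 (x - c))\<^sup>2) has_real_derivative 2 * (x - c)) (at x)"
      by (rule has_field_derivative_transform_within_open[where S = "{c<..}"]) (use 2 in auto)
    with 2 show ?thesis by simp
  next
    case 3
    have "((\<lambda>h. (max 0 h)\<^sup>2 / h) \<longlongrightarrow> 0) (at (0::real))"
    proof (rule Lim_null_comparison)
      show "\<forall>\<^sub>F h in at (0::real). norm ((max 0 h)\<^sup>2 / h) \<le> \<bar>h\<bar>"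
        by (auto simp: max_def power2_eq_square intro!: always_eventually)
      show "((\<lambda>h::real. \<bar>h\<bar>) \<longlongrightarrow> 0) (at 0)"
        by (auto intro!: tendsto_eq_intros)
    qed
    then show ?thesis
      unfolding 3 DERIV_def by simp
  qed
qed

text \<open>The derivative is approximated within \<epsilon>/2 and then raised by \<epsilon>/2. This
  makes the error one-sided: a nonnegative error multiplied by \<open>sqd_rate\<close> needs only an
  upper bound of the rate. Integrating from 0, where both functions vanish because c is nonnegative,
  gives the bounds for \<open>Q\<close>.\<close>

lemma polynomial_majorant_pos_part:
  fixes c R \<epsilon> :: real
  assumes "0 \<le> c" "0 < \<epsilon>"
  obtains q Q where "real_polynomial_function Q" "\<And>x. (Q has_real_derivative q x) (at x)"
    "continuous_on UNIV q"
    "\<And>x. x \<in> {0..R} \<Longrightarrow> 2 * max 0 (x - c) \<le> q x \<and> q x \<le> 2 * max 0 (x - c) + \<epsilon>"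
    "\<And>x. x \<in> {0..R} \<Longrightarrow> (max 0 (x - c))\<^sup>2 \<le> Q x \<and> Q x \<le> (max 0 (x - c))\<^sup>2 + \<epsilon> * x"
proof -
  have "continuous_on {0..R} (\<lambda>x. 2 * max 0 (x - c))"
    by (intro continuous_intros)
  then obtain g where g: "real_polynomial_function g"
    "\<And>x. x \<in> {0..R} \<Longrightarrow> \<bar>2 * max 0 (x - c) - g x\<bar> < \<epsilon> / 2"
    using Stone_Weierstrass_real_polynomial_function[of "{0..R}" "\<lambda>x. 2 * max 0 (x - c)" "\<epsilon> / 2"] assms(2)
    by auto
  define q where "q x = g x + \<epsilon> / 2" for x
  have q: "real_polynomial_function q"
    unfolding q_def by (intro real_polynomial_function.intros(2,3) g)
  obtain Q where Q: "real_polynomial_function Q" "\<And>x. (Q has_real_derivative q x) (at x)" "Q 0 = 0"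
    using real_polynomial_function_antiderivative[OF q] by blast
  have qb: "2 * max 0 (x - c) \<le> q x \<and> q x \<le> 2 * max 0 (x - c) + \<epsilon>" if "x \<in> {0..R}" for x
    using g(2)[OF that] unfolding q_def by linarith
  have "(max 0 (x - c))\<^sup>2 \<le> Q x \<and> Q x \<le> (max 0 (x - c))\<^sup>2 + \<epsilon> * x" if "x \<in> {0..R}" for x
  proof
    have "Q 0 - (max 0 (0 - c))\<^sup>2 \<le> Q x - (max 0 (x - c))\<^sup>2"
    proof (rule DERIV_nonneg_imp_nondecreasing[of 0 x "\<lambda>x. Q x - (max 0 (x - c))\<^sup>2"])
      fix y assume "0 \<le> y" "y \<le> x"
      then show "\<exists>d. ((\<lambda>x. Q x - (max 0 (x - c))\<^sup>2) has_real_derivative d) (at y) \<and> 0 \<le> d"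
        using qb[of y] that
        by (intro exI[of _ "q y - 2 * max 0 (y - c)"] conjI DERIV_diff Q has_real_derivative_pos_part_power2) auto
    qed (use that in simp)
    then show "(max 0 (x - c))\<^sup>2 \<le> Q x" using Q(3) assms(1) by simp
    have "Q x - (max 0 (x - c))\<^sup>2 - x * \<epsilon> \<le> Q 0 - (max 0 (0 - c))\<^sup>2 - 0 * \<epsilon>"
    proof (rule DERIV_nonpos_imp_nonincreasing[of 0 x "\<lambda>x. Q x - (max 0 (x - c))\<^sup>2 - x * \<epsilon>"])
      fix y assume y: "0 \<le> y" "y \<le> x"
      have "((\<lambda>x. x * \<epsilon>) has_real_derivative \<epsilon>) (at y)"
        by (auto intro!: derivative_eq_intros)
      then show "\<exists>d. ((\<lambda>x. Q x - (max 0 (x - c))\<^sup>2 - x * \<epsilon>) has_real_derivative d) (at y) \<and> d \<le> 0"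
        using qb[of y] that y
        by (intro exI[of _ "q y - 2 * max 0 (y - c) - \<epsilon>"] conjI DERIV_diff Q has_real_derivative_pos_part_power2) auto
    qed (use that in simp)
    then show "Q x \<le> (max 0 (x - c))\<^sup>2 + \<epsilon> * x" using Q(3) assms(1) by (simp add: mult.commute)
  qed
  moreover have "continuous_on UNIV q"
    using q by (simp add: continuous_on_polymonial_function real_polynomial_function_eq)
  ultimately show ?thesis using that Q(1,2) qb by blast
qed

section \<open>Propagation of the diameter bound and exponential decay\<close>

context mean_field_flow
begin

definition spread :: "real \<Rightarrow> complex^'n^'n \<Rightarrow> real" where
  "spread t U = (\<integral>p. (norm (U - fst p))\<^sup>2 \<partial>N t)"

lemma unitary_dist_le:
  fixes U V :: "complex^'n^'n"
  assumes "U \<in> unitary_group" "V \<in> unitary_group"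
  shows "norm (U - V) \<le> 2 * norm (mat 1 :: complex^'n^'n)" "(norm (U - V))\<^sup>2 \<le> R2"
proof -
  show "norm (U - V) \<le> 2 * norm (mat 1 :: complex^'n^'n)"
    using norm_triangle_ineq4[of U V] norm_unitary[OF assms(1)] norm_unitary[OF assms(2)] by simp
  then show "(norm (U - V))\<^sup>2 \<le> R2"
    unfolding R2_def by (intro power_mono) auto
qed

text \<open>The mean \<open>m\<close> is in general not unitary, so the interaction estimate cannot
  be applied to it. But \<open>L\<close> is linear, so \<open>L m\<close> is the average of
  \<open>L\<close> over the particles, each of which is unitary; averaging the estimate produces
  \<open>spread\<close>.\<close>

lemma sqd_rate_le:
  assumes t: "0 \<le> t" and z: "z \<in> (unitary_group \<times> S) \<times> (unitary_group \<times> S)"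
  shows "sqd_rate t z \<le> 2 * \<alpha> * norm (fst (fst z) - fst (snd z))
    - \<kappa> * sqd z * (2 - spread t (fst (fst z)) / 2 - spread t (fst (snd z)) / 2)"
proof -
  interpret prob_space "N t" by (rule prob_N[OF t])
  obtain U A V B where z_eq: "z = ((U, A), (V, B))" by (metis prod.collapse)
  with z have U: "U \<in> unitary_group" and V: "V \<in> unitary_group" and A: "A \<in> S" and B: "B \<in> S" by auto
  define m where "m = (\<integral>p. fst p \<partial>N t)"
  define L where "L W = (U - V) \<bullet> (U ** ctranspose W ** U - V ** ctranspose W ** V)" for W
  have "linear L"
    by (intro linearI) (simp_all add: L_def matrix_mult.add_left matrix_mult.add_right ctranspose_add ctranspose_scaleR
        inner_add_right inner_diff_right matrix_mult.scaleR_left matrix_mult.scaleR_right algebra_simps)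
  then have L: "bounded_linear L" by (simp add: linear_conv_bounded_linear)
  have intf: "integrable (N t) fst"
    by (intro integrable_N t continuous_intros)
  have ints: "integrable (N t) (\<lambda>p. (norm (X - fst p))\<^sup>2)" for X
    by (intro integrable_N t continuous_intros)
  have "L m = (\<integral>p. L (fst p) \<partial>N t)"
    unfolding m_def by (rule integral_bounded_linear[OF L intf, symmetric])
  also have "\<dots> \<ge> (\<integral>p. (norm (U - V))\<^sup>2 * (2 - (norm (U - fst p))\<^sup>2 / 2 - (norm (V - fst p))\<^sup>2 / 2) \<partial>N t)"
  proof (rule integral_mono_AE)
    show "AE p in N t. (norm (U - V))\<^sup>2 * (2 - (norm (U - fst p))\<^sup>2 / 2 - (norm (V - fst p))\<^sup>2 / 2) \<le> L (fst p)"
      using supp_N[OF t] by eventually_elim (auto simp: L_def intro: interaction_inner_ge[OF U V])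
    show "integrable (N t) (\<lambda>p. L (fst p))"
      by (rule integrable_bounded_linear[OF L intf])
    show "integrable (N t) (\<lambda>p. (norm (U - V))\<^sup>2 * (2 - (norm (U - fst p))\<^sup>2 / 2 - (norm (V - fst p))\<^sup>2 / 2))"
      by (intro integrable_N t continuous_intros) auto
  qed
  also have "(\<integral>p. (norm (U - V))\<^sup>2 * (2 - (norm (U - fst p))\<^sup>2 / 2 - (norm (V - fst p))\<^sup>2 / 2) \<partial>N t)
      = (norm (U - V))\<^sup>2 * (2 - spread t U / 2 - spread t V / 2)"
    unfolding spread_def using ints by (simp add: prob_space)
  finally have Lm: "L m \<ge> (norm (U - V))\<^sup>2 * (2 - spread t U / 2 - spread t V / 2)" .
  have "vel t (U, A) - vel t (V, B) =
    (A ** U - B ** V) - (\<kappa> / 2) *\<^sub>R (U ** ctranspose m ** U - V ** ctranspose m ** V)"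
    by (simp add: vel_def flow_velocity_def m_def algebra_simps)
  then have "sqd_rate t z = 2 * ((U - V) \<bullet> (A ** U - B ** V)) - \<kappa> * L m"
    by (simp only: sqd_rate_def z_eq L_def fst_conv snd_conv inner_diff_right[of _ "A ** U - B ** V"]
        inner_scaleR_right) simp
  also have "\<dots> \<le> 2 * (norm (U - V) * \<alpha>) - \<kappa> * ((norm (U - V))\<^sup>2 * (2 - spread t U / 2 - spread t V / 2))"
  proof (intro diff_mono mult_left_mono)
    have "(U - V) \<bullet> (A ** U - B ** V) \<le> norm (U - V) * norm (A - B)"
      using A skew_S by (intro drift_inner_le V) auto
    also have "\<dots> \<le> norm (U - V) * \<alpha>"
      using diam_S[OF A B] by (intro mult_left_mono) auto
    finally show "(U - V) \<bullet> (A ** U - B ** V) \<le> norm (U - V) * \<alpha>" .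
  qed (use Lm \<kappa>_pos in auto)
  finally show ?thesis
    by (simp add: z_eq sqd_def algebra_simps)
qed

text \<open>Here \<open>e\<close> is the mean excess seen from one particle and \<open>e2\<close>
  the mean squared excess. Since \<open>spread\<close> is at most D^2 + \<open>e\<close>, a pair at
  distance above D separates only through \<open>e\<close>. Jensen bounds the square of
  \<open>e\<close> by \<open>e2\<close>, whose mean is \<open>G\<close>, so formally G' \<le> L G
  with G 0 = 0. The actual differentiation is done for a polynomial majorant \<open>H\<close> of
  \<open>G\<close>, up to errors of order \<epsilon>.\<close>

lemma diameter_preserved:
  assumes D: "0 < D" "\<alpha> \<le> \<kappa> * D * (1 - D\<^sup>2 / 2)"
    and init: "AE z in pairs 0. sqd z \<le> D\<^sup>2" and T: "0 \<le> T"
  shows "AE z in pairs T. sqd z \<le> D\<^sup>2"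
proof -
  define pos where "pos x = max 0 (x - D\<^sup>2)" for x :: real
  define G where "G t = (\<integral>z. (pos (sqd z))\<^sup>2 \<partial>pairs t)" for t
  define e where "e t U = (\<integral>p. pos ((norm (U - fst p))\<^sup>2) \<partial>N t)" for t U
  define e2 where "e2 t p = (\<integral>p'. (pos (sqd (p, p')))\<^sup>2 \<partial>N t)" for t p
  \<comment> \<open>A crude upper bound for \<open>sqd_rate\<close> on unitary pairs, used only
    where the rate is multiplied by the approximation error.\<close>
  define C where "C = 2 * \<alpha> * (2 * norm (mat 1 :: complex^'n^'n)) + \<kappa> * R2 * R2"
  have "0 \<le> \<kappa> * D * (1 - D\<^sup>2 / 2)" using D(2) \<alpha>_nonneg by linarith
  then have D2: "0 \<le> 1 - D\<^sup>2 / 2"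
    using mult_pos_pos[OF \<kappa>_pos D(1)] by (simp add: zero_le_mult_iff)
  have C: "0 \<le> C" using \<alpha>_nonneg \<kappa>_pos R2_pos by (simp add: C_def)
  have pos_cont: "continuous_on A g \<Longrightarrow> continuous_on A (\<lambda>x. pos (g x))" for A :: "'x::topological_space set" and g
    unfolding pos_def by (intro continuous_intros)
  have sqd_cont: "continuous_on UNIV (\<lambda>z. (pos (sqd z))\<^sup>2)"
    by (intro continuous_intros pos_cont)
  have e2_int: "integrable (N t) (e2 t)" "(\<integral>p. e2 t p \<partial>N t) = G t" if t: "0 \<le> t" for t
  proof -
    interpret prob_space "N t" by (rule prob_N[OF t])
    interpret pair_prob_space "N t" "N t" ..
    show "integrable (N t) (e2 t)" "(\<integral>p. e2 t p \<partial>N t) = G t"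
      using integrable_fst'[OF integrable_pairs[OF t sqd_cont]] integral_fst'[OF integrable_pairs[OF t sqd_cont]]
      by (simp_all add: e2_def[abs_def] G_def)
  qed
  have e_le: "(e t (fst p))\<^sup>2 \<le> e2 t p" if t: "0 \<le> t" for t p
  proof -
    interpret prob_space "N t" by (rule prob_N[OF t])
    have "(e t (fst p))\<^sup>2 \<le> (\<integral>p'. (pos ((norm (fst p - fst p'))\<^sup>2))\<^sup>2 \<partial>N t)"
      unfolding e_def by (intro power2_expectation_le integrable_N t continuous_intros pos_cont)
    then show ?thesis by (simp add: e2_def sqd_def)
  qed
  have e_nonneg: "0 \<le> e t U" for t U
    unfolding e_def pos_def by (intro integral_nonneg_AE) auto
  have spread_le: "spread t U \<le> D\<^sup>2 + e t U" if t: "0 \<le> t" for t U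
  proof -
    interpret prob_space "N t" by (rule prob_N[OF t])
    have "spread t U \<le> (\<integral>p. D\<^sup>2 + pos ((norm (U - fst p))\<^sup>2) \<partial>N t)"
      unfolding spread_def
      by (intro integral_mono integrable_N t continuous_intros pos_cont) (auto simp: pos_def)
    also have "\<dots> = D\<^sup>2 + e t U"
      unfolding e_def by (subst Bochner_Integration.integral_add)
        (auto simp: prob_space intro!: integrable_N t continuous_intros pos_cont)
    finally show ?thesis .
  qed
  have spread_le_R2: "spread t U \<le> R2" if t: "0 \<le> t" and U: "U \<in> unitary_group" for t U
  proof -
    interpret prob_space "N t" by (rule prob_N[OF t])
    have "spread t U \<le> (\<integral>p. R2 \<partial>N t)"
      unfolding spread_def
      using supp_N[OF t] unitary_dist_le(2)[OF U]
      by (intro integral_mono_AE integrable_N t continuous_intros) (auto elim!: eventually_mono)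
    then show ?thesis by (simp add: prob_space)
  qed
  have rate_C: "sqd_rate t z \<le> C" if t: "0 \<le> t" and z: "z \<in> (unitary_group \<times> S) \<times> (unitary_group \<times> S)" for t z
  proof -
    have U: "fst (fst z) \<in> unitary_group" "fst (snd z) \<in> unitary_group" using z by auto
    have "sqd z * (spread t (fst (fst z)) / 2 + spread t (fst (snd z)) / 2 - 2) \<le> sqd z * R2"
      using spread_le_R2[OF t U(1)] spread_le_R2[OF t U(2)]
      by (intro mult_left_mono) (auto simp: sqd_def)
    also have "\<dots> \<le> R2 * R2"
      using unitary_dist_le(2)[OF U] R2_pos by (intro mult_right_mono) (auto simp: sqd_def)
    finally have "sqd z * (spread t (fst (fst z)) / 2 + spread t (fst (snd z)) / 2 - 2) \<le> R2 * R2" .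
    then have "\<kappa> * (sqd z * (spread t (fst (fst z)) / 2 + spread t (fst (snd z)) / 2 - 2)) \<le> \<kappa> * (R2 * R2)"
      using \<kappa>_pos by (intro mult_left_mono) auto
    moreover have "2 * \<alpha> * norm (fst (fst z) - fst (snd z)) \<le> 2 * \<alpha> * (2 * norm (mat 1 :: complex^'n^'n))"
      using unitary_dist_le(1)[OF U] \<alpha>_nonneg by (intro mult_left_mono) auto
    ultimately show ?thesis
      using sqd_rate_le[OF t z] by (simp add: C_def algebra_simps)
  qed
  \<comment> \<open>The left side is what the exact functional would have under its time derivative.
    Pairs within distance D contribute nothing to it.\<close>
  have rate_pos: "2 * pos (sqd z) * sqd_rate t z \<le> \<kappa> * R2 * ((pos (sqd z))\<^sup>2 + (e2 t (fst z) + e2 t (snd z)) / 2)"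
    if t: "0 \<le> t" and z: "z \<in> (unitary_group \<times> S) \<times> (unitary_group \<times> S)" for t z
  proof (cases "sqd z \<le> D\<^sup>2")
    case True
    have "0 \<le> e2 t p" for p
      using e_le[OF t, of p] by (meson order_trans zero_le_power2)
    then show ?thesis using True \<kappa>_pos R2_pos by (simp add: pos_def)
  next
    case False
    define r where "r = norm (fst (fst z) - fst (snd z))"
    define s where "s = (e t (fst (fst z)) + e t (fst (snd z))) / 2"
    have r2: "sqd z = r\<^sup>2" by (simp add: sqd_def r_def)
    have "D \<le> r"
      using False D(1) power2_le_imp_le[of D r] by (simp add: r2 r_def)
    \<comment> \<open>From r \<ge> D, the condition on \<alpha> lets the contraction at spread D^2
      absorb the whole drift. What remains of the rate is \<kappa> r^2 s, where s averages the two
      mean excesses.\<close>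
    have "\<alpha> * r \<le> \<kappa> * D * (1 - D\<^sup>2 / 2) * r"
      using D \<open>D \<le> r\<close> by (intro mult_right_mono) auto
    also have "\<dots> \<le> \<kappa> * r * (1 - D\<^sup>2 / 2) * r"
      using D \<open>D \<le> r\<close> D2 \<kappa>_pos by (intro mult_right_mono mult_left_mono) auto
    finally have 1: "\<alpha> * r \<le> \<kappa> * (r\<^sup>2 * (1 - D\<^sup>2 / 2))" by (simp add: power2_eq_square algebra_simps)
    have U: "fst (fst z) \<in> unitary_group" "fst (snd z) \<in> unitary_group" using z by auto
    have "r\<^sup>2 * (2 - D\<^sup>2 - s) \<le> r\<^sup>2 * (2 - spread t (fst (fst z)) / 2 - spread t (fst (snd z)) / 2)"
      using spread_le[OF t, of "fst (fst z)"] spread_le[OF t, of "fst (snd z)"]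
      by (intro mult_left_mono) (auto simp: s_def add_divide_distrib)
    then have "\<kappa> * (r\<^sup>2 * (2 - D\<^sup>2 - s)) \<le> \<kappa> * (r\<^sup>2 * (2 - spread t (fst (fst z)) / 2 - spread t (fst (snd z)) / 2))"
      using \<kappa>_pos by (rule mult_left_mono[OF _ less_imp_le])
    then have "sqd_rate t z \<le> 2 * (\<alpha> * r) - \<kappa> * (r\<^sup>2 * (2 - D\<^sup>2 - s))"
      using sqd_rate_le[OF t z] by (simp add: r2 r_def algebra_simps)
    also have "\<dots> \<le> \<kappa> * r\<^sup>2 * s" using 1 by (simp add: algebra_simps)
    also have "\<dots> \<le> \<kappa> * R2 * s"
      using unitary_dist_le(2)[OF U] \<kappa>_pos e_nonneg by (intro mult_right_mono mult_left_mono) (auto simp: r_def s_def)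
    finally have "2 * pos (sqd z) * sqd_rate t z \<le> 2 * pos (sqd z) * (\<kappa> * R2 * s)"
      by (intro mult_left_mono) (auto simp: pos_def)
    also have "\<dots> = \<kappa> * R2 * (2 * pos (sqd z) * s)" by simp
    also have "\<dots> \<le> \<kappa> * R2 * ((pos (sqd z))\<^sup>2 + (e2 t (fst z) + e2 t (snd z)) / 2)"
    proof (intro mult_left_mono)
      have "2 * pos (sqd z) * e t U \<le> (pos (sqd z))\<^sup>2 + (e t U)\<^sup>2" for U
        by (rule sum_squares_bound)
      from this[of "fst (fst z)"] this[of "fst (snd z)"]
      show "2 * pos (sqd z) * s \<le> (pos (sqd z))\<^sup>2 + (e2 t (fst z) + e2 t (snd z)) / 2"
        using e_le[OF t, of "fst z"] e_le[OF t, of "snd z"]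
        by (simp add: s_def algebra_simps add_divide_distrib)
    qed (use \<kappa>_pos R2_pos in auto)
    finally show ?thesis .
  qed
  \<comment> \<open>After integration the squared excess and the average of the two
    \<open>e2\<close> terms each contribute \<kappa> \<open>R2\<close> \<open>G\<close>.\<close>
  define L where "L = 2 * \<kappa> * R2"
  have L: "0 < L" using \<kappa>_pos R2_pos by (simp add: L_def)
  have sqd_R2: "sqd z \<in> {0..R2}" if "z \<in> (unitary_group \<times> S) \<times> (unitary_group \<times> S)" for z
    using that unitary_dist_le(2) by (auto simp: sqd_def)
  \<comment> \<open>Both the initial value of \<open>H\<close> and the error in its differential
    inequality are proportional to \<epsilon>, and so is the Gronwall bound; letting \<epsilon> tend
    to 0 gives \<open>G T\<close> \<le> 0.\<close>
  have bound: "G T \<le> \<epsilon> * ((R2 + C / L) * exp (L * T))" if \<epsilon>: "0 < \<epsilon>" for \<epsilon>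
  proof -
    obtain Q q where Q: "real_polynomial_function Q" "\<And>x. (Q has_real_derivative q x) (at x)"
      and qc: "continuous_on UNIV q"
      and q: "\<And>x. x \<in> {0..R2} \<Longrightarrow> 2 * pos x \<le> q x \<and> q x \<le> 2 * pos x + \<epsilon>"
      and Qb: "\<And>x. x \<in> {0..R2} \<Longrightarrow> (pos x)\<^sup>2 \<le> Q x \<and> Q x \<le> (pos x)\<^sup>2 + \<epsilon> * x"
      unfolding pos_def using polynomial_majorant_pos_part[OF zero_le_power2 \<epsilon>, of R2 D] by metis
    define H where "H t = (\<integral>z. Q (sqd z) \<partial>pairs t)" for t
    have Qc: "continuous_on UNIV Q"
      using Q(2) by (auto intro!: continuous_at_imp_continuous_on DERIV_isCont)
    have QcH: "continuous_on UNIV (\<lambda>z. Q (sqd z))"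
      by (intro continuous_on_compose2[OF Qc] continuous_intros) auto
    have G_le_H: "G t \<le> H t" if t: "0 \<le> t" for t
      unfolding G_def H_def
      using supp_pairs[OF t] Qb[OF sqd_R2]
      by (intro integral_mono_AE integrable_pairs t sqd_cont QcH) (auto elim!: eventually_mono)
    have "H 0 \<le> (\<integral>z. \<epsilon> * R2 \<partial>pairs 0)"
      unfolding H_def
    proof (intro integral_mono_AE integrable_pairs order_refl QcH continuous_on_const)
      show "AE z in pairs 0. Q (sqd z) \<le> \<epsilon> * R2"
        using supp_pairs[OF order_refl] init
      proof eventually_elim
        case (elim z)
        have "Q (sqd z) \<le> (pos (sqd z))\<^sup>2 + \<epsilon> * sqd z" using Qb[OF sqd_R2[OF elim(1)]] by blast
        also have "\<dots> \<le> \<epsilon> * R2" using elim(2) sqd_R2[OF elim(1)] \<epsilon> by (simp add: pos_def)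
        finally show ?case .
      qed
    qed
    also have "\<dots> = \<epsilon> * R2"
    proof -
      interpret prob_space "N 0" by (rule prob_N) simp
      interpret pair_prob_space "N 0" "N 0" ..
      show ?thesis by (simp add: P.prob_space)
    qed
    finally have H0: "H 0 \<le> \<epsilon> * R2" .
    have deriv: "(H has_real_derivative (\<integral>z. q (sqd z) * sqd_rate t z \<partial>pairs t)) (at t)"
      and deriv_le: "(\<integral>z. q (sqd z) * sqd_rate t z \<partial>pairs t) \<le> L * H t + \<epsilon> * C" if t: "0 < t" for t
    proof -
      show "(H has_real_derivative (\<integral>z. q (sqd z) * sqd_rate t z \<partial>pairs t)) (at t)"
        unfolding H_def by (rule polynomial_sqd_deriv(2)[OF Q t])
      have t0: "0 \<le> t" using t by simp
      interpret prob_space "N t" by (rule prob_N[OF t0])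
      interpret pair_prob_space "N t" "N t" ..
      note e2 = prob_space.pair_integral_fst[OF prob_N[OF t0] e2_int(1)[OF t0]]
        prob_space.pair_integral_snd[OF prob_N[OF t0] e2_int(1)[OF t0]]
      have "(\<integral>z. q (sqd z) * sqd_rate t z \<partial>pairs t) \<le>
        (\<integral>z. \<kappa> * R2 * ((pos (sqd z))\<^sup>2 + (e2 t (fst z) + e2 t (snd z)) / 2) + \<epsilon> * C \<partial>pairs t)"
      proof (rule integral_mono_AE)
        show "integrable (pairs t) (\<lambda>z. q (sqd z) * sqd_rate t z)"
          by (intro integrable_pairs t0 continuous_intros continuous_on_compose2[OF qc]) auto
        show "integrable (pairs t) (\<lambda>z. \<kappa> * R2 * ((pos (sqd z))\<^sup>2 + (e2 t (fst z) + e2 t (snd z)) / 2) + \<epsilon> * C)"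
          using e2 integrable_pairs[OF t0 sqd_cont] by simp
        show "AE z in pairs t. q (sqd z) * sqd_rate t z \<le>
          \<kappa> * R2 * ((pos (sqd z))\<^sup>2 + (e2 t (fst z) + e2 t (snd z)) / 2) + \<epsilon> * C"
          using supp_pairs[OF t0]
        proof eventually_elim
          case (elim z)
          have qz: "0 \<le> q (sqd z) - 2 * pos (sqd z)" "q (sqd z) - 2 * pos (sqd z) \<le> \<epsilon>"
            using q[OF sqd_R2[OF elim]] by auto
          have "(q (sqd z) - 2 * pos (sqd z)) * sqd_rate t z \<le> (q (sqd z) - 2 * pos (sqd z)) * C"
            using rate_C[OF t0 elim] qz by (intro mult_left_mono) auto
          also have "\<dots> \<le> \<epsilon> * C" using qz C by (intro mult_right_mono) auto
          finally show ?case using rate_pos[OF t0 elim] by (simp add: left_diff_distrib)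
        qed
      qed
      also have "\<dots> = L * G t + \<epsilon> * C"
        using e2 integrable_pairs[OF t0 sqd_cont] e2_int(2)[OF t0]
        by (simp add: P.prob_space G_def[symmetric] L_def)
      also have "\<dots> \<le> L * H t + \<epsilon> * C"
        using G_le_H[OF t0] L by simp
      finally show "(\<integral>z. q (sqd z) * sqd_rate t z \<partial>pairs t) \<le> L * H t + \<epsilon> * C" .
    qed
    have "H T \<le> (H 0 + \<epsilon> * C / L) * exp (L * T) - \<epsilon> * C / L"
    proof (rule gronwall_affine[OF T])
      show "continuous_on {0..T} H"
        unfolding H_def using polynomial_sqd_deriv(1)[OF Q] by (rule continuous_on_subset) auto
    qed (use deriv deriv_le L in blast)+
    also have "\<dots> \<le> (H 0 + \<epsilon> * C / L) * exp (L * T)"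
      using C L \<epsilon> by simp
    also have "\<dots> \<le> (\<epsilon> * R2 + \<epsilon> * C / L) * exp (L * T)"
      using H0 by (intro mult_right_mono) auto
    finally have "H T \<le> \<epsilon> * ((R2 + C / L) * exp (L * T))"
      by (simp add: algebra_simps)
    with G_le_H[OF T] show ?thesis by simp
  qed
  have K: "0 < (R2 + C / L) * exp (L * T)" using R2_pos C L by (simp add: add_pos_nonneg)
  have "G T \<le> 0"
  proof (rule field_le_epsilon)
    fix d :: real assume "0 < d"
    then show "G T \<le> 0 + d"
      using bound[of "d / ((R2 + C / L) * exp (L * T))"] K by (simp split: if_splits)
  qed
  moreover have "0 \<le> G T" unfolding G_def by simp
  ultimately have "(\<integral>z. (pos (sqd z))\<^sup>2 \<partial>pairs T) = 0" unfolding G_def by (rule antisym)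
  then have "AE z in pairs T. (pos (sqd z))\<^sup>2 = 0"
    by (subst (asm) integral_nonneg_eq_0_iff_AE) (use integrable_pairs[OF T sqd_cont] in auto)
  then show ?thesis by eventually_elim (simp add: pos_def max_def split: if_splits)
qed

lemma dispersion_bound:
  assumes D: "0 < D" "D\<^sup>2 < 2" "\<alpha> \<le> \<kappa> * D * (1 - D\<^sup>2 / 2)"
    and init: "AE z in pairs 0. sqd z \<le> D\<^sup>2" and T: "0 \<le> T"
  defines "c \<equiv> \<kappa> * (1 - D\<^sup>2 / 2)"
  shows "(\<integral>z. sqd z \<partial>pairs T) \<le> (\<integral>z. sqd z \<partial>pairs 0) * exp (- (c * T)) + (\<alpha> / c)\<^sup>2"
proof -
  define F where "F t = (\<integral>z. sqd z \<partial>pairs t)" for t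
  have c: "0 < c" using D \<kappa>_pos by (simp add: c_def)
  have id: "real_polynomial_function (\<lambda>x::real. x)" "((\<lambda>x::real. x) has_real_derivative 1) (at x)" for x
    by (simp_all add: real_polynomial_function.intros(1) bounded_linear_ident)
  have deriv: "(F has_real_derivative (\<integral>z. sqd_rate t z \<partial>pairs t)) (at t)"
    and deriv_le: "(\<integral>z. sqd_rate t z \<partial>pairs t) \<le> - c * F t + \<alpha>\<^sup>2 / c" if t: "0 < t" for t
  proof -
    show "(F has_real_derivative (\<integral>z. sqd_rate t z \<partial>pairs t)) (at t)"
      using polynomial_sqd_deriv(2)[OF id t] by (simp add: F_def[abs_def])
    have t0: "0 \<le> t" using t by simp
    interpret prob_space "N t" by (rule prob_N[OF t0])
    interpret pair_prob_space "N t" "N t" ..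
    \<comment> \<open>The diameter bound holds for almost all pairs, so by Fubini the bound on
      \<open>spread\<close> is obtained for almost every particle.\<close>
    have "AE p in N t. AE p' in N t. sqd (p, p') \<le> D\<^sup>2"
      using AE_pair[OF diameter_preserved[OF D(1,3) init t0]] .
    then have spread_le: "AE p in N t. spread t (fst p) \<le> D\<^sup>2"
    proof eventually_elim
      case (elim p)
      have "spread t (fst p) \<le> (\<integral>p'. D\<^sup>2 \<partial>N t)"
        unfolding spread_def
        using elim by (intro integral_mono_AE integrable_N t0 continuous_intros) (simp add: sqd_def)
      then show ?case by (simp add: prob_space.prob_space[OF prob_N[OF t0]])
    qed
    have "(\<integral>z. sqd_rate t z \<partial>pairs t) \<le> (\<integral>z. - c * sqd z + \<alpha>\<^sup>2 / c \<partial>pairs t)"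
    proof (intro integral_mono_AE integrable_pairs t0 continuous_intros)
      show "AE z in pairs t. sqd_rate t z \<le> - c * sqd z + \<alpha>\<^sup>2 / c"
        using supp_pairs[OF t0] prob_space.AE_pair_fst[OF prob_N[OF t0] spread_le]
          prob_space.AE_pair_snd[OF prob_N[OF t0] spread_le]
      proof eventually_elim
        case (elim z)
        define r where "r = norm (fst (fst z) - fst (snd z))"
        have r2: "sqd z = r\<^sup>2" by (simp add: sqd_def r_def)
        have "r\<^sup>2 * (2 * (1 - D\<^sup>2 / 2)) \<le> r\<^sup>2 * (2 - spread t (fst (fst z)) / 2 - spread t (fst (snd z)) / 2)"
          using elim by (intro mult_left_mono) auto
        then have "\<kappa> * (r\<^sup>2 * (2 * (1 - D\<^sup>2 / 2))) \<le> \<kappa> * (r\<^sup>2 * (2 - spread t (fst (fst z)) / 2 - spread t (fst (snd z)) / 2))"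
          using \<kappa>_pos by (rule mult_left_mono[OF _ less_imp_le])
        then have "sqd_rate t z \<le> 2 * \<alpha> * r - 2 * c * r\<^sup>2"
          using sqd_rate_le[OF t0 elim(1)] by (simp add: r2 r_def c_def algebra_simps)
        \<comment> \<open>Young's inequality weighted by sqrt c: the drift uses up half of the
          dissipation 2 c r^2 and leaves decay at rate c.\<close>
        also have "2 * \<alpha> * r \<le> \<alpha>\<^sup>2 / c + c * r\<^sup>2"
          using sum_squares_bound[of "\<alpha> / sqrt c" "sqrt c * r"] c
          by (simp add: power_mult_distrib power_divide)
        finally show ?case by (simp add: r2)
      qed
    qed
    also have "\<dots> = - c * F t + \<alpha>\<^sup>2 / c"
      using integrable_pairs[OF t0 continuous_sqd] by (simp add: F_def P.prob_space)
    finally show "(\<integral>z. sqd_rate t z \<partial>pairs t) \<le> - c * F t + \<alpha>\<^sup>2 / c" .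
  qed
  have "F T \<le> (F 0 + \<alpha>\<^sup>2 / c / - c) * exp (- c * T) - \<alpha>\<^sup>2 / c / - c"
  proof (rule gronwall_affine[OF T])
    show "continuous_on {0..T} F"
      using polynomial_sqd_deriv(1)[OF id] unfolding F_def by (rule continuous_on_subset) auto
  qed (use deriv deriv_le c in \<open>auto intro!: exI\<close>)
  also have "\<dots> \<le> F 0 * exp (- (c * T)) + (\<alpha> / c)\<^sup>2"
  proof -
    have "0 \<le> \<alpha>\<^sup>2 / c / c * exp (- (c * T))" using c by simp
    then show ?thesis by (simp add: algebra_simps power_divide power2_eq_square)
  qed
  finally show ?thesis by (simp add: F_def)
qed

end

section \<open>Laws on the phase space\<close>

text \<open>Each point outside a support has a null neighbourhood, but there are uncountably many
  such points. Second countability selects countably many neighbourhoods that cover them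
  all.\<close>

lemma AE_Lindelof:
  fixes g :: "'a \<Rightarrow> 'b::second_countable_topology"
  assumes "\<And>x. x \<in> X \<Longrightarrow> \<exists>T. open T \<and> x \<in> T \<and> (AE y in M. g y \<notin> T)"
  shows "AE y in M. g y \<notin> X"
proof -
  define F where "F = {T. open T \<and> (AE y in M. g y \<notin> T)}"
  obtain F' where F': "F' \<subseteq> F" "countable F'" "\<Union>F' = \<Union>F"
    using Lindelof[of F] by (auto simp: F_def)
  have "AE y in M. \<forall>T\<in>F'. g y \<notin> T"
    using F' by (intro AE_ball_countable') (auto simp: F_def)
  then show ?thesis
  proof eventually_elim
    case (elim y)
    moreover have "X \<subseteq> \<Union>F'" using assms unfolding F'(3) F_def by blast
    ultimately show ?case by blast
  qed
qed

section \<open>Continuously differentiable bumps and cut-offs on matrices\<close>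

lemma radial_C1:
  fixes a :: "'a::real_inner"
  assumes \<theta>: "\<And>x. (\<theta> has_real_derivative \<theta>' x) (at x)" and cont: "continuous_on UNIV \<theta>'"
  obtains \<xi>' where "\<And>x. ((\<lambda>x. \<theta> ((norm (x - a))\<^sup>2)) has_derivative blinfun_apply (\<xi>' x)) (at x)"
    "continuous_on UNIV \<xi>'"
proof (rule that[of "\<lambda>x. \<theta>' ((norm (x - a))\<^sup>2) *\<^sub>R (2 *\<^sub>R blinfun_inner_right (x - a))"])
  show "((\<lambda>x. \<theta> ((norm (x - a))\<^sup>2)) has_derivative
    blinfun_apply (\<theta>' ((norm (x - a))\<^sup>2) *\<^sub>R (2 *\<^sub>R blinfun_inner_right (x - a)))) (at x)" for x
  proof -
    have "((\<lambda>x. (norm (x - a))\<^sup>2) has_derivative (\<lambda>h. 2 * ((x - a) \<bullet> h))) (at x)"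
      unfolding power2_norm_eq_inner by (auto intro!: derivative_eq_intros simp: inner_commute)
    from has_derivative_compose[OF this \<theta>[unfolded has_field_derivative_def, of "(norm (x - a))\<^sup>2"]]
    show ?thesis
      by (rule has_derivative_eq_rhs) (simp add: fun_eq_iff blinfun.scaleR_left)
  qed
  show "continuous_on UNIV (\<lambda>x. \<theta>' ((norm (x - a))\<^sup>2) *\<^sub>R (2 *\<^sub>R blinfun_inner_right (x - a)))"
    by (intro continuous_intros continuous_on_compose2[OF cont]
        bounded_linear.continuous_on[OF bounded_linear_blinfun_inner_right]) auto
qed

text \<open>On phase space only C^1 is required of test functions, so the squared positive part of
  \<epsilon>^2 - |x - a|^2 will do; no flat exponential is needed as in time.\<close>

lemma bump_C1:
  fixes a :: "'a::real_inner"
  assumes \<epsilon>: "0 \<le> \<epsilon>"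
  obtains \<xi> \<xi>' where "\<And>x. (\<xi> has_derivative blinfun_apply (\<xi>' x)) (at x)" "continuous_on UNIV \<xi>'"
    "\<And>x. norm (x - a) < \<epsilon> \<Longrightarrow> 0 < \<xi> x" "\<And>x. \<epsilon> \<le> norm (x - a) \<Longrightarrow> \<xi> x = (0::real)"
proof -
  define \<theta> where "\<theta> x = (max 0 (- x - - \<epsilon>\<^sup>2))\<^sup>2" for x :: real
  define \<theta>' where "\<theta>' x = - (2 * max 0 (- x - - \<epsilon>\<^sup>2))" for x :: real
  have "(\<theta> has_real_derivative \<theta>' x) (at x)" for x
  proof -
    have "((\<lambda>x. - x) has_real_derivative - 1) (at x)" by (auto intro!: derivative_eq_intros)
    from DERIV_chain2[OF has_real_derivative_pos_part_power2[of "- \<epsilon>\<^sup>2" "- x"] this]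
    show ?thesis by (simp add: \<theta>_def[abs_def] \<theta>'_def)
  qed
  moreover have "continuous_on UNIV \<theta>'"
    unfolding \<theta>'_def by (intro continuous_intros)
  ultimately obtain \<xi>' where
    "\<And>x. ((\<lambda>x. \<theta> ((norm (x - a))\<^sup>2)) has_derivative blinfun_apply (\<xi>' x)) (at x)"
    "continuous_on UNIV \<xi>'"
    using radial_C1 by blast
  then show ?thesis
  proof (rule that)
    fix x
    show "0 < \<theta> ((norm (x - a))\<^sup>2)" if "norm (x - a) < \<epsilon>"
    proof -
      have "(norm (x - a))\<^sup>2 < \<epsilon>\<^sup>2" using that by (intro power_strict_mono) auto
      then show ?thesis by (simp add: \<theta>_def)
    qed
    show "\<theta> ((norm (x - a))\<^sup>2) = 0" if "\<epsilon> \<le> norm (x - a)"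
      using power_mono[OF that \<epsilon>, of 2] by (simp add: \<theta>_def)
  qed
qed

text \<open>The function is the squared positive part of 1 - w, where w is the squared positive part
  of |x|^2 - R^2. From radius R + 1 on, |x|^2 - R^2 is at least 1, hence w is too.\<close>

lemma cutoff_C1:
  fixes R :: real
  assumes R: "0 \<le> R"
  obtains \<xi> :: "'a::real_inner \<Rightarrow> real" and \<xi>' R' where
    "\<And>x. (\<xi> has_derivative blinfun_apply (\<xi>' x)) (at x)" "continuous_on UNIV \<xi>'"
    "\<And>x. norm x \<le> R \<Longrightarrow> \<xi> x = 1" "\<And>x. R' \<le> norm x \<Longrightarrow> \<xi> x = 0"
proof -
  define w where "w x = (max 0 (x - R\<^sup>2))\<^sup>2" for x :: real
  define \<theta> where "\<theta> x = (max 0 (- w x - - 1))\<^sup>2" for x :: real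
  define \<theta>' where "\<theta>' x = 2 * max 0 (- w x - - 1) * - (2 * max 0 (x - R\<^sup>2))" for x :: real
  have "(\<theta> has_real_derivative \<theta>' x) (at x)" for x
  proof -
    have "((\<lambda>x. - w x) has_real_derivative - (2 * max 0 (x - R\<^sup>2))) (at x)"
      unfolding w_def by (intro DERIV_minus has_real_derivative_pos_part_power2)
    from DERIV_chain2[OF has_real_derivative_pos_part_power2[of "- 1" "- w x"] this]
    show ?thesis by (simp add: \<theta>_def[abs_def] \<theta>'_def)
  qed
  moreover have "continuous_on UNIV \<theta>'"
    unfolding \<theta>'_def w_def by (intro continuous_intros)
  ultimately obtain \<xi>' where \<xi>':
    "\<And>x::'a. ((\<lambda>x. \<theta> ((norm (x - 0))\<^sup>2)) has_derivative blinfun_apply (\<xi>' x)) (at x)"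
    "continuous_on UNIV \<xi>'"
    using radial_C1 by blast
  show ?thesis
  proof (rule that[OF \<xi>'])
    fix x :: 'a
    show "\<theta> ((norm (x - 0))\<^sup>2) = 1" if "norm x \<le> R"
      using power_mono[OF that, of 2] by (simp add: \<theta>_def w_def)
    show "\<theta> ((norm (x - 0))\<^sup>2) = 0" if "R + 1 \<le> norm x"
    proof -
      have "(R + 1)\<^sup>2 \<le> (norm x)\<^sup>2" using that R by (intro power_mono) auto
      then have 1: "1 \<le> (norm x)\<^sup>2 - R\<^sup>2" using R by (simp add: power2_eq_square algebra_simps)
      then have "1 \<le> ((norm x)\<^sup>2 - R\<^sup>2)\<^sup>2" by (simp add: one_le_power)
      then show ?thesis using 1 by (simp add: \<theta>_def w_def)
    qed
  qed
qed

text \<open>The unitary group is compact, so cutting off in the frequency alone gives compact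
  support.\<close>

lemma C1c_test_product:
  fixes \<phi> \<xi> :: "complex^'n^'n \<Rightarrow> real"
  assumes \<phi>: "\<And>x. (\<phi> has_derivative blinfun_apply (\<phi>' x)) (at x)" "continuous_on UNIV \<phi>'"
    and \<xi>: "\<And>x. (\<xi> has_derivative blinfun_apply (\<xi>' x)) (at x)" "continuous_on UNIV \<xi>'"
    and K: "compact K" "\<And>x. x \<notin> K \<Longrightarrow> \<xi> x = 0"
  shows "C1c_test (\<lambda>p. \<phi> (fst p) * \<xi> (snd p))
    (\<lambda>p. \<phi> (fst p) *\<^sub>R (\<xi>' (snd p) o\<^sub>L snd_blinfun) + \<xi> (snd p) *\<^sub>R (\<phi>' (fst p) o\<^sub>L fst_blinfun))"
  unfolding C1c_test_def
proof (intro conjI ballI)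
  have c: "continuous_on UNIV \<phi>" "continuous_on UNIV \<xi>"
    using \<phi>(1) \<xi>(1) by (auto intro!: has_derivative_continuous_on)
  note cc = continuous_on_compose2[OF \<phi>(2) _ subset_UNIV] continuous_on_compose2[OF c(1) _ subset_UNIV]
     continuous_on_compose2[OF \<xi>(2) _ subset_UNIV] continuous_on_compose2[OF c(2) _ subset_UNIV]
  show "((\<lambda>p. \<phi> (fst p) * \<xi> (snd p)) has_derivative
      blinfun_apply (\<phi> (fst p) *\<^sub>R (\<xi>' (snd p) o\<^sub>L snd_blinfun) + \<xi> (snd p) *\<^sub>R (\<phi>' (fst p) o\<^sub>L fst_blinfun)))
      (at p within unitary_group \<times> skew_hermitian)" for p
    by (auto intro!: derivative_eq_intros has_derivative_compose[OF _ \<phi>(1)] has_derivative_compose[OF _ \<xi>(1)]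
        simp: blinfun.add_left blinfun.scaleR_left)
  show "continuous_on (unitary_group \<times> skew_hermitian)
    (\<lambda>p. \<phi> (fst p) *\<^sub>R (\<xi>' (snd p) o\<^sub>L snd_blinfun) + \<xi> (snd p) *\<^sub>R (\<phi>' (fst p) o\<^sub>L fst_blinfun))"
    by (intro continuous_intros cc)
  show "\<exists>C. compact C \<and> (\<forall>p\<in>unitary_group \<times> skew_hermitian - C. \<phi> (fst p) * \<xi> (snd p) = 0)"
  proof (intro exI conjI ballI)
    show "compact ((unitary_group :: (complex^'n^'n) set) \<times> K)"
      by (intro compact_Times compact_unitary_group K(1))
  qed (use K(2) in fastforce)
qed

lemma closed_skew_hermitian: "closed (skew_hermitian :: (complex^'n^'n) set)"
  unfolding skew_hermitian_def by (intro closed_Collect_eq continuous_intros)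

section \<open>Densities as Borel measures on all matrix pairs\<close>

locale unitary_phase_space =
  fixes \<mu> \<gamma> :: "(complex^'n^'n) measure"
  assumes haar: "haar_unitary \<mu>" and posdens: "positive_density_prob \<gamma>"
begin

abbreviation M :: "((complex^'n^'n) \<times> (complex^'n^'n)) measure" where
  "M \<equiv> \<mu> \<Otimes>\<^sub>M \<gamma>"

lemma sets_\<mu>: "sets \<mu> = sets (restrict_space borel unitary_group)"
  using haar by (simp add: haar_unitary_def)

lemma sets_\<gamma>: "sets \<gamma> = sets (restrict_space borel skew_hermitian)"
  using posdens by (auto simp: positive_density_prob_def skew_hermitian_lebesgue_def)

sublocale \<mu>: prob_space \<mu>
  using haar by (simp add: haar_unitary_def)

sublocale \<gamma>: prob_space \<gamma>
  using posdens by (simp add: positive_density_prob_def)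

sublocale MM: pair_prob_space \<mu> \<gamma> ..

lemma space_\<mu>: "space \<mu> = unitary_group"
  using sets_eq_imp_space_eq[OF sets_\<mu>] by (simp add: space_restrict_space)

lemma space_\<gamma>: "space \<gamma> = skew_hermitian"
  using sets_eq_imp_space_eq[OF sets_\<gamma>] by (simp add: space_restrict_space)

lemma space_M: "space M = unitary_group \<times> skew_hermitian"
  by (simp add: space_pair_measure space_\<mu> space_\<gamma>)

lemma measurable_id_\<mu>: "(\<lambda>x. x) \<in> measurable \<mu> borel"
  by (subst measurable_cong_sets[OF sets_\<mu> refl]) (simp add: measurable_restrict_space1)

lemma measurable_id_\<gamma>: "(\<lambda>x. x) \<in> measurable \<gamma> borel"
  by (subst measurable_cong_sets[OF sets_\<gamma> refl]) (simp add: measurable_restrict_space1)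

lemma measurable_id_M [measurable]: "(\<lambda>p. p) \<in> measurable M borel"
proof -
  have "(\<lambda>p. (fst p, snd p)) \<in> measurable M (borel \<Otimes>\<^sub>M borel)"
    by (intro measurable_Pair measurable_compose[OF measurable_fst measurable_id_\<mu>]
        measurable_compose[OF measurable_snd measurable_id_\<gamma>])
  then show ?thesis by (simp add: borel_prod)
qed

lemma borel_measurable_M: "f \<in> borel_measurable borel \<Longrightarrow> f \<in> borel_measurable M"
  using measurable_compose[OF measurable_id_M] by blast

text \<open>The density measure lives on the unitary and skew-Hermitian matrices only. Its image
  under the identity is a Borel measure on all matrix pairs, against which functions given on the
  whole space can be integrated without restriction.\<close>

definition law :: "((complex^'n^'n) \<times> (complex^'n^'n) \<Rightarrow> real) \<Rightarrow> ((complex^'n^'n) \<times> (complex^'n^'n)) measure" where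
  "law h = distr (density M (\<lambda>p. ennreal (h p))) borel (\<lambda>p. p)"

lemma sets_law [simp, measurable_cong]: "sets (law h) = sets borel"
  by (simp add: law_def)

lemma measurable_density_M: "(\<lambda>p. p) \<in> measurable (density M (\<lambda>p. ennreal (h p))) borel"
  using measurable_id_M by simp

lemma prob_space_law: "prob_density M h \<Longrightarrow> prob_space (law h)"
  unfolding law_def prob_density_def
  using measurable_density_M by (blast intro: prob_space.prob_space_distr)

lemma integral_law:
  fixes f :: "_ \<Rightarrow> 'b::{banach, second_countable_topology}"
  assumes "prob_density M h" and f: "f \<in> borel_measurable borel"
  shows "(\<integral>p. f p \<partial>law h) = (\<integral>p. h p *\<^sub>R f p \<partial>M)"
    and "integrable (law h) f \<longleftrightarrow> integrable M (\<lambda>p. h p *\<^sub>R f p)"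
  using assms unfolding law_def prob_density_def
  by (simp_all add: integral_distr[OF measurable_density_M] integrable_distr_eq[OF measurable_density_M]
      integral_density integrable_density borel_measurable_M)

lemma AE_law_iff:
  assumes "h \<in> borel_measurable M" "{p. P p} \<in> sets borel"
  shows "(AE p in law h. P p) \<longleftrightarrow> (AE p in M. 0 < h p \<longrightarrow> P p)"
  unfolding law_def using assms
  by (subst AE_distr_iff[OF measurable_density_M]) (simp_all add: AE_density)

lemma AE_law_space:
  assumes "h \<in> borel_measurable M"
  shows "AE p in law h. p \<in> unitary_group \<times> skew_hermitian"
proof (subst AE_law_iff[OF assms])
  show "{p. p \<in> unitary_group \<times> skew_hermitian} \<in> sets borel"
    unfolding Collect_mem_eq
    by (intro borel_closed closed_Times compact_imp_closed compact_unitary_group closed_skew_hermitian)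
  show "AE p in M. 0 < h p \<longrightarrow> p \<in> unitary_group \<times> skew_hermitian"
    by (rule AE_I2) (simp add: space_M)
qed

lemma law_cong:
  assumes "h \<in> borel_measurable M" "h' \<in> borel_measurable M" "AE p in M. h p = h' p"
  shows "law h = law h'"
proof -
  have "density M (\<lambda>p. ennreal (h p)) = density M (\<lambda>p. ennreal (h' p))"
    using assms by (intro density_cong) auto
  then show ?thesis by (simp add: law_def)
qed

lemma AE_law_support:
  assumes h: "h \<in> borel_measurable M"
  shows "AE p in law h. p \<in> density_support M h"
proof -
  have "AE p in law h. p \<notin> space M - density_support M h"
  proof (rule AE_Lindelof)
    fix x assume "x \<in> space M - density_support M h"
    then obtain T where T: "open T" "x \<in> T" "emeasure (density M (\<lambda>y. ennreal (h y))) (T \<inter> space M) = 0"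
      by (auto simp: density_support_def)
    have "emeasure (law h) T = 0"
      using T unfolding law_def by (subst emeasure_distr[OF measurable_density_M]) auto
    then have "T \<in> null_sets (law h)" using T(1) by (auto simp: null_sets_def)
    then have "AE p in law h. p \<notin> T" by (rule AE_not_in)
    with T show "\<exists>T. open T \<and> x \<in> T \<and> (AE y in law h. y \<notin> T)" by blast
  qed
  with AE_law_space[OF h] show ?thesis
    by eventually_elim (auto simp: space_M)
qed

text \<open>Over a set of states that is null for the marginal, Fubini makes the integral of the
  nonnegative \<open>h\<close> vanish, so \<open>h\<close> itself vanishes almost everywhere
  there.\<close>

lemma AE_law_marginal_support:
  assumes h: "prob_density M h"
  shows "AE p in law h. fst p \<in> density_support \<mu> (marginal \<gamma> h)"
proof -
  have hm [measurable]: "h \<in> borel_measurable M" and h0: "AE p in M. 0 \<le> h p"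
    using h by (auto simp: prob_density_def)
  have "integrable (law h) (\<lambda>_. 1::real)"
    using prob_space_law[OF h] by (simp add: prob_space_def finite_measure.integrable_const)
  then have hi: "integrable M h" using integral_law(2)[OF h, of "\<lambda>_. 1::real"] by simp
  have mm [measurable]: "marginal \<gamma> h \<in> borel_measurable \<mu>"
    unfolding marginal_def by (rule \<gamma>.borel_measurable_lebesgue_integral) simp
  have "AE p in law h. fst p \<notin> unitary_group - density_support \<mu> (marginal \<gamma> h)"
  proof (rule AE_Lindelof)
    fix x assume "x \<in> unitary_group - density_support \<mu> (marginal \<gamma> h)"
    then obtain T where T: "open T" "x \<in> T"
      "emeasure (density \<mu> (\<lambda>y. ennreal (marginal \<gamma> h y))) (T \<inter> space \<mu>) = 0"
      by (auto simp: density_support_def space_\<mu>)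
    have Tm [measurable]: "T \<inter> space \<mu> \<in> sets \<mu>"
      using measurable_sets[OF measurable_id_\<mu>, of T] T(1) by (simp add: Int_def)
    have "AE U in \<mu>. ennreal (marginal \<gamma> h U) * indicator (T \<inter> space \<mu>) U = 0"
      using T(3) by (subst (asm) emeasure_density) (simp_all add: nn_integral_0_iff_AE)
    \<comment> \<open>\<open>ennreal\<close> truncates negative values, so a null density gives only
      an upper bound for the marginal; together with h \<ge> 0 this is enough.\<close>
    then have neg: "AE U in \<mu>. indicator (T \<inter> space \<mu>) U * marginal \<gamma> h U \<le> 0"
      by eventually_elim (auto simp: indicator_def ennreal_eq_0_iff split: if_splits)
    have int: "integrable M (\<lambda>p. indicator (T \<inter> space \<mu>) (fst p) * h p)"
    proof (rule Bochner_Integration.integrable_bound[OF hi])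
      have [measurable]: "(\<lambda>p. indicator (T \<inter> space \<mu>) (fst p) :: real) \<in> borel_measurable M"
        by (rule measurable_compose[OF measurable_fst]) simp
      show "(\<lambda>p. indicator (T \<inter> space \<mu>) (fst p) * h p) \<in> borel_measurable M"
        by (intro borel_measurable_times) fact+
    qed (auto simp: indicator_def)
    have nonneg: "AE p in M. 0 \<le> indicator (T \<inter> space \<mu>) (fst p) * h p"
      using h0 by eventually_elim (simp add: indicator_def)
    have "(\<integral>p. indicator (T \<inter> space \<mu>) (fst p) * h p \<partial>M) =
      (\<integral>U. indicator (T \<inter> space \<mu>) U * marginal \<gamma> h U \<partial>\<mu>)"
      using MM.integral_fst'[OF int] by (simp add: marginal_def)
    also have "\<dots> \<le> 0"
    proof -
      have "0 \<le> (\<integral>U. - (indicator (T \<inter> space \<mu>) U * marginal \<gamma> h U) \<partial>\<mu>)"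
        by (rule integral_nonneg_AE) (use neg in eventually_elim, simp)
      then show ?thesis by simp
    qed
    finally have "(\<integral>p. indicator (T \<inter> space \<mu>) (fst p) * h p \<partial>M) = 0"
      using integral_nonneg_AE[OF nonneg] by simp
    then have "AE p in M. indicator (T \<inter> space \<mu>) (fst p) * h p = 0"
      using integral_nonneg_eq_0_iff_AE[OF int nonneg] by simp
    then have "AE p in M. 0 < h p \<longrightarrow> fst p \<notin> T"
      using AE_space[of M]
      by eventually_elim (auto simp: indicator_def space_M space_\<mu> split: if_splits)
    then have "AE p in law h. fst p \<notin> T"
    proof (subst AE_law_iff[OF hm])
      have "{p. fst p \<notin> T} = - (fst -` T)" by auto
      moreover have "open (fst -` T :: ((complex^'n^'n) \<times> (complex^'n^'n)) set)"
        using T(1) by (rule open_vimage_fst)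
      ultimately show "{p :: (complex^'n^'n) \<times> (complex^'n^'n). fst p \<notin> T} \<in> sets borel"
        by (metis borel_comp borel_open)
    qed
    with T show "\<exists>T. open T \<and> x \<in> T \<and> (AE y in law h. fst y \<notin> T)" by blast
  qed
  with AE_law_space[OF hm] show ?thesis
    by eventually_elim (auto simp: space_M)
qed

text \<open>K(V, U) is linear in V, so averaging it over the particles evaluates it at their mean;
  the factor U on the right then cancels against U^H.\<close>

lemma velocity_eq:
  assumes h: "prob_density M h" and U: "U \<in> unitary_group"
  shows "velocity \<mu> \<gamma> \<kappa> h U A = flow_velocity \<kappa> (\<integral>p. fst p \<partial>law h) (U, A)"
proof -
  interpret L: prob_space "law h" by (rule prob_space_law[OF h])
  have hm [measurable]: "h \<in> borel_measurable M" using h by (auto simp: prob_density_def)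
  define T where "T V = interaction V U" for V
  have "linear T"
    by (intro linearI) (simp_all add: T_def interaction_def matrix_mult.add_left matrix_mult.add_right ctranspose_add ctranspose_scaleR
        matrix_mult.scaleR_left matrix_mult.scaleR_right algebra_simps)
  then have T: "bounded_linear T" by (simp add: linear_conv_bounded_linear)
  have fst_int: "integrable (law h) fst"
  proof (rule L.integrable_const_bound)
    show "AE p in law h. norm (fst p) \<le> norm (mat 1 :: complex^'n^'n)"
      using AE_law_space[OF hm] by eventually_elim (auto simp: norm_unitary)
    have "fst \<in> borel_measurable (borel :: ((complex^'n^'n) \<times> (complex^'n^'n)) measure)"
      by (intro borel_measurable_continuous_onI continuous_intros)
    then show "fst \<in> borel_measurable (law h)"
      by (subst measurable_cong_sets[OF sets_law refl])
  qed
  have T_borel: "(\<lambda>p. T (fst p)) \<in> borel_measurable borel"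
    by (intro borel_measurable_continuous_onI bounded_linear.continuous_on[OF T] continuous_intros)
  have Ti: "integrable M (\<lambda>p. h p *\<^sub>R T (fst p))"
    using integral_law(2)[OF h T_borel] integrable_bounded_linear[OF T fst_int] by simp
  have "integrable (law h) (\<lambda>_. 1::real)" by simp
  then have hi: "integrable M h" using integral_law(2)[OF h, of "\<lambda>_. 1::real"] by simp
  have "T (\<integral>p. fst p \<partial>law h) = (\<integral>p. T (fst p) \<partial>law h)"
    by (rule integral_bounded_linear[OF T fst_int, symmetric])
  also have "\<dots> = (\<integral>p. h p *\<^sub>R T (fst p) \<partial>M)"
    by (rule integral_law(1)[OF h T_borel])
  also have "\<dots> = (\<integral>V. \<integral>B. h (V, B) *\<^sub>R T V \<partial>\<gamma> \<partial>\<mu>)"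
    using MM.integral_fst'[OF Ti] by simp
  also have "\<dots> = (\<integral>V. marginal \<gamma> h V *\<^sub>R T V \<partial>\<mu>)"
  proof (rule integral_cong_AE)
    have [measurable]: "T \<in> borel_measurable \<mu>"
      by (rule measurable_compose[OF measurable_id_\<mu>, of T])
        (intro borel_measurable_continuous_onI bounded_linear.continuous_on[OF T] continuous_intros)
    have [measurable]: "marginal \<gamma> h \<in> borel_measurable \<mu>"
      unfolding marginal_def by (rule \<gamma>.borel_measurable_lebesgue_integral) simp
    show "(\<lambda>V. marginal \<gamma> h V *\<^sub>R T V) \<in> borel_measurable \<mu>" by simp
    show "(\<lambda>V. \<integral>B. h (V, B) *\<^sub>R T V \<partial>\<gamma>) \<in> borel_measurable \<mu>"
      by (rule \<gamma>.borel_measurable_lebesgue_integral) simp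
    \<comment> \<open>Taking \<open>T V\<close> out of the inner integral uses integrability of
      \<open>h\<close> in the frequency, which Fubini grants for almost every V.\<close>
    show "AE V in \<mu>. (\<integral>B. h (V, B) *\<^sub>R T V \<partial>\<gamma>) = marginal \<gamma> h V *\<^sub>R T V"
      using MM.AE_integrable_fst'[OF hi] by eventually_elim (simp add: marginal_def)
  qed
  finally have eq: "(\<integral>V. marginal \<gamma> h V *\<^sub>R interaction V U \<partial>\<mu>) = interaction (\<integral>p. fst p \<partial>law h) U"
    by (simp add: T_def)
  show ?thesis
    unfolding velocity_def eq
    unfolding flow_velocity_def interaction_def
    by (simp add: matrix_mult.add_left matrix_mult.scaleR_left matrix_mult.diff_left
        unitary_groupD[OF U] flip: matrix_mul_assoc)
qed

end

section \<open>Weak solutions as mean-field flows\<close>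

context unitary_phase_space
begin

context
  fixes \<kappa> :: real and f0 f
  assumes sol: "weak_solution \<mu> \<gamma> \<kappa> f0 f" and f0: "prob_density M f0"
    and cpt: "compact (density_support M f0)"
begin

lemma dens: "0 \<le> t \<Longrightarrow> prob_density M (f t)"
  using sol by (simp add: weak_solution_def)

lemma dens_measurable: "0 \<le> t \<Longrightarrow> f t \<in> borel_measurable M"
  using dens by (simp add: prob_density_def)

lemma law_initial: "law (f 0) = law f0"
  using sol f0 dens_measurable[of 0]
  by (intro law_cong) (auto simp: weak_solution_def prob_density_def)

lemma integral_law_real:
  fixes \<phi> :: "_ \<Rightarrow> real"
  assumes "0 \<le> t" "continuous_on UNIV \<phi>"
  shows "(\<integral>p. \<phi> p * f t p \<partial>M) = (\<integral>p. \<phi> p \<partial>law (f t))"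
  using integral_law(1)[OF dens[OF assms(1)], of \<phi>] assms(2)
  by (simp add: borel_measurable_continuous_onI mult.commute)

lemma continuous_in_time:
  fixes \<phi> :: "_ \<Rightarrow> real"
  assumes c: "continuous_on UNIV \<phi>" and b: "bounded (\<phi> ` (unitary_group \<times> skew_hermitian))"
  shows "continuous_on {0..} (\<lambda>t. \<integral>p. \<phi> p \<partial>law (f t))"
proof -
  have "continuous_on {0..} (\<lambda>t. \<integral>p. \<phi> p * f t p \<partial>M)"
    using sol b continuous_on_subset[OF c] by (simp add: weak_solution_def)
  then show ?thesis
    by (rule continuous_on_eq) (simp add: integral_law_real c)
qed

lemma bounded_product:
  fixes g :: "complex^'n^'n \<Rightarrow> complex^'n^'n \<Rightarrow> real"
  assumes c: "continuous_on UNIV (\<lambda>p. g (fst p) (snd p))" and K: "compact K" "\<And>U A. A \<notin> K \<Longrightarrow> g U A = 0"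
  shows "bounded ((\<lambda>p. g (fst p) (snd p)) ` (unitary_group \<times> skew_hermitian))"
proof -
  have "compact ((\<lambda>p. g (fst p) (snd p)) ` (unitary_group \<times> K))"
    by (intro compact_continuous_image continuous_on_subset[OF c] compact_Times compact_unitary_group K(1)) auto
  then have "bounded (insert 0 ((\<lambda>p. g (fst p) (snd p)) ` (unitary_group \<times> K)))"
    by (simp add: compact_imp_bounded)
  then show ?thesis
    by (rule bounded_subset) (use K(2) in \<open>force\<close>)
qed

lemma bounded_state:
  fixes g :: "complex^'n^'n \<Rightarrow> real"
  assumes c: "continuous_on UNIV g"
  shows "bounded ((\<lambda>p. g (fst p)) ` (unitary_group \<times> skew_hermitian))"
proof -
  have "compact (g ` unitary_group)"
    by (intro compact_continuous_image continuous_on_subset[OF c] compact_unitary_group) auto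
  then have "bounded (g ` unitary_group)" by (rule compact_imp_bounded)
  then show ?thesis by (rule bounded_subset) auto
qed

text \<open>The transport moves U and leaves A fixed, so \<xi> is a passive weight: its derivative
  is evaluated at the zero frequency component of the velocity.\<close>

lemma weak_product:
  fixes \<phi> \<xi> :: "complex^'n^'n \<Rightarrow> real"
  assumes \<phi>: "\<And>x. (\<phi> has_derivative blinfun_apply (\<phi>' x)) (at x)" "continuous_on UNIV \<phi>'"
    and \<xi>: "\<And>x. (\<xi> has_derivative blinfun_apply (\<xi>' x)) (at x)" "continuous_on UNIV \<xi>'"
    and K: "compact K" "\<And>x. x \<notin> K \<Longrightarrow> \<xi> x = 0"
    and \<psi>: "smooth_time_test \<psi>"
  shows "- (LINT t:{0<..}|lborel. deriv \<psi> t * (\<integral>p. \<phi> (fst p) * \<xi> (snd p) \<partial>law (f t))) =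
    (LINT t:{0<..}|lborel. \<psi> t * (\<integral>p. \<xi> (snd p) *
      blinfun_apply (\<phi>' (fst p)) (flow_velocity \<kappa> (\<integral>p. fst p \<partial>law (f t)) p) \<partial>law (f t)))"
proof -
  have c: "continuous_on UNIV \<phi>" "continuous_on UNIV \<xi>"
    using \<phi>(1) \<xi>(1) by (auto intro!: has_derivative_continuous_on)
  note cc = continuous_on_compose2[OF \<phi>(2) _ subset_UNIV] continuous_on_compose2[OF c(1) _ subset_UNIV]
     continuous_on_compose2[OF \<xi>(2) _ subset_UNIV] continuous_on_compose2[OF c(2) _ subset_UNIV]
  define F where "F p = \<phi> (fst p) *\<^sub>R (\<xi>' (snd p) o\<^sub>L snd_blinfun) + \<xi> (snd p) *\<^sub>R (\<phi>' (fst p) o\<^sub>L fst_blinfun)"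
    for p :: "(complex^'n^'n) \<times> (complex^'n^'n)"
  have "C1c_test (\<lambda>p. \<phi> (fst p) * \<xi> (snd p)) F"
    unfolding F_def by (rule C1c_test_product[OF \<phi> \<xi> K])
  then have weak: "- (LINT t:{0<..}|lborel. deriv \<psi> t * (\<integral>p. \<phi> (fst p) * \<xi> (snd p) * f t p \<partial>M)) =
    (LINT t:{0<..}|lborel. \<psi> t *
      (\<integral>(U, A). blinfun_apply (F (U, A)) (velocity \<mu> \<gamma> \<kappa> (f t) U A, 0) * f t (U, A) \<partial>M))"
    using sol \<psi> unfolding weak_solution_def by blast
  have l: "(\<integral>p. \<phi> (fst p) * \<xi> (snd p) * f t p \<partial>M) = (\<integral>p. \<phi> (fst p) * \<xi> (snd p) \<partial>law (f t))" if "0 < t" for t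
    using that by (intro integral_law_real continuous_intros cc) auto
  have r: "(\<integral>(U, A). blinfun_apply (F (U, A)) (velocity \<mu> \<gamma> \<kappa> (f t) U A, 0) * f t (U, A) \<partial>M) =
    (\<integral>p. \<xi> (snd p) * blinfun_apply (\<phi>' (fst p)) (flow_velocity \<kappa> (\<integral>p. fst p \<partial>law (f t)) p) \<partial>law (f t))"
    if t: "0 < t" for t
  proof -
    have "(\<integral>(U, A). blinfun_apply (F (U, A)) (velocity \<mu> \<gamma> \<kappa> (f t) U A, 0) * f t (U, A) \<partial>M) =
      (\<integral>p. \<xi> (snd p) * blinfun_apply (\<phi>' (fst p)) (flow_velocity \<kappa> (\<integral>p. fst p \<partial>law (f t)) p) * f t p \<partial>M)"
      using velocity_eq[OF dens] t
      by (intro Bochner_Integration.integral_cong refl)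
        (auto simp: space_M F_def blinfun.add_left blinfun.scaleR_left blinfun.zero_right)
    also have "\<dots> = (\<integral>p. \<xi> (snd p) * blinfun_apply (\<phi>' (fst p)) (flow_velocity \<kappa> (\<integral>p. fst p \<partial>law (f t)) p) \<partial>law (f t))"
      using t by (intro integral_law_real continuous_intros cc) auto
    finally show ?thesis .
  qed
  have "(LINT t:{0<..}|lborel. deriv \<psi> t * (\<integral>p. \<phi> (fst p) * \<xi> (snd p) * f t p \<partial>M)) =
    (LINT t:{0<..}|lborel. deriv \<psi> t * (\<integral>p. \<phi> (fst p) * \<xi> (snd p) \<partial>law (f t)))"
    by (intro set_lebesgue_integral_cong) (auto simp: l)
  moreover have "(LINT t:{0<..}|lborel. \<psi> t *
      (\<integral>(U, A). blinfun_apply (F (U, A)) (velocity \<mu> \<gamma> \<kappa> (f t) U A, 0) * f t (U, A) \<partial>M)) =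
    (LINT t:{0<..}|lborel. \<psi> t * (\<integral>p. \<xi> (snd p) *
      blinfun_apply (\<phi>' (fst p)) (flow_velocity \<kappa> (\<integral>p. fst p \<partial>law (f t)) p) \<partial>law (f t)))"
    by (intro set_lebesgue_integral_cong) (auto simp: r)
  ultimately show ?thesis using weak by simp
qed

text \<open>Frequencies are constants of motion. For \<phi> = 1 the weak formulation says that the
  integral of \<xi>(A) has derivative 0; it starts at 0 for a bump \<xi> off the initial frequencies
  and stays 0. Compactness of the support makes its projection closed, so there is room for such a
  bump.\<close>

lemma AE_frequency_support:
  assumes t: "0 \<le> t"
  shows "AE p in law (f t). snd p \<in> snd ` density_support M f0"
proof -
  define S where "S = snd ` density_support M f0"
  have S: "closed S"
    unfolding S_def by (intro compact_imp_closed compact_continuous_image cpt continuous_intros)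
  interpret L: prob_space "law (f t)" by (rule prob_space_law[OF dens[OF t]])
  have "AE p in law (f t). snd p \<notin> - S"
  proof (rule AE_Lindelof)
    fix a assume "a \<in> - S"
    then obtain \<epsilon> where \<epsilon>: "0 < \<epsilon>" "ball a \<epsilon> \<subseteq> - S"
      using S open_contains_ball by blast
    obtain \<xi> :: "complex^'n^'n \<Rightarrow> real" and \<xi>' where
      \<xi>: "\<And>x. (\<xi> has_derivative blinfun_apply (\<xi>' x)) (at x)" "continuous_on UNIV \<xi>'"
      and \<xi>_pos: "\<And>x. norm (x - a) < \<epsilon> \<Longrightarrow> 0 < \<xi> x" and \<xi>_0: "\<And>x. \<epsilon> \<le> norm (x - a) \<Longrightarrow> \<xi> x = 0"
      using bump_C1[of \<epsilon> a] \<epsilon>(1) by auto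
    have c: "continuous_on UNIV \<xi>"
      using \<xi>(1) by (auto intro!: has_derivative_continuous_on)
    have cs: "continuous_on UNIV (\<lambda>p :: (complex^'n^'n) \<times> (complex^'n^'n). \<xi> (snd p))"
      by (intro continuous_on_compose2[OF c] continuous_intros) auto
    have z: "x \<notin> cball a \<epsilon> \<Longrightarrow> \<xi> x = 0" for x
      using \<xi>_0[of x] by (auto simp: dist_norm norm_minus_commute)
    have nn: "0 \<le> \<xi> x" for x using \<xi>_pos[of x] \<xi>_0[of x] by linarith
    define h where "h s = (\<integral>p. \<xi> (snd p) \<partial>law (f s))" for s
    have bdd: "bounded ((\<lambda>p :: (complex^'n^'n) \<times> (complex^'n^'n). \<xi> (snd p)) ` (unitary_group \<times> skew_hermitian))"
    proof (rule bounded_product[of "\<lambda>U A. \<xi> A"])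
      show "compact (cball a \<epsilon>)" by (rule compact_cball)
    qed (use cs z in auto)
    have hc: "continuous_on {0..} h"
      unfolding h_def by (rule continuous_in_time[OF cs bdd])
    have "(h has_real_derivative 0) (at s)" if "0 < s" for s
    proof (rule weak_derivative_imp_derivative[OF hc continuous_on_const _ that])
      fix \<psi> assume "smooth_time_test \<psi>"
      moreover have "((\<lambda>_. 1 :: real) has_derivative blinfun_apply 0) (at x)" for x :: "complex^'n^'n"
        by (simp add: zero_blinfun.rep_eq)
      ultimately show "- (LINT t:{0<..}|lborel. deriv \<psi> t * h t) = (LINT t:{0<..}|lborel. \<psi> t * 0)"
        using weak_product[OF _ _ \<xi> compact_cball[of a \<epsilon>] z, where \<phi> = "\<lambda>_. 1" and \<phi>' = "\<lambda>_. 0"]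
        by (simp add: h_def)
    qed
    then have "h t = h 0"
    proof (cases "t = 0")
      case False
      with t show ?thesis
        using \<open>\<And>s. 0 < s \<Longrightarrow> (h has_real_derivative 0) (at s)\<close>
        by (intro DERIV_isconst_end[of 0 t h]) (auto intro: continuous_on_subset[OF hc])
    qed simp
    also have "h 0 = 0"
    proof -
      have "AE p in law f0. \<xi> (snd p) = 0"
      proof -
        have "AE p in law f0. p \<in> density_support M f0"
          using f0 by (intro AE_law_support) (simp add: prob_density_def)
        then show ?thesis
        proof eventually_elim
          case (elim p)
          then have "snd p \<in> S" by (simp add: S_def)
          then have "snd p \<notin> ball a \<epsilon>" using \<epsilon>(2) by auto
          then show ?case by (intro \<xi>_0) (simp add: dist_norm norm_minus_commute)
        qed
      qed
      then show ?thesis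
        unfolding h_def law_initial by (rule integral_eq_zero_AE)
    qed
    finally have h0: "(\<integral>p. \<xi> (snd p) \<partial>law (f t)) = 0" by (simp add: h_def)
    have int: "integrable (law (f t)) (\<lambda>p. \<xi> (snd p))"
    proof -
      obtain B where B: "\<forall>p\<in>(unitary_group :: (complex^'n^'n) set) \<times> skew_hermitian. norm (\<xi> (snd p)) \<le> B"
        using bdd unfolding bounded_iff by blast
      show ?thesis
      proof (rule L.integrable_const_bound)
        show "AE p in law (f t). norm (\<xi> (snd p)) \<le> B"
          using AE_law_space[OF dens_measurable[OF t]] B by (auto elim!: eventually_mono)
        show "(\<lambda>p. \<xi> (snd p)) \<in> borel_measurable (law (f t))"
          by (subst measurable_cong_sets[OF sets_law refl]) (rule borel_measurable_continuous_onI[OF cs])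
      qed
    qed
    have "AE p in law (f t). \<xi> (snd p) = 0"
      using integral_nonneg_eq_0_iff_AE[OF int] h0 nn by simp
    then have "AE p in law (f t). snd p \<notin> ball a \<epsilon>"
    proof eventually_elim
      case (elim p)
      then show ?case using \<xi>_pos[of "snd p"] by (auto simp: dist_norm norm_minus_commute)
    qed
    with \<epsilon>(1) show "\<exists>T. open T \<and> a \<in> T \<and> (AE p in law (f t). snd p \<notin> T)"
      by (intro exI[of _ "ball a \<epsilon>"]) auto
  qed
  then show ?thesis by (simp add: S_def)
qed

lemma norm_frequency_le:
  assumes "A \<in> snd ` density_support M f0" "B \<in> snd ` density_support M f0"
  shows "norm (A - B) \<le> frequency_diameter \<mu> \<gamma> f0"
proof -
  define X where "X = {norm (A - B) | A B U V. (U, A) \<in> density_support M f0 \<and> (V, B) \<in> density_support M f0}"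
  obtain R where R: "\<And>p. p \<in> density_support M f0 \<Longrightarrow> norm p \<le> R"
    using compact_imp_bounded[OF cpt] bounded_iff by blast
  have "bdd_above X"
  proof (rule bdd_aboveI[of _ "R + R"])
    fix x assume "x \<in> X"
    then obtain A B U V where x: "x = norm (A - B)" "(U, A) \<in> density_support M f0" "(V, B) \<in> density_support M f0"
      by (auto simp: X_def)
    have "norm A \<le> R" "norm B \<le> R"
      by (rule order_trans[OF norm_snd_le R[OF x(2)]], rule order_trans[OF norm_snd_le R[OF x(3)]])
    then show "x \<le> R + R" unfolding x(1) using norm_triangle_ineq4[of A B] by linarith
  qed
  moreover have "norm (A - B) \<in> X" using assms by (force simp: X_def)
  ultimately show ?thesis
    unfolding frequency_diameter_def X_def[symmetric] by (rule cSup_upper[rotated])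
qed

text \<open>A test function of U alone is not compactly supported in A. A cut-off \<xi> equal to 1
  on the conserved set of frequencies makes it admissible without changing any integral against the
  law. To pass from the distributional to the classical derivative, the right side must moreover be
  continuous in time.\<close>

lemma mean_field_flow_law:
  assumes \<kappa>: "0 < \<kappa>" and \<alpha>: "0 \<le> frequency_diameter \<mu> \<gamma> f0"
  shows "mean_field_flow (\<lambda>t. law (f t)) (snd ` density_support M f0) \<kappa> (frequency_diameter \<mu> \<gamma> f0)"
proof (rule mean_field_flow.intro)
  define S where "S = snd ` density_support M f0"
  show cS: "compact (snd ` density_support M f0)"
    by (intro compact_continuous_image cpt continuous_intros)
  show "snd ` density_support M f0 \<subseteq> skew_hermitian"
    by (auto simp: density_support_def space_M)
  show "prob_space (law (f t))" if "0 \<le> t" for t using that by (intro prob_space_law dens)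
  show "sets (law (f t)) = sets borel" if "0 \<le> t" for t by simp
  show supp: "AE p in law (f t). p \<in> unitary_group \<times> snd ` density_support M f0" if t: "0 \<le> t" for t
    using AE_frequency_support[OF t] AE_law_space[OF dens_measurable[OF t]]
    by eventually_elim (auto simp: mem_Times_iff)
  show "norm (A - B) \<le> frequency_diameter \<mu> \<gamma> f0"
    if "A \<in> snd ` density_support M f0" "B \<in> snd ` density_support M f0" for A B
    by (rule norm_frequency_le[OF that])
  show "0 < \<kappa>" "0 \<le> frequency_diameter \<mu> \<gamma> f0" by fact+
  show cont: "continuous_on {0..} (\<lambda>t. \<integral>p. \<phi> (fst p) \<partial>law (f t))" if "continuous_on UNIV \<phi>"
    for \<phi> :: "complex^'n^'n \<Rightarrow> real"
    by (intro continuous_in_time bounded_state that continuous_on_compose2[OF that] continuous_intros) auto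
  fix \<phi> :: "complex^'n^'n \<Rightarrow> real" and \<phi>' and t :: real
  assume \<phi>: "\<And>U. (\<phi> has_derivative blinfun_apply (\<phi>' U)) (at U)" "continuous_on UNIV \<phi>'" and t: "0 < t"
  have c: "continuous_on UNIV \<phi>"
    using \<phi>(1) by (auto intro!: has_derivative_continuous_on)
  obtain R where R: "0 \<le> R" "\<And>A. A \<in> S \<Longrightarrow> norm A \<le> R"
    using compact_imp_bounded[OF cS] bounded_pos[of S] unfolding S_def by (metis less_imp_le)
  obtain \<xi> :: "complex^'n^'n \<Rightarrow> real" and \<xi>' R' where
    \<xi>: "\<And>x. (\<xi> has_derivative blinfun_apply (\<xi>' x)) (at x)" "continuous_on UNIV \<xi>'"
    and \<xi>_1: "\<And>x. norm x \<le> R \<Longrightarrow> \<xi> x = 1" and \<xi>_0: "\<And>x. R' \<le> norm x \<Longrightarrow> \<xi> x = 0"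
    using cutoff_C1[OF R(1)] by metis
  have c\<xi>: "continuous_on UNIV \<xi>"
    using \<xi>(1) by (auto intro!: has_derivative_continuous_on)
  have z: "x \<notin> cball 0 R' \<Longrightarrow> \<xi> x = 0" for x
    using \<xi>_0[of x] by auto
  note cc = continuous_on_compose2[OF \<phi>(2) _ subset_UNIV] continuous_on_compose2[OF c _ subset_UNIV]
    continuous_on_compose2[OF c\<xi> _ subset_UNIV]
  have AE1: "AE p in law (f s). \<xi> (snd p) = 1" if "0 \<le> s" for s
    using supp[OF that]
  proof eventually_elim
    case (elim p)
    then have "snd p \<in> S" by (simp add: S_def mem_Times_iff)
    then show ?case by (intro \<xi>_1 R(2))
  qed
  define m where "m s = (\<integral>p. fst p \<partial>law (f s))" for s
  define k where "k s = (\<integral>p. \<xi> (snd p) * blinfun_apply (\<phi>' (fst p)) (flow_velocity \<kappa> (m s) p) \<partial>law (f s))" for s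
  have integrable: "integrable (law (f s)) g"
    if "0 \<le> s" and g: "continuous_on UNIV g" for s and g :: "_ \<Rightarrow> 'b::{banach, second_countable_topology}"
  proof -
    interpret L: prob_space "law (f s)" by (rule prob_space_law[OF dens[OF that(1)]])
    have "compact (g ` (unitary_group \<times> snd ` density_support M f0))"
      by (intro compact_continuous_image compact_Times compact_unitary_group cS continuous_on_subset[OF g]) auto
    then obtain B where B: "\<forall>p\<in>unitary_group \<times> snd ` density_support M f0. norm (g p) \<le> B"
      using compact_imp_bounded bounded_iff by (metis image_eqI)
    show ?thesis
    proof (rule L.integrable_const_bound)
      show "AE p in law (f s). norm (g p) \<le> B"
        using supp[OF that(1)] B by (auto elim!: eventually_mono)
      show "g \<in> borel_measurable (law (f s))"
        by (subst measurable_cong_sets[OF sets_law refl]) (rule borel_measurable_continuous_onI[OF g])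
    qed
  qed
  \<comment> \<open>The integrand of \<open>k\<close> depends on time through the mean
    \<open>m s\<close>, so weak continuity does not apply to it directly. Expanding
    \<open>m s\<close> in a real basis separates the two time dependences into products of integrals
    of fixed functions. The drift term keeps \<xi> because weak continuity is granted for bounded
    functions and A is unbounded on phase space.\<close>
  have k_eq: "k s = (\<integral>p. \<xi> (snd p) * blinfun_apply (\<phi>' (fst p)) (snd p ** fst p) \<partial>law (f s)) +
      (\<kappa> / 2) * (\<Sum>b\<in>Basis. (\<integral>p. fst p \<bullet> b \<partial>law (f s)) *
        (\<integral>p. blinfun_apply (\<phi>' (fst p)) (b - fst p ** ctranspose b ** fst p) \<partial>law (f s)))"
    if s: "0 \<le> s" for s
  proof -
    have expand: "blinfun_apply (\<phi>' U) (m s - U ** ctranspose (m s) ** U) =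
      (\<Sum>b\<in>Basis. (m s \<bullet> b) * blinfun_apply (\<phi>' U) (b - U ** ctranspose b ** U))" for U
    proof -
      define T where "T V = blinfun_apply (\<phi>' U) (V - U ** ctranspose V ** U)" for V
      have "linear T"
        by (intro linearI) (simp_all add: T_def matrix_mult.add_left matrix_mult.add_right ctranspose_add ctranspose_scaleR
          matrix_mult.scaleR_left matrix_mult.scaleR_right algebra_simps blinfun.add_right blinfun.diff_right
          blinfun.scaleR_right)
      then have "T (m s) = (\<Sum>b\<in>Basis. (m s \<bullet> b) *\<^sub>R T b)"
        by (subst euclidean_representation[of "m s", symmetric]) (simp add: linear_sum linear_scale)
      then show ?thesis by (simp add: T_def)
    qed
    have mb: "m s \<bullet> b = (\<integral>p. fst p \<bullet> b \<partial>law (f s))" for b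
      unfolding m_def by (rule integral_inner_left[symmetric]) (intro integrable s continuous_intros)
    have "k s = (\<integral>p. \<xi> (snd p) * blinfun_apply (\<phi>' (fst p)) (snd p ** fst p) +
      (\<kappa> / 2) * (\<Sum>b\<in>Basis. (m s \<bullet> b) * blinfun_apply (\<phi>' (fst p)) (b - fst p ** ctranspose b ** fst p)) \<partial>law (f s))"
      unfolding k_def
    proof (rule integral_cong_AE)
      show "AE p in law (f s). \<xi> (snd p) * blinfun_apply (\<phi>' (fst p)) (flow_velocity \<kappa> (m s) p) =
        \<xi> (snd p) * blinfun_apply (\<phi>' (fst p)) (snd p ** fst p) +
        (\<kappa> / 2) * (\<Sum>b\<in>Basis. (m s \<bullet> b) * blinfun_apply (\<phi>' (fst p)) (b - fst p ** ctranspose b ** fst p))"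
        using AE1[OF s]
        by eventually_elim (simp add: flow_velocity_def expand[symmetric] blinfun.add_right blinfun.scaleR_right)
    qed (intro borel_measurable_integrable integrable s continuous_intros cc)+
    also have "\<dots> = (\<integral>p. \<xi> (snd p) * blinfun_apply (\<phi>' (fst p)) (snd p ** fst p) \<partial>law (f s)) +
      (\<integral>p. (\<kappa> / 2) * (\<Sum>b\<in>Basis. (m s \<bullet> b) * blinfun_apply (\<phi>' (fst p)) (b - fst p ** ctranspose b ** fst p)) \<partial>law (f s))"
      by (intro Bochner_Integration.integral_add integrable s continuous_intros cc)
    also have "(\<integral>p. (\<kappa> / 2) * (\<Sum>b\<in>Basis. (m s \<bullet> b) * blinfun_apply (\<phi>' (fst p)) (b - fst p ** ctranspose b ** fst p)) \<partial>law (f s)) =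
      (\<kappa> / 2) * (\<Sum>b\<in>Basis. (m s \<bullet> b) * (\<integral>p. blinfun_apply (\<phi>' (fst p)) (b - fst p ** ctranspose b ** fst p) \<partial>law (f s)))"
      by (subst integral_mult_right_zero, subst Bochner_Integration.integral_sum)
        (auto intro!: integrable s continuous_intros cc)
    finally show ?thesis by (simp add: mb)
  qed
  have kc: "continuous_on {0..} k"
  proof (rule continuous_on_eq)
    show "continuous_on {0..} (\<lambda>s. (\<integral>p. \<xi> (snd p) * blinfun_apply (\<phi>' (fst p)) (snd p ** fst p) \<partial>law (f s)) +
      (\<kappa> / 2) * (\<Sum>b\<in>Basis. (\<integral>p. fst p \<bullet> b \<partial>law (f s)) *
        (\<integral>p. blinfun_apply (\<phi>' (fst p)) (b - fst p ** ctranspose b ** fst p) \<partial>law (f s))))"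
    proof (intro continuous_on_add continuous_on_mult continuous_on_sum continuous_on_const)
      show "continuous_on {0..} (\<lambda>s. \<integral>p. \<xi> (snd p) * blinfun_apply (\<phi>' (fst p)) (snd p ** fst p) \<partial>law (f s))"
      proof (rule continuous_in_time)
        show *: "continuous_on UNIV (\<lambda>p. \<xi> (snd p) * blinfun_apply (\<phi>' (fst p)) (snd p ** fst p))"
          by (intro continuous_intros cc)
        show "bounded ((\<lambda>p. \<xi> (snd p) * blinfun_apply (\<phi>' (fst p)) (snd p ** fst p)) ` (unitary_group \<times> skew_hermitian))"
          by (rule bounded_product[of "\<lambda>U A. \<xi> A * blinfun_apply (\<phi>' U) (A ** U)", OF * compact_cball[of 0 R']])
            (simp add: z)
      qed
      show "continuous_on {0..} (\<lambda>s. \<integral>p. fst p \<bullet> b \<partial>law (f s))" for b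
        by (rule cont) (intro continuous_intros)
      show "continuous_on {0..} (\<lambda>s. \<integral>p. blinfun_apply (\<phi>' (fst p)) (b - fst p ** ctranspose b ** fst p) \<partial>law (f s))" for b
        by (rule cont[of "\<lambda>U. blinfun_apply (\<phi>' U) (b - U ** ctranspose b ** U)"]) (intro continuous_intros cc)
    qed
  qed (simp add: k_eq)
  define h where "h s = (\<integral>p. \<phi> (fst p) \<partial>law (f s))" for s
  have h_eq: "(\<integral>p. \<phi> (fst p) * \<xi> (snd p) \<partial>law (f s)) = h s" if s: "0 \<le> s" for s
    unfolding h_def
  proof (rule integral_cong_AE)
    show "AE p in law (f s). \<phi> (fst p) * \<xi> (snd p) = \<phi> (fst p)"
      using AE1[OF s] by eventually_elim simp
  qed (intro borel_measurable_integrable integrable s continuous_intros cc)+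
  have hk: "(h has_real_derivative k t) (at t)"
  proof (rule weak_derivative_imp_derivative[OF _ kc _ t])
    show "continuous_on {0..} h" unfolding h_def by (rule cont[OF c])
    fix \<psi> assume "smooth_time_test \<psi>"
    from weak_product[OF \<phi> \<xi> compact_cball[of 0 R'] z this]
    have "- (LINT t:{0<..}|lborel. deriv \<psi> t * (\<integral>p. \<phi> (fst p) * \<xi> (snd p) \<partial>law (f t))) =
      (LINT t:{0<..}|lborel. \<psi> t * k t)" by (simp add: k_def m_def)
    moreover have "(LINT t:{0<..}|lborel. deriv \<psi> t * (\<integral>p. \<phi> (fst p) * \<xi> (snd p) \<partial>law (f t))) =
      (LINT t:{0<..}|lborel. deriv \<psi> t * h t)"
      by (intro set_lebesgue_integral_cong) (auto simp: h_eq)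
    ultimately show "- (LINT t:{0<..}|lborel. deriv \<psi> t * h t) = (LINT t:{0<..}|lborel. \<psi> t * k t)"
      by simp
  qed
  have "k t = (\<integral>p. blinfun_apply (\<phi>' (fst p)) (flow_velocity \<kappa> (m t) p) \<partial>law (f t))"
    unfolding k_def
  proof (rule integral_cong_AE)
    show "AE p in law (f t). \<xi> (snd p) * blinfun_apply (\<phi>' (fst p)) (flow_velocity \<kappa> (m t) p) =
      blinfun_apply (\<phi>' (fst p)) (flow_velocity \<kappa> (m t) p)"
      using AE1[of t] t by (auto elim!: eventually_mono)
  qed (use t in \<open>intro borel_measurable_integrable integrable continuous_intros cc; simp\<close>)+
  with hk show "((\<lambda>t. \<integral>p. \<phi> (fst p) \<partial>law (f t)) has_real_derivative
    (\<integral>p. blinfun_apply (\<phi>' (fst p)) (flow_velocity \<kappa> (\<integral>p. fst p \<partial>law (f t)) p) \<partial>law (f t))) (at t)"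
    by (simp add: h_def[abs_def] m_def)
qed

end

end

section \<open>Practical synchronization\<close>

context unitary_phase_space
begin

lemma dispersion_eq:
  assumes dens: "prob_density M (f t)"
  shows "dispersion \<mu> \<gamma> f t = (\<integral>z. (norm (fst (fst z) - fst (snd z)))\<^sup>2 \<partial>(law (f t) \<Otimes>\<^sub>M law (f t)))"
proof -
  define h where "h = f t"
  define D where "D = density M (\<lambda>p. ennreal (h p))"
  have h [measurable]: "h \<in> borel_measurable M" and h0: "AE p in M. 0 \<le> h p" and pD: "prob_space D"
    using dens by (auto simp: prob_density_def h_def D_def)
  interpret D: prob_space D by (rule pD)
  interpret L: prob_space "law h" using dens by (simp add: h_def prob_space_law)
  let ?n = "\<lambda>z :: ((complex^'n^'n) \<times> (complex^'n^'n)) \<times> ((complex^'n^'n) \<times> (complex^'n^'n)).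
    (norm (fst (fst z) - fst (snd z)))\<^sup>2"
  have n [measurable]: "?n \<in> borel_measurable (borel \<Otimes>\<^sub>M borel)"
    unfolding borel_prod by (intro borel_measurable_continuous_onI continuous_intros)
  have idD: "(\<lambda>p. p) \<in> measurable D borel" by (simp add: D_def)
  have pp: "law h \<Otimes>\<^sub>M law h = distr (D \<Otimes>\<^sub>M D) (borel \<Otimes>\<^sub>M borel) (\<lambda>(x, y). (x, y))"
    unfolding law_def D_def[symmetric]
    by (rule pair_measure_distr[OF idD idD]) (use L.sigma_finite_measure_axioms in \<open>simp add: law_def D_def\<close>)
  have pd: "D \<Otimes>\<^sub>M D = density (M \<Otimes>\<^sub>M M) (\<lambda>(x, y). ennreal (h x) * ennreal (h y))"
    unfolding D_def
    by (rule pair_measure_density)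
      (use MM.P.sigma_finite_measure_axioms D.sigma_finite_measure_axioms in \<open>simp_all add: D_def\<close>)
  have "(\<integral>z. ?n z \<partial>(law h \<Otimes>\<^sub>M law h)) = (\<integral>z. ?n z \<partial>(D \<Otimes>\<^sub>M D))"
    unfolding pp
  proof (subst integral_distr)
    show "(\<lambda>(x, y). (x, y)) \<in> measurable (D \<Otimes>\<^sub>M D) (borel \<Otimes>\<^sub>M borel)"
      unfolding split_beta
      by (intro measurable_Pair measurable_compose[OF measurable_fst idD] measurable_compose[OF measurable_snd idD])
  qed (use n in \<open>simp_all add: split_beta\<close>)
  also have "\<dots> = (\<integral>z. (max 0 (h (fst z)) * max 0 (h (snd z))) *\<^sub>R ?n z \<partial>(M \<Otimes>\<^sub>M M))"
  proof -
    \<comment> \<open>A density is nonnegative only almost everywhere; \<open>ennreal\<close>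
      replaces it by its positive part, and the two are identified almost everywhere below.\<close>
    have "(\<lambda>(x, y). ennreal (h x) * ennreal (h y)) = (\<lambda>z. ennreal (max 0 (h (fst z)) * max 0 (h (snd z))))"
      by (auto simp: fun_eq_iff ennreal_mult ennreal_max_0)
    moreover have "?n \<in> borel_measurable (M \<Otimes>\<^sub>M M)"
    proof -
      have "(\<lambda>z. (fst z, snd z)) \<in> measurable (M \<Otimes>\<^sub>M M) (borel \<Otimes>\<^sub>M borel)"
        by (intro measurable_Pair measurable_compose[OF measurable_fst measurable_id_M]
            measurable_compose[OF measurable_snd measurable_id_M])
      from measurable_compose[OF this n] show ?thesis by simp
    qed
    ultimately show ?thesis
      unfolding pd by (simp only:) (rule integral_density; simp)
  qed
  also have "\<dots> = (\<integral>z. ?n z * h (fst z) * h (snd z) \<partial>(M \<Otimes>\<^sub>M M))"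
  proof (rule integral_cong_AE)
    show "AE z in M \<Otimes>\<^sub>M M. (max 0 (h (fst z)) * max 0 (h (snd z))) *\<^sub>R ?n z = ?n z * h (fst z) * h (snd z)"
      using MM.P.AE_pair_fst[OF h0] MM.P.AE_pair_snd[OF h0] by eventually_elim simp
    have "(\<lambda>z. (fst z, snd z)) \<in> measurable (M \<Otimes>\<^sub>M M) (borel \<Otimes>\<^sub>M borel)"
      by (intro measurable_Pair measurable_compose[OF measurable_fst measurable_id_M]
          measurable_compose[OF measurable_snd measurable_id_M])
    from measurable_compose[OF this n] have [measurable]: "?n \<in> borel_measurable (M \<Otimes>\<^sub>M M)" by simp
    show "(\<lambda>z. (max 0 (h (fst z)) * max 0 (h (snd z))) *\<^sub>R ?n z) \<in> borel_measurable (M \<Otimes>\<^sub>M M)"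
      by (intro borel_measurable_scaleR borel_measurable_times borel_measurable_max borel_measurable_const
          measurable_compose[OF measurable_fst h] measurable_compose[OF measurable_snd h]) fact
    show "(\<lambda>z. ?n z * h (fst z) * h (snd z)) \<in> borel_measurable (M \<Otimes>\<^sub>M M)"
      by (intro borel_measurable_times
          measurable_compose[OF measurable_fst h] measurable_compose[OF measurable_snd h]) fact
  qed
  also have "\<dots> = dispersion \<mu> \<gamma> f t"
    unfolding dispersion_def h_def by (intro Bochner_Integration.integral_cong refl) (auto split: prod.split)
  finally show ?thesis by (simp add: h_def)
qed

lemma AE_initial_diameter:
  assumes h: "prob_density M h"
  shows "AE z in law h \<Otimes>\<^sub>M law h. norm (fst (fst z) - fst (snd z)) \<le> initial_diameter \<mu> \<gamma> h"
proof -
  interpret L: prob_space "law h" by (rule prob_space_law[OF h])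
  define X where "X = {norm (U - V) | U V. U \<in> density_support \<mu> (marginal \<gamma> h) \<and>
    V \<in> density_support \<mu> (marginal \<gamma> h)}"
  have "bdd_above X"
  proof (rule bdd_aboveI[of _ "norm (mat 1 :: complex^'n^'n) + norm (mat 1 :: complex^'n^'n)"])
    fix x assume "x \<in> X"
    then obtain U V :: "complex^'n^'n" where x: "x = norm (U - V)" "U \<in> unitary_group" "V \<in> unitary_group"
      by (auto simp: X_def density_support_def space_\<mu>)
    then show "x \<le> norm (mat 1 :: complex^'n^'n) + norm (mat 1 :: complex^'n^'n)"
      using norm_triangle_ineq4[of U V] norm_unitary[OF x(2)] norm_unitary[OF x(3)] by simp
  qed
  note upper = cSup_upper[OF _ this]
  show ?thesis
    using L.AE_pair_fst[OF AE_law_marginal_support[OF h]] L.AE_pair_snd[OF AE_law_marginal_support[OF h]]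
  proof eventually_elim
    case (elim z)
    then have "norm (fst (fst z) - fst (snd z)) \<in> X" by (auto simp: X_def)
    from upper[OF this] show ?case by (simp add: initial_diameter_def X_def)
  qed
qed

lemma dispersion_le:
  assumes sol: "weak_solution \<mu> \<gamma> \<kappa> f0 f" and f0: "prob_density M f0"
    and cpt: "compact (density_support M f0)"
    and \<kappa>: "0 < \<kappa>" and \<alpha>: "0 \<le> frequency_diameter \<mu> \<gamma> f0"
    and D: "0 < initial_diameter \<mu> \<gamma> f0" "(initial_diameter \<mu> \<gamma> f0)\<^sup>2 < 2"
    and strong: "frequency_diameter \<mu> \<gamma> f0
      \<le> \<kappa> * initial_diameter \<mu> \<gamma> f0 * (1 - (initial_diameter \<mu> \<gamma> f0)\<^sup>2 / 2)"
    and t: "0 \<le> t"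
  defines "c \<equiv> \<kappa> * (1 - (initial_diameter \<mu> \<gamma> f0)\<^sup>2 / 2)"
  shows "dispersion \<mu> \<gamma> f t \<le> dispersion \<mu> \<gamma> f 0 * exp (- (c * t)) + (frequency_diameter \<mu> \<gamma> f0 / c)\<^sup>2"
proof -
  interpret flow: mean_field_flow "\<lambda>t. law (f t)" "snd ` density_support M f0" \<kappa> "frequency_diameter \<mu> \<gamma> f0"
    by (rule mean_field_flow_law[OF sol f0 cpt \<kappa> \<alpha>])
  have "AE z in flow.pairs 0. flow.sqd z \<le> (initial_diameter \<mu> \<gamma> f0)\<^sup>2"
    using AE_initial_diameter[OF f0] unfolding law_initial[OF sol f0 cpt]
    by eventually_elim (simp add: flow.sqd_def power_mono)
  from flow.dispersion_bound[OF D strong this t]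
  show ?thesis
    using dispersion_eq[of f t, OF dens[OF sol f0 cpt t]]
      dispersion_eq[of f 0, OF dens[OF sol f0 cpt order_refl]]
    by (simp add: flow.sqd_def c_def)
qed

end

section \<open>The cubic that defines \<open>zeta2\<close>\<close>

lemma finite_zeta2_roots: "finite {x :: real. 1 / 2 * x ^ 3 - x + \<eta> = 0}"
proof -
  have "{x :: real. 1 / 2 * x ^ 3 - x + \<eta> = 0} = {x. poly [:\<eta>, -1, 0, 1 / 2:] x = 0}"
    by (simp add: power3_eq_cube algebra_simps)
  then show ?thesis using poly_roots_finite[of "[:\<eta>, -1, 0, 1 / 2:]"] by simp
qed

text \<open>A positive root x satisfies x (1 - x^2/2) = \<eta> > 0, so x^2 < 2.\<close>

lemma less_zeta2_imp:
  assumes \<eta>: "0 < \<eta>" and D: "0 < D" "D < zeta2 \<eta>"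
  shows "D\<^sup>2 < 2"
proof -
  let ?g = "\<lambda>x::real. 1 / 2 * x ^ 3 - x + \<eta>"
  \<comment> \<open>\<open>Max\<close> is a root only if there is one. At 0 the cubic equals \<eta>;
    at -(\<eta> + 2) it is at most -2 because (\<eta> + 2)^3 \<ge> 4 (\<eta> + 2).\<close>
  have "\<exists>x. - (\<eta> + 2) \<le> x \<and> x \<le> 0 \<and> ?g x = 0"
  proof (rule IVT')
    have "4 * (\<eta> + 2) \<le> (\<eta> + 2) * (\<eta> + 2) * (\<eta> + 2)"
      using \<eta> by (intro mult_right_mono) (auto simp: algebra_simps)
    then show "?g (- (\<eta> + 2)) \<le> 0" by (simp add: power3_eq_cube algebra_simps)
  qed (use \<eta> in \<open>auto intro!: continuous_intros\<close>)
  then have "zeta2 \<eta> \<in> {x. ?g x = 0}"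
    unfolding zeta2_def by (intro Max_in finite_zeta2_roots) auto
  then have root: "zeta2 \<eta> * (1 - (zeta2 \<eta>)\<^sup>2 / 2) = \<eta>"
    by (simp add: power3_eq_cube power2_eq_square algebra_simps)
  have "(zeta2 \<eta>)\<^sup>2 < 2"
  proof (rule ccontr)
    assume "\<not> (zeta2 \<eta>)\<^sup>2 < 2"
    then have "zeta2 \<eta> * (1 - (zeta2 \<eta>)\<^sup>2 / 2) \<le> 0"
      using D by (intro mult_nonneg_nonpos) auto
    then show False using root \<eta> by simp
  qed
  moreover have "D\<^sup>2 < (zeta2 \<eta>)\<^sup>2" using D by (intro power_strict_mono) auto
  ultimately show ?thesis by simp
qed

text \<open>The cubic is negative at D and equals \<eta> > 0 at sqrt 2, so it has a root beyond
  D.\<close>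

lemma less_zeta2_if:
  assumes D: "0 < D" "D\<^sup>2 < 2" and \<eta>: "0 < \<eta>" "\<eta> < D * (1 - D\<^sup>2 / 2)"
  shows "D < zeta2 \<eta>"
proof -
  let ?g = "\<lambda>x::real. 1 / 2 * x ^ 3 - x + \<eta>"
  have gD: "?g D < 0" using \<eta>(2) by (simp add: power3_eq_cube power2_eq_square algebra_simps)
  have "\<exists>x. D \<le> x \<and> x \<le> sqrt 2 \<and> ?g x = 0"
  proof (rule IVT')
    show "0 \<le> ?g (sqrt 2)" using \<eta>(1) by (simp add: power3_eq_cube)
    show "D \<le> sqrt 2" using D by (simp add: real_le_rsqrt)
  qed (use gD in \<open>auto intro!: continuous_intros\<close>)
  then obtain x where x: "D \<le> x" "?g x = 0" by blast
  have "x \<noteq> D" using x gD by auto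
  with x(1) have "D < x" by simp
  also have "x \<le> zeta2 \<eta>"
    unfolding zeta2_def using x(2) by (intro Max_ge finite_zeta2_roots) simp
  finally show ?thesis .
qed

theorem theorem5p1:
  fixes \<mu> \<gamma> :: "(complex^'n^'n) measure"
    and f0 :: "(complex^'n^'n) \<times> (complex^'n^'n) \<Rightarrow> real"
    and f :: "real \<Rightarrow> real \<Rightarrow> (complex^'n^'n) \<times> (complex^'n^'n) \<Rightarrow> real"
  assumes "haar_unitary \<mu>"
    and "positive_density_prob \<gamma>"
    and "prob_density (\<mu> \<Otimes>\<^sub>M \<gamma>) f0"
    and "compact (density_support (\<mu> \<Otimes>\<^sub>M \<gamma>) f0)"
    and "\<exists>\<kappa>. admissible_coupling \<mu> \<gamma> f0 \<kappa>"
    and "\<And>\<kappa>. admissible_coupling \<mu> \<gamma> f0 \<kappa> \<Longrightarrow> weak_solution \<mu> \<gamma> \<kappa> f0 (f \<kappa>)"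
  shows "((\<lambda>\<kappa>. Limsup at_top (\<lambda>t. ereal (dispersion \<mu> \<gamma> (f \<kappa>) t))) \<longlongrightarrow> 0) at_top"
proof -
  interpret unitary_phase_space \<mu> \<gamma> by unfold_locales (use assms in auto)
  define D where "D = initial_diameter \<mu> \<gamma> f0"
  define \<alpha> where "\<alpha> = frequency_diameter \<mu> \<gamma> f0"
  define b where "b = 1 - D\<^sup>2 / 2"
  define C where "C = ((3::real) / 2) powr (3 / 2)"
  obtain \<kappa>0 where "admissible_coupling \<mu> \<gamma> f0 \<kappa>0" using assms(5) by blast
  then have \<kappa>0: "C * \<alpha> < \<kappa>0" "0 < C * \<alpha>" "0 < D" "D < zeta2 (\<alpha> / \<kappa>0)"
    by (simp_all add: admissible_coupling_def D_def \<alpha>_def C_def)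
  have "0 < C" by (simp add: C_def)
  with \<kappa>0 have \<alpha>: "0 < \<alpha>" by (simp add: zero_less_mult_iff)
  have "0 < \<kappa>0" using \<kappa>0 by linarith
  \<comment> \<open>The existence of one admissible coupling is turned here into a property of D
    that no longer mentions the coupling.\<close>
  with \<alpha> have D: "0 < D" "D\<^sup>2 < 2" using less_zeta2_imp[of "\<alpha> / \<kappa>0" D] \<kappa>0 by auto
  have b: "0 < b" using D by (simp add: b_def)
  define L where "L \<kappa> = Limsup at_top (\<lambda>t. ereal (dispersion \<mu> \<gamma> (f \<kappa>) t))" for \<kappa>
  \<comment> \<open>Above the first bound the coupling beats the frequency spread as admissibility
    demands; above the second the diameter is preserved and D also stays below \<open>zeta2\<close>.
    So every larger coupling is admissible and has a solution to work with.\<close>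
  define K where "K = max (C * \<alpha>) (\<alpha> / (D * b))"
  have bounds: "0 \<le> L \<kappa> \<and> L \<kappa> \<le> ereal ((\<alpha> / (\<kappa> * b))\<^sup>2)" if "K < \<kappa>" for \<kappa>
  proof
    have \<kappa>: "C * \<alpha> < \<kappa>" "\<alpha> / (D * b) < \<kappa>" using that by (auto simp: K_def)
    then have \<kappa>_pos: "0 < \<kappa>" using \<kappa>0(2) by linarith
    have strong: "\<alpha> < \<kappa> * (D * b)"
      using \<kappa>(2) D b by (simp add: pos_divide_less_eq)
    then have "\<alpha> / \<kappa> < D * b" using \<kappa>_pos by (simp add: pos_divide_less_eq mult.commute)
    then have "D < zeta2 (\<alpha> / \<kappa>)"
      using less_zeta2_if[OF D, of "\<alpha> / \<kappa>"] \<alpha> \<kappa>_pos by (simp add: b_def)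
    then have "admissible_coupling \<mu> \<gamma> f0 \<kappa>"
      using \<kappa>(1) \<kappa>0 by (simp add: admissible_coupling_def D_def \<alpha>_def C_def)
    then have sol: "weak_solution \<mu> \<gamma> \<kappa> f0 (f \<kappa>)" by (rule assms(6))
    have le: "dispersion \<mu> \<gamma> (f \<kappa>) t \<le>
      dispersion \<mu> \<gamma> (f \<kappa>) 0 * exp (- (\<kappa> * b * t)) + (\<alpha> / (\<kappa> * b))\<^sup>2" if "0 \<le> t" for t
      using dispersion_le[OF sol assms(3,4) \<kappa>_pos _ _ _ _ that] \<alpha> D strong
      by (simp add: \<alpha>_def D_def b_def mult.assoc)
    have "L \<kappa> \<le> Limsup at_top (\<lambda>t. ereal (dispersion \<mu> \<gamma> (f \<kappa>) 0 * exp (- (\<kappa> * b * t)) + (\<alpha> / (\<kappa> * b))\<^sup>2))"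
      unfolding L_def using le
      by (intro Limsup_mono eventually_mono[OF eventually_ge_at_top[of 0]]) auto
    also have "\<dots> = ereal ((\<alpha> / (\<kappa> * b))\<^sup>2)"
    proof (rule lim_imp_Limsup)
      have "((\<lambda>t. exp (- (\<kappa> * b * t))) \<longlongrightarrow> 0) at_top"
        using \<kappa>_pos b by real_asymp
      then have "((\<lambda>t. dispersion \<mu> \<gamma> (f \<kappa>) 0 * exp (- (\<kappa> * b * t)) + (\<alpha> / (\<kappa> * b))\<^sup>2) \<longlongrightarrow>
        dispersion \<mu> \<gamma> (f \<kappa>) 0 * 0 + (\<alpha> / (\<kappa> * b))\<^sup>2) at_top"
        by (intro tendsto_intros)
      then show "((\<lambda>t. ereal (dispersion \<mu> \<gamma> (f \<kappa>) 0 * exp (- (\<kappa> * b * t)) + (\<alpha> / (\<kappa> * b))\<^sup>2)) \<longlongrightarrow>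
        ereal ((\<alpha> / (\<kappa> * b))\<^sup>2)) at_top"
        by simp
    qed simp
    finally show "L \<kappa> \<le> ereal ((\<alpha> / (\<kappa> * b))\<^sup>2)" .
    have "0 \<le> dispersion \<mu> \<gamma> (f \<kappa>) t" if "0 \<le> t" for t
      using dispersion_eq[of "f \<kappa>" t] dens[OF sol assms(3,4) that] by simp
    then have "Limsup at_top (\<lambda>t::real. 0::ereal) \<le> L \<kappa>"
      unfolding L_def
      by (intro Limsup_mono eventually_mono[OF eventually_ge_at_top[of 0]]) auto
    then show "0 \<le> L \<kappa>" by (simp add: Limsup_const)
  qed
  have "((\<lambda>\<kappa>. (\<alpha> / b * inverse \<kappa>)\<^sup>2) \<longlongrightarrow> (\<alpha> / b * 0)\<^sup>2) at_top"
    by (intro tendsto_intros tendsto_inverse_0_at_top filterlim_ident)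
  then have "((\<lambda>\<kappa>. (\<alpha> / (\<kappa> * b))\<^sup>2) \<longlongrightarrow> 0) at_top"
    by (simp add: divide_inverse mult_ac)
  then have lim: "((\<lambda>\<kappa>. ereal ((\<alpha> / (\<kappa> * b))\<^sup>2)) \<longlongrightarrow> 0) at_top"
    by (simp add: zero_ereal_def)
  have "(L \<longlongrightarrow> 0) at_top"
    by (rule tendsto_sandwich[OF _ _ tendsto_const lim])
      (use bounds in \<open>auto intro: eventually_mono[OF eventually_gt_at_top[of K]]\<close>)
  then show ?thesis by (simp add: L_def[abs_def])
qed

end
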